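(* Let $0<q_0<p_0<\infty$ and let $\mathfrak F$ be a family of pairs $(f,g)$ of non-negative measurable functions on $\mathbb R^n$ (not identically zero). Suppose that for every $w\in A_1$, $$\Big(\int_{\mathbb R^n}f(x)^{p_0}w(x)\,dx\Big)^{1/p_0}\le C\Big(\int_{\mathbb R^n}g(x)^{q_0}w(x)^{q_0/p_0}\,dx\Big)^{1/q_0}\quad\text{for all }(f,g)\in\mathfrak F \text{ with finite left-hand side},$$ where $C$ depends only on $p_0,q_0$ and $[w]_{A_1}$. Then for every $\vec q=(q_1,\dots,q_n)$ with $q_0<q_i<\frac{p_0q_0}{p_0-q_0}$ for all $i$, and $\vec p$ defined by $\frac1{q_i}-\frac1{p_i}=\frac1{q_0}-\frac1{p_0}$, there is a constant $C'$ with $\|f\|_{L^{\vec p}}\le C'\|g\|_{L^{\vec q}}$ for all $(f,g)\in\mathfrak F$ with $\|f\|_{L^{\vec p}}<\infty$.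
   Context: For $\vec q=(q_1,\dots,q_n)\in(0,\infty]^n$ and a measurable $f$ on $\mathbb{R}^n$, the mixed Lebesgue norm is $\|f\|_{L^{\vec q}}=\big(\int_{\mathbb R}\cdots\big(\int_{\mathbb R}\big(\int_{\mathbb R}|f(x_1,\dots,x_n)|^{q_1}dx_1\big)^{q_2/q_1}dx_2\big)^{q_3/q_2}\cdots dx_n\big)^{1/q_n}$. A non-negative locally integrable $w$ is an $A_1$ weight if there is $C>0$ with $\frac1{|B|}\int_B w(y)dy\le Cw(x)$ for a.e. $x\in B$, for every ball $B$; $[w]_{A_1}$ is the infimum of such $C$. *)

theory Defs
  imports "HOL-Analysis.Analysis"
begin

text \<open>Points of R^n are represented as functions nat => real whose coordinates
  0,...,n-1 are the coordinates x_1,...,x_n (extensional: undefined outside {..<n}).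
  Lebesgue measure on R^n is the completion of the n-fold product of Lebesgue-Borel measure.\<close>

definition Rn :: "nat \<Rightarrow> (nat \<Rightarrow> real) measure" where
  "Rn n = completion (PiM {..<n} (\<lambda>_. lborel))"

text \<open>Power of a non-negative extended real with a positive real exponent (infinity stays infinity).\<close>
definition epowr :: "ennreal \<Rightarrow> real \<Rightarrow> ennreal" where
  "epowr x r = (if x = \<infinity> then \<infinity> else ennreal (enn2real x powr r))"

definition eball :: "nat \<Rightarrow> (nat \<Rightarrow> real) \<Rightarrow> real \<Rightarrow> (nat \<Rightarrow> real) set" where
  "eball n x r = {y \<in> space (Rn n). sqrt (\<Sum>i<n. (y i - x i)^2) < r}"

definition A1_cond :: "nat \<Rightarrow> ((nat \<Rightarrow> real) \<Rightarrow> real) \<Rightarrow> real \<Rightarrow> bool" where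
  "A1_cond n w C \<longleftrightarrow> (\<forall>x\<in>space (Rn n). \<forall>r>0.
      AE y in Rn n. y \<in> eball n x r \<longrightarrow>
        (1 / measure (Rn n) (eball n x r)) * (\<integral>z\<in>eball n x r. w z \<partial>Rn n) \<le> C * w y)"

definition A1_weight :: "nat \<Rightarrow> ((nat \<Rightarrow> real) \<Rightarrow> real) \<Rightarrow> bool" where
  "A1_weight n w \<longleftrightarrow> w \<in> borel_measurable (Rn n) \<and> (\<forall>x\<in>space (Rn n). 0 \<le> w x)
     \<and> (\<forall>x\<in>space (Rn n). \<forall>r>0. set_integrable (Rn n) (eball n x r) w)
     \<and> (\<exists>C>0. A1_cond n w C)"

definition A1_const :: "nat \<Rightarrow> ((nat \<Rightarrow> real) \<Rightarrow> real) \<Rightarrow> real" where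
  "A1_const n w = Inf {C. C > 0 \<and> A1_cond n w C}"

text \<open>Iterated mixed norm: after integrating out the first k coordinates
  (coordinate i with exponent q i), as a function of the remaining point.\<close>
fun mixed_partial :: "(nat \<Rightarrow> real) \<Rightarrow> ((nat \<Rightarrow> real) \<Rightarrow> real) \<Rightarrow> nat \<Rightarrow> (nat \<Rightarrow> real) \<Rightarrow> ennreal" where
  "mixed_partial q f 0 x = ennreal \<bar>f x\<bar>"
| "mixed_partial q f (Suc k) x =
     epowr (\<integral>\<^sup>+ t. epowr (mixed_partial q f k (x(k := t))) (q k) \<partial>lborel) (1 / q k)"

definition mixed_norm :: "nat \<Rightarrow> (nat \<Rightarrow> real) \<Rightarrow> ((nat \<Rightarrow> real) \<Rightarrow> real) \<Rightarrow> ennreal" where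
  "mixed_norm n q f = mixed_partial q f n (\<lambda>_. undefined)"

end

theory Submission
  imports Defs
begin

text \<open>By duality the mixed norm of \<open>f powr p0\<close> is tested against a function \<open>h\<close> of unit norm in
  the dual mixed space, and the weighted hypothesis applies once \<open>h\<close> is majorized by an \<open>A\<^sub>1\<close>
  weight \<open>W\<close> of finite norm in that space; Hoelder's inequality then returns the mixed norm of \<open>g\<close>.
  The majorant is obtained by Rubio de Francia's iteration of the one-dimensional maximal
  functions in the coordinate directions: a weight that is \<open>A\<^sub>1\<close> in each coordinate separately,
  uniformly in the others, is \<open>A\<^sub>1\<close> with respect to balls.  The boundedness of the \<open>j\<close>-th maximal
  function on the mixed norm in the first \<open>j\<close> coordinates follows by induction on the number of
  these coordinates: Fubini gives the exponent of the last one, and the one-dimensional weighted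
  extrapolation theorem gives all others.

  Since the constant \<open>\<Phi>\<close> of the hypothesis is an arbitrary (not necessarily bounded or monotone)
  function of the \<open>A\<^sub>1\<close> constant, only one weight may be used for the whole family.  If no
  \<open>C'\<close> existed, there would be a sequence of pairs violating the estimate with rapidly growing
  constants; \<open>W\<close> is then chosen to majorize all the dual functions of the sequence at once, with
  geometrically decreasing factors.\<close>

text \<open>Put r_i = p_i/p0 and s_i = q_i/q0, all above 1. Duality for f^p0 asks for W in the mixed
  space with exponents r_i', while Hoelder's inequality for g^q0 against W^(q0/p0) asks for W in the
  one with exponents (q0/p0) s_i'. The relation between p and q says precisely that these agree, so
  one norm of W serves both sides.

  The obstacle is a maximal function in coordinate j taken inside norms of earlier coordinates with
  different exponents. Later coordinates need only monotonicity of the norm; earlier ones can be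
  exchanged with coordinate j only at equal exponents, which forces weights into a problem that has
  none.

  All norms take values in [0,\<infinity>] and majorants may be infinite on null sets. This keeps
  the coordinatewise A_1 inequality true at every point, so that it can be iterated from one
  coordinate to the next without exceptional sections. Minkowski's inequality is avoided: powers
  commute with suprema, and sums are traded for suprema at the price of geometric factors.\<close>

subsection \<open>Powers of extended non-negative reals\<close>

lemma epowr_ennreal: "0 \<le> x \<Longrightarrow> epowr (ennreal x) r = ennreal (x powr r)"
  by (simp add: epowr_def)

lemma epowr_top [simp]: "epowr top r = top"
  by (simp add: epowr_def)

lemma epowr_0 [simp]: "epowr 0 r = 0"
  by (simp add: epowr_def)

lemma epowr_one [simp]: "epowr x 1 = x"
  by (cases x) (simp_all add: epowr_ennreal)

lemma epowr_1_left [simp]: "epowr 1 r = 1"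
  using epowr_ennreal[of 1 r] by simp

lemma epowr_epowr: "epowr (epowr x a) b = epowr x (a * b)"
  by (cases x) (simp_all add: epowr_ennreal powr_powr)

text \<open>The convention sends 0 to 0 and \<open>top\<close> to \<open>top\<close> for every
  exponent, zero and negative ones included; together with 0 * \<open>top\<close> = 0 this makes the
  map multiplicative without side conditions.\<close>

lemma epowr_mult: "epowr (x * y) r = epowr x r * epowr y r"
proof (cases x)
  case (real a)
  show ?thesis
  proof (cases y)
    case (real b)
    then show ?thesis using \<open>x = ennreal a\<close> \<open>0 \<le> a\<close>
      by (simp add: epowr_ennreal powr_mult flip: ennreal_mult)
  next
    case top
    show ?thesis
      by (cases "a = 0") (use top \<open>x = ennreal a\<close> \<open>0 \<le> a\<close> in
          \<open>simp_all add: epowr_ennreal ennreal_mult_top\<close>)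
  qed
next
  case top
  show ?thesis
  proof (cases y)
    case (real b)
    show ?thesis
      by (cases "b = 0") (use top real in \<open>simp_all add: epowr_ennreal ennreal_top_mult\<close>)
  qed (use top in simp)
qed

lemma epowr_add: "epowr x a * epowr x b = epowr x (a + b)"
  by (cases x) (simp_all add: epowr_ennreal powr_add flip: ennreal_mult)

lemma epowr_mono: "x \<le> y \<Longrightarrow> 0 \<le> r \<Longrightarrow> epowr x r \<le> epowr y r"
  by (cases x; cases y) (auto simp: epowr_ennreal top_unique intro!: powr_mono2 ennreal_leI)

lemma epowr_inv: "0 < r \<Longrightarrow> epowr (epowr x r) (1 / r) = x"
  by (simp add: epowr_epowr)

lemma epowr_inv': "0 < r \<Longrightarrow> epowr (epowr x (1 / r)) r = x"
  by (simp add: epowr_epowr)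

lemma epowr_le_iff: "0 < r \<Longrightarrow> epowr x r \<le> y \<longleftrightarrow> x \<le> epowr y (1 / r)"
  by (metis epowr_inv epowr_inv' epowr_mono less_imp_le zero_less_divide_1_iff)

text \<open>For r > 0 the power is an order automorphism of [0,\<infinity>], hence commutes with
  arbitrary suprema. This lets suprema pass through norms without a triangle inequality.\<close>

lemma epowr_SUP:
  assumes "0 < r"
  shows "epowr (SUP i\<in>I. u i) r = (SUP i\<in>I. epowr (u i) r)"
proof (rule antisym)
  show "epowr (SUP i\<in>I. u i) r \<le> (SUP i\<in>I. epowr (u i) r)"
  proof -
    have "u i \<le> epowr (SUP i\<in>I. epowr (u i) r) (1 / r)" if "i \<in> I" for i
      using assms that SUP_upper[of i I "\<lambda>i. epowr (u i) r"] by (simp flip: epowr_le_iff)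
    then show ?thesis using assms by (simp add: epowr_le_iff SUP_least)
  qed
  show "(SUP i\<in>I. epowr (u i) r) \<le> epowr (SUP i\<in>I. u i) r"
    using assms by (intro SUP_least epowr_mono SUP_upper) auto
qed

lemma epowr_eq_0_iff [simp]: "epowr x r = 0 \<longleftrightarrow> x = 0"
  by (cases x) (auto simp: epowr_ennreal)

lemma epowr_eq_top_iff [simp]: "epowr x r = top \<longleftrightarrow> x = top"
  by (cases x) (auto simp: epowr_ennreal)

lemma epowr_gt_0_iff [simp]: "0 < epowr x r \<longleftrightarrow> 0 < x"
  by (simp add: zero_less_iff_neq_zero)

lemma epowr_less_top_iff [simp]: "epowr x r < top \<longleftrightarrow> x < top"
  by (metis epowr_eq_top_iff less_top)

lemma measurable_epowr [measurable]:
  assumes [measurable]: "f \<in> borel_measurable M"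
  shows "(\<lambda>x. epowr (f x) r) \<in> borel_measurable M"
  unfolding epowr_def by measurable

lemma epowr_max: "0 \<le> r \<Longrightarrow> epowr (max x y) r = max (epowr x r) (epowr y r)"
  by (metis epowr_mono max.absorb1 max.absorb2 nle_le)

lemma epowr_add_le:
  assumes "0 \<le> r"
  shows "epowr (x + y) r \<le> ennreal (2 powr r) * (epowr x r + epowr y r)"
proof -
  have "x + y \<le> max x y + max x y" by (intro add_mono) auto
  also have "\<dots> = 2 * max x y" by (simp add: mult_2)
  finally have "epowr (x + y) r \<le> epowr (2 * max x y) r"
    using assms by (intro epowr_mono)
  also have "\<dots> = ennreal (2 powr r) * max (epowr x r) (epowr y r)"
    using epowr_ennreal[of 2 r] by (simp add: epowr_mult epowr_max assms)
  also have "\<dots> \<le> ennreal (2 powr r) * (epowr x r + epowr y r)"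
    by (intro mult_left_mono) (auto simp: max_def)
  finally show ?thesis .
qed

subsection \<open>The weighted maximal function over rational intervals\<close>

text \<open>Since \<open>0 / 0 = 0\<close> and \<open>x / top = 0\<close>, intervals of zero or infinite weight do not contribute.\<close>

definition maxfun :: "(real \<Rightarrow> ennreal) \<Rightarrow> (real \<Rightarrow> ennreal) \<Rightarrow> real \<Rightarrow> ennreal" where
  "maxfun v h t = (SUP p\<in>\<rat>\<times>\<rat>. indicator {fst p<..<snd p} t *
     ((\<integral>\<^sup>+ u\<in>{fst p<..<snd p}. h u * v u \<partial>lborel) / (\<integral>\<^sup>+ u\<in>{fst p<..<snd p}. v u \<partial>lborel)))"

lemma countable_rat_pairs: "countable (\<rat> \<times> \<rat> :: (real \<times> real) set)"
  by (intro countable_SIGMA countable_rat)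

lemma measurable_maxfun [measurable]: "maxfun v h \<in> borel_measurable borel"
  unfolding maxfun_def
  by (intro borel_measurable_SUP countable_rat_pairs) auto

lemma maxfun_ge:
  assumes "a \<in> \<rat>" "b \<in> \<rat>" "a < t" "t < b"
  shows "(\<integral>\<^sup>+ u\<in>{a<..<b}. h u * v u \<partial>lborel) / (\<integral>\<^sup>+ u\<in>{a<..<b}. v u \<partial>lborel) \<le> maxfun v h t"
  unfolding maxfun_def by (rule SUP_upper2[of "(a,b)"]) (use assms in auto)

lemma maxfun_leI:
  assumes "\<And>a b. a \<in> \<rat> \<Longrightarrow> b \<in> \<rat> \<Longrightarrow> a < t \<Longrightarrow> t < b \<Longrightarrow>
     (\<integral>\<^sup>+ u\<in>{a<..<b}. h u * v u \<partial>lborel) / (\<integral>\<^sup>+ u\<in>{a<..<b}. v u \<partial>lborel) \<le> c"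
  shows "maxfun v h t \<le> c"
  unfolding maxfun_def by (rule SUP_least) (use assms in \<open>auto simp: indicator_def\<close>)

text \<open>Only integrals of \<open>h\<close> enter, so an almost everywhere inequality gives one
  at every \<open>t\<close>. It is used to pass from an infinite-valued majorant to a real-valued
  version of it.\<close>

lemma maxfun_mono_AE:
  assumes "AE u in lborel. h u \<le> h' u"
  shows "maxfun v h t \<le> maxfun v h' t"
proof -
  have "AE u in lborel. h u * v u * indicator I u \<le> h' u * v u * indicator I u" for I :: "real set"
    using assms by eventually_elim (auto intro!: mult_right_mono)
  then show ?thesis unfolding maxfun_def
    by (intro SUP_mono' mult_left_mono divide_right_mono_ennreal nn_integral_mono_AE) auto
qed

lemma maxfun_mono: "(\<And>u. h u \<le> h' u) \<Longrightarrow> maxfun v h t \<le> maxfun v h' t"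
  by (intro maxfun_mono_AE) auto

lemma maxfun_add_const:
  assumes [measurable]: "h \<in> borel_measurable borel" "v \<in> borel_measurable borel"
  shows "maxfun v (\<lambda>u. h u + c) t \<le> maxfun v h t + c"
proof (rule maxfun_leI)
  fix a b :: real assume ab: "a \<in> \<rat>" "b \<in> \<rat>" "a < t" "t < b"
  let ?V = "\<integral>\<^sup>+ u\<in>{a<..<b}. v u \<partial>lborel" and ?H = "\<integral>\<^sup>+ u\<in>{a<..<b}. h u * v u \<partial>lborel"
  have "(\<integral>\<^sup>+ u\<in>{a<..<b}. (h u + c) * v u \<partial>lborel) = ?H + c * ?V"
    by (simp add: distrib_right nn_integral_add nn_integral_cmult mult.assoc)
  then have "(\<integral>\<^sup>+ u\<in>{a<..<b}. (h u + c) * v u \<partial>lborel) / ?V = ?H / ?V + c * ?V / ?V"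
    by (simp add: divide_ennreal_def distrib_right)
  also have "c * ?V / ?V \<le> c"
    by (cases "?V = 0"; cases "?V = top") (auto simp: ennreal_mult_divide_eq divide_ennreal_def[of _ top])
  also have "?H / ?V \<le> maxfun v h t"
    using maxfun_ge[OF ab] by simp
  finally show "(\<integral>\<^sup>+ u\<in>{a<..<b}. (h u + c) * v u \<partial>lborel) / ?V \<le> maxfun v h t + c"
    by (simp add: add_mono)
qed

lemma card_ge_3D:
  assumes "finite S" "3 \<le> card S"
  obtains x where "x \<in> S" "x \<noteq> p" "x \<noteq> q"
proof -
  have "card {p, q} \<le> 2" by (simp add: card_insert_if)
  then have "\<not> S \<subseteq> {p, q}"
    using card_mono[of "{p,q}" S] assms by auto
  then show ?thesis using that by auto
qed

text \<open>A subfamily of minimal cardinality with the same union works: among three intervals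
  through a common point, one lies in the union of the other two.\<close>

lemma interval_subcover_overlap_2:
  fixes J :: "(real \<times> real) set"
  assumes "finite J"
  obtains K where "K \<subseteq> J" "(\<Union>p\<in>K. {fst p<..<snd p}) = (\<Union>p\<in>J. {fst p<..<snd p})"
    "\<And>t. card {p\<in>K. t \<in> {fst p<..<snd p}} \<le> 2"
proof -
  let ?U = "\<lambda>K. \<Union>p\<in>K. {fst p<..<snd p :: real}"
  define P where "P K \<longleftrightarrow> K \<subseteq> J \<and> ?U K = ?U J" for K
  define K where "K = arg_min card P"
  have PK: "P K" and min: "\<And>L. P L \<Longrightarrow> card K \<le> card L"
    using arg_min_natI[of P J card] arg_min_nat_le[of P _ card] unfolding K_def P_def by auto
  have finK: "finite K" using PK assms finite_subset unfolding P_def by auto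
  have "card {p\<in>K. t \<in> {fst p<..<snd p}} \<le> 2" for t
  proof (rule ccontr)
    let ?S = "{p\<in>K. t \<in> {fst p<..<snd p}}"
    assume "\<not> card ?S \<le> 2"
    then have c: "3 \<le> card ?S" by simp
    have fS: "finite ?S" using finK by auto
    have neS: "?S \<noteq> {}" using c by (auto simp del: Collect_empty_eq)
    \<comment> \<open>Both \<open>p\<close> and \<open>q\<close> contain \<open>t\<close>, so their
      union is one interval, reaching at least as far to each side as any member of
      \<open>?S\<close>; they may coincide.\<close>
    have "Min (fst ` ?S) \<in> fst ` ?S" by (intro Min_in) (use fS neS in auto)
    then obtain p where p: "p \<in> ?S" "fst p = Min (fst ` ?S)" by (metis (no_types, lifting) imageE)
    have "Max (snd ` ?S) \<in> snd ` ?S" by (intro Max_in) (use fS neS in auto)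
    then obtain q where q: "q \<in> ?S" "snd q = Max (snd ` ?S)" by (metis (no_types, lifting) imageE)
    obtain x where x: "x \<in> ?S" "x \<noteq> p" "x \<noteq> q" using card_ge_3D[OF fS c] by metis
    have "fst p \<le> fst x" using p x fS by (auto intro!: Min_le)
    moreover have "snd x \<le> snd q" using q x fS by (auto intro!: Max_ge)
    ultimately have "{fst x<..<snd x} \<subseteq> {fst p<..<snd p} \<union> {fst q<..<snd q}"
      using p q by auto
    moreover have "p \<in> K - {x}" "q \<in> K - {x}" using p q x by auto
    ultimately have "{fst x<..<snd x} \<subseteq> ?U (K - {x})" by blast
    then have "?U (K - {x}) = ?U K" by auto
    then have "P (K - {x})" using PK unfolding P_def by auto
    moreover have "card (K - {x}) < card K" using x by (intro card_Diff1_less finK) auto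
    ultimately show False using min[of "K - {x}"] by linarith
  qed
  then show ?thesis using PK unfolding P_def by (intro that[of K]) auto
qed

text \<open>In a subfamily of overlap at most 2 the integrals of \<open>h * v\<close> count each
  point at most twice. The constant 2 does not see \<open>v\<close>: no doubling of the weight
  enters.\<close>

lemma weak_type_finite:
  fixes h v :: "real \<Rightarrow> ennreal"
  assumes [measurable]: "h \<in> borel_measurable borel" "v \<in> borel_measurable borel"
    and J: "finite J"
    and av: "\<And>p. p \<in> J \<Longrightarrow> c * (\<integral>\<^sup>+ u\<in>{fst p<..<snd p}. v u \<partial>lborel)
                  \<le> (\<integral>\<^sup>+ u\<in>{fst p<..<snd p}. h u * v u \<partial>lborel)"
  shows "c * (\<integral>\<^sup>+ u\<in>(\<Union>p\<in>J. {fst p<..<snd p}). v u \<partial>lborel) \<le> 2 * (\<integral>\<^sup>+ u. h u * v u \<partial>lborel)"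
proof -
  obtain K where K: "K \<subseteq> J" "(\<Union>p\<in>K. {fst p<..<snd p}) = (\<Union>p\<in>J. {fst p<..<snd p})"
    "\<And>t. card {p\<in>K. t \<in> {fst p<..<snd p}} \<le> 2"
    by (rule interval_subcover_overlap_2[OF J]) (rule that)
  have finK: "finite K" using K J finite_subset by auto
  have ind: "(\<Sum>p\<in>K. indicator {fst p<..<snd p} u :: ennreal)
        = of_nat (card {p\<in>K. u \<in> {fst p<..<snd p}})" for u
    using finK by (simp add: indicator_def sum.If_cases Int_def)
  have "c * (\<integral>\<^sup>+ u\<in>(\<Union>p\<in>K. {fst p<..<snd p}). v u \<partial>lborel)
      \<le> c * (\<integral>\<^sup>+ u. (\<Sum>p\<in>K. v u * indicator {fst p<..<snd p} u) \<partial>lborel)"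
  proof (intro mult_left_mono nn_integral_mono)
    fix u
    show "v u * indicator (\<Union>p\<in>K. {fst p<..<snd p}) u \<le> (\<Sum>p\<in>K. v u * indicator {fst p<..<snd p} u)"
    proof (cases "u \<in> (\<Union>p\<in>K. {fst p<..<snd p})")
      case True
      then obtain p where p: "p \<in> K" "u \<in> {fst p<..<snd p}" by auto
      have "v u * indicator {fst p<..<snd p} u \<le> (\<Sum>p\<in>K. v u * indicator {fst p<..<snd p} u)"
        using finK p by (intro member_le_sum) auto
      then show ?thesis using True p by simp
    qed simp
  qed auto
  also have "\<dots> = (\<Sum>p\<in>K. c * (\<integral>\<^sup>+ u\<in>{fst p<..<snd p}. v u \<partial>lborel))"
    by (simp add: nn_integral_sum sum_distrib_left)
  also have "\<dots> \<le> (\<Sum>p\<in>K. \<integral>\<^sup>+ u\<in>{fst p<..<snd p}. h u * v u \<partial>lborel)"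
    using K by (intro sum_mono av) auto
  also have "\<dots> = (\<integral>\<^sup>+ u. h u * v u * (\<Sum>p\<in>K. indicator {fst p<..<snd p} u) \<partial>lborel)"
    by (simp add: nn_integral_sum sum_distrib_left)
  also have "\<dots> \<le> (\<integral>\<^sup>+ u. h u * v u * 2 \<partial>lborel)"
    unfolding ind using K(3)
    by (intro nn_integral_mono mult_left_mono) (metis of_nat_le_iff of_nat_numeral, simp)
  also have "\<dots> = 2 * (\<integral>\<^sup>+ u. h u * v u \<partial>lborel)"
    by (simp add: mult.commute[of _ 2] nn_integral_cmult)
  finally show ?thesis using K(2) by simp
qed

text \<open>The level set is the union of the countably many rational intervals on which the average
  exceeds \<open>c\<close>; finite subfamilies exhaust it.\<close>

lemma weak_type:
  fixes h v :: "real \<Rightarrow> ennreal"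
  assumes [measurable]: "h \<in> borel_measurable borel" "v \<in> borel_measurable borel"
  shows "c * (\<integral>\<^sup>+ u\<in>{u. c < maxfun v h u}. v u \<partial>lborel) \<le> 2 * (\<integral>\<^sup>+ u. h u * v u \<partial>lborel)"
proof -
  let ?I = "\<lambda>p. {fst p<..<snd p :: real}"
  define G where "G = {p\<in>\<rat>\<times>\<rat>. c < (\<integral>\<^sup>+ u\<in>?I p. h u * v u \<partial>lborel) / (\<integral>\<^sup>+ u\<in>?I p. v u \<partial>lborel)}"
  have cG: "countable G" unfolding G_def by (rule countable_subset[OF _ countable_rat_pairs]) auto
  have E: "{u. c < maxfun v h u} = (\<Union>p\<in>G. ?I p)"
  proof -
    have "c < indicator A u * x \<longleftrightarrow> u \<in> A \<and> c < x" for A :: "real set" and u x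
      by (auto simp: indicator_def)
    then show ?thesis unfolding maxfun_def less_SUP_iff G_def by fastforce
  qed
  have avG: "c * (\<integral>\<^sup>+ u\<in>?I p. v u \<partial>lborel) \<le> (\<integral>\<^sup>+ u\<in>?I p. h u * v u \<partial>lborel)" if "p \<in> G" for p
  proof (cases "(\<integral>\<^sup>+ u\<in>?I p. v u \<partial>lborel) = 0")
    \<comment> \<open>An interval of infinite weight has quotient 0, which exceeds no
      \<open>c\<close>, so the intervals of \<open>G\<close> have finite weight.\<close>
    case False
    have "(\<integral>\<^sup>+ u\<in>?I p. v u \<partial>lborel) \<noteq> top"
      using that unfolding G_def by (auto simp: divide_ennreal_def)
    moreover have "c * (\<integral>\<^sup>+ u\<in>?I p. v u \<partial>lborel)
        \<le> (\<integral>\<^sup>+ u\<in>?I p. h u * v u \<partial>lborel) / (\<integral>\<^sup>+ u\<in>?I p. v u \<partial>lborel) * (\<integral>\<^sup>+ u\<in>?I p. v u \<partial>lborel)"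
      using that unfolding G_def by (intro mult_right_mono) auto
    ultimately show ?thesis
      using False by (simp only: ennreal_divide_times) (simp add: ennreal_divide_self less_top)
  qed simp
  show ?thesis
  proof (cases "G = {}")
    case False
    define A where "A n = (\<Union>p\<in>from_nat_into G ` {..<n}. ?I p)" for n
    have [measurable]: "A n \<in> sets borel" for n unfolding A_def by auto
    have UA: "(\<Union>n. A n) = (\<Union>p\<in>G. ?I p)"
    proof -
      have "G = (\<Union>n. from_nat_into G ` {..<n})"
      proof safe
        fix p assume "p \<in> G"
        then obtain n where "p = from_nat_into G n" using from_nat_into_surj[OF cG] by metis
        then show "p \<in> (\<Union>n. from_nat_into G ` {..<n})" by (intro UN_I[of "Suc n"]) auto
      qed (use from_nat_into[OF False] in metis)
      then show ?thesis unfolding A_def by blast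
    qed
    have inc: "incseq A" unfolding A_def incseq_def by force
    have "(\<integral>\<^sup>+ u\<in>(\<Union>n. A n). v u \<partial>lborel) = (SUP n. \<integral>\<^sup>+ u\<in>A n. v u \<partial>lborel)"
    proof -
      have "v u * indicator (\<Union>n. A n) u = (SUP n. v u * indicator (A n) u)" for u
        unfolding SUP_mult_left_ennreal[symmetric]
        by (rule arg_cong[where f="\<lambda>x. v u * x"]) (rule antisym, auto simp: indicator_def intro!: SUP_upper2 SUP_least)
      then show ?thesis
        apply (simp only:)
        apply (rule nn_integral_monotone_convergence_SUP)
        using inc by (auto simp: incseq_def le_fun_def indicator_def)
    qed
    then have "c * (\<integral>\<^sup>+ u\<in>(\<Union>n. A n). v u \<partial>lborel) = (SUP n. c * (\<integral>\<^sup>+ u\<in>A n. v u \<partial>lborel))"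
      by (simp add: SUP_mult_left_ennreal)
    also have "\<dots> \<le> 2 * (\<integral>\<^sup>+ u. h u * v u \<partial>lborel)"
      unfolding A_def using avG from_nat_into[OF False]
      by (intro SUP_least weak_type_finite) auto
    finally show ?thesis unfolding E UA .
  qed (simp add: E)
qed

section \<open>Strong type from the layer-cake formula\<close>

lemma ennreal_mult_divide_cancel: "0 < c \<Longrightarrow> ennreal c * (x / ennreal c) = x"
  by (subst ennreal_times_divide, subst mult.commute) (simp add: ennreal_mult_divide_eq)

text \<open>Layer-cake formula for one value \<open>x\<close>: integrated against a weight and
  combined with Tonelli it turns power integrals into integrals over level sets.\<close>

lemma nn_integral_powr_below:
  fixes x :: ennreal
  assumes a: "-1 < a"
  shows "(\<integral>\<^sup>+ l. ennreal (l powr a) * indicator {l. 0 < l \<and> ennreal l < x} l \<partial>lborel)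
           = epowr x (a + 1) / ennreal (a + 1)"
proof -
  let ?J = "\<lambda>x. \<integral>\<^sup>+ l. ennreal (l powr a) * indicator {l. 0 < l \<and> ennreal l < x} l \<partial>lborel"
  have fin: "?J (ennreal c) = ennreal (c powr (a + 1) / (a + 1))" if "0 \<le> c" for c
  proof -
    have "?J (ennreal c) = (\<integral>\<^sup>+ l. ennreal (l powr a) * indicator {0..c} l \<partial>lborel)"
    proof (rule nn_integral_cong_AE)
      have "AE l in lborel. l \<noteq> 0 \<and> l \<noteq> c"
        using AE_lborel_singleton[of 0] AE_lborel_singleton[of c] by eventually_elim auto
      then show "AE l in lborel. ennreal (l powr a) * indicator {l. 0 < l \<and> ennreal l < ennreal c} l
          = ennreal (l powr a) * indicator {0..c} l"
        by eventually_elim (auto simp: indicator_def ennreal_less_iff)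
    qed
    also have "\<dots> = ennreal (c powr (a + 1) / (a + 1))"
      by (rule nn_integral_has_integral_lebesgue'[OF _ has_integral_powr_from_0]) (use a that in auto)
    finally show ?thesis .
  qed
  show ?thesis
  proof (cases x)
    case (real c)
    then show ?thesis using fin[of c] a by (simp add: epowr_ennreal divide_ennreal)
  next
    case top
    have "of_nat n \<le> ?J top" for n :: nat
    proof -
      \<comment> \<open>The cut-off up to which the integral is exactly \<open>n\<close>; hence it
        is infinite at \<open>top\<close>.\<close>
      let ?c = "(real n * (a + 1)) powr (1 / (a + 1))"
      have "of_nat n = ?J (ennreal ?c)"
        using a by (subst fin) (auto simp: powr_powr ennreal_of_nat_eq_real_of_nat)
      also have "\<dots> \<le> ?J top"
        by (intro nn_integral_mono) (auto simp: indicator_def)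
      finally show ?thesis .
    qed
    then have "(SUP n. of_nat n :: ennreal) \<le> ?J top" by (intro SUP_least) auto
    then show ?thesis using top a
      by (simp add: ennreal_SUP_of_nat_eq_top top_unique ennreal_top_divide)
  qed
qed

text \<open>Truncation at height l/2: \<open>g\<close> keeps the values of \<open>h\<close> above
  l/2, the rest raises the maximal function by at most l/2, and the weak type bound is applied to
  \<open>g\<close>. The constant 4 is 2 from halving the level times 2 from the overlap.\<close>

lemma maxfun_level_bound:
  fixes h v :: "real \<Rightarrow> ennreal"
  assumes [measurable]: "h \<in> borel_measurable borel" "v \<in> borel_measurable borel"
    and l: "0 < l"
  shows "ennreal l * (\<integral>\<^sup>+ t\<in>{t. ennreal l < maxfun v h t}. v t \<partial>lborel)
           \<le> 4 * (\<integral>\<^sup>+ t. h t * indicator {t. ennreal l < 2 * h t} t * v t \<partial>lborel)"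
proof -
  define g where "g t = h t * indicator {t. ennreal l < 2 * h t} t" for t
  have [measurable]: "g \<in> borel_measurable borel" unfolding g_def by measurable
  have half: "ennreal (l / 2) + ennreal (l / 2) = ennreal l"
    using l by (simp flip: ennreal_plus)
  have hg: "h t \<le> g t + ennreal (l / 2)" for t
  proof (cases "ennreal l < 2 * h t")
    case False
    then have "2 * h t \<le> 2 * ennreal (l / 2)"
      using half by (simp add: mult_2)
    then have "h t \<le> ennreal (l / 2)"
      by (subst (asm) ennreal_mult_le_mult_iff) auto
    then show ?thesis by (simp add: add_increasing)
  qed (auto simp: g_def)
  have sub: "{t. ennreal l < maxfun v h t} \<subseteq> {t. ennreal (l / 2) < maxfun v g t}"
  proof safe
    fix t assume "ennreal l < maxfun v h t"
    also have "maxfun v h t \<le> maxfun v (\<lambda>u. g u + ennreal (l / 2)) t"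
      by (intro maxfun_mono hg)
    also have "\<dots> \<le> maxfun v g t + ennreal (l / 2)"
      by (intro maxfun_add_const) auto
    finally show "ennreal (l / 2) < maxfun v g t"
      using half by (metis add_right_mono linorder_not_less)
  qed
  have "ennreal l * (\<integral>\<^sup>+ t\<in>{t. ennreal l < maxfun v h t}. v t \<partial>lborel)
     \<le> ennreal l * (\<integral>\<^sup>+ t\<in>{t. ennreal (l / 2) < maxfun v g t}. v t \<partial>lborel)"
    using sub by (intro mult_left_mono nn_integral_mono) (auto simp: indicator_def)
  also have "\<dots> = 2 * (ennreal (l / 2) * (\<integral>\<^sup>+ t\<in>{t. ennreal (l / 2) < maxfun v g t}. v t \<partial>lborel))"
    using half by (simp add: mult_2 flip: distrib_right)
  also have "\<dots> \<le> 2 * (2 * (\<integral>\<^sup>+ t. g t * v t \<partial>lborel))"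
    by (intro mult_left_mono weak_type) auto
  also have "\<dots> = 4 * (\<integral>\<^sup>+ t. g t * v t \<partial>lborel)"
    by (simp flip: mult.assoc)
  finally show ?thesis unfolding g_def .
qed

text \<open>Marcinkiewicz interpolation between weak type (1,1) and the trivial bound in
  L^\<infinity>. What matters is that \<open>C\<close> depends on \<open>s\<close> alone and is
  chosen before \<open>v\<close>.\<close>

lemma strong_type:
  assumes s: "1 < s"
  obtains C :: real where "0 < C" "\<And>h v. h \<in> borel_measurable borel \<Longrightarrow> v \<in> borel_measurable borel \<Longrightarrow>
     (\<integral>\<^sup>+ t. epowr (maxfun v h t) s * v t \<partial>lborel) \<le> ennreal C * (\<integral>\<^sup>+ t. epowr (h t) s * v t \<partial>lborel)"
proof
  \<comment> \<open>\<open>s\<close> comes from the layer-cake formula for the maximal function, 4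
    from the level bound, and 2^(s-1)/(s-1) from the layer-cake formula for \<open>2 * h\<close>
    with exponent s-1.\<close>
  define C where "C = s * 4 * 2 powr (s - 1) / (s - 1)"
  show "0 < C" using s by (simp add: C_def)
  fix h v :: "real \<Rightarrow> ennreal"
  assume [measurable]: "h \<in> borel_measurable borel" "v \<in> borel_measurable borel"
  let ?m = "maxfun v h"
  define B where "B a l x = ennreal (l powr a) * indicator {l. 0 < l \<and> ennreal l < x} l" for a l and x :: ennreal
  have [measurable]: "(\<lambda>(l, t). B a l (f t)) \<in> borel_measurable (lborel \<Otimes>\<^sub>M lborel)"
    if [measurable]: "f \<in> borel_measurable borel" for f :: "real \<Rightarrow> ennreal" and a
    unfolding B_def indicator_def by (simp add: case_prod_beta) measurable
  have [measurable]: "(\<lambda>l. B a l x) \<in> borel_measurable borel" for a x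
    unfolding B_def by measurable
  have lay: "epowr x (a + 1) = ennreal (a + 1) * (\<integral>\<^sup>+ l. B a l x \<partial>lborel)" if "-1 < a" for a x
    unfolding B_def nn_integral_powr_below[OF that] using that
    by (simp add: ennreal_mult_divide_cancel)
  have "(\<integral>\<^sup>+ t. epowr (?m t) s * v t \<partial>lborel)
      = (\<integral>\<^sup>+ t. ennreal s * (\<integral>\<^sup>+ l. B (s - 1) l (?m t) * v t \<partial>lborel) \<partial>lborel)"
    using lay[of "s - 1"] s by (simp add: nn_integral_multc mult.assoc)
  also have "\<dots> = ennreal s * (\<integral>\<^sup>+ t. \<integral>\<^sup>+ l. B (s - 1) l (?m t) * v t \<partial>lborel \<partial>lborel)"
    by (intro nn_integral_cmult) measurable
  also have "(\<integral>\<^sup>+ t. \<integral>\<^sup>+ l. B (s - 1) l (?m t) * v t \<partial>lborel \<partial>lborel)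
           = (\<integral>\<^sup>+ l. \<integral>\<^sup>+ t. B (s - 1) l (?m t) * v t \<partial>lborel \<partial>lborel)"
    by (rule lborel_pair.Fubini') measurable
  \<comment> \<open>The level bound costs a factor 1/l, so s-1 drops to s-2; this is still above -1
    because s > 1, so the integral over \<open>l\<close> converges at 0.\<close>
  also have "\<dots> \<le> (\<integral>\<^sup>+ l. \<integral>\<^sup>+ t. 4 * (B (s - 2) l (2 * h t) * h t * v t) \<partial>lborel \<partial>lborel)"
  proof (rule nn_integral_mono)
    fix l :: real
    show "(\<integral>\<^sup>+ t. B (s - 1) l (?m t) * v t \<partial>lborel) \<le> (\<integral>\<^sup>+ t. 4 * (B (s - 2) l (2 * h t) * h t * v t) \<partial>lborel)"
    proof (cases "0 < l")
      case True
      have pw: "ennreal (l powr (s - 1)) = ennreal (l powr (s - 2)) * ennreal l"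
        using True powr_add[of l "s - 2" 1] by (simp flip: ennreal_mult)
      have "(\<integral>\<^sup>+ t. B (s - 1) l (?m t) * v t \<partial>lborel)
          = (\<integral>\<^sup>+ t. ennreal (l powr (s - 1)) * (v t * indicator {t. ennreal l < ?m t} t) \<partial>lborel)"
        using True by (intro nn_integral_cong) (auto simp: B_def indicator_def)
      also have "\<dots> = ennreal (l powr (s - 1)) * (\<integral>\<^sup>+ t\<in>{t. ennreal l < ?m t}. v t \<partial>lborel)"
        by (intro nn_integral_cmult) measurable
      also have "\<dots> \<le> ennreal (l powr (s - 2)) * (4 * (\<integral>\<^sup>+ t. h t * indicator {t. ennreal l < 2 * h t} t * v t \<partial>lborel))"
        unfolding pw using True
        by (subst mult.assoc) (intro mult_left_mono maxfun_level_bound, auto)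
      also have "\<dots> = (\<integral>\<^sup>+ t. ennreal (l powr (s - 2)) * (4 * (h t * indicator {t. ennreal l < 2 * h t} t * v t)) \<partial>lborel)"
        by (simp add: nn_integral_cmult)
      also have "\<dots> = (\<integral>\<^sup>+ t. 4 * (B (s - 2) l (2 * h t) * h t * v t) \<partial>lborel)"
        using True by (intro nn_integral_cong) (auto simp: B_def indicator_def mult_ac)
      finally show ?thesis .
    qed (simp add: B_def)
  qed
  also have "\<dots> = (\<integral>\<^sup>+ t. \<integral>\<^sup>+ l. 4 * (B (s - 2) l (2 * h t) * h t * v t) \<partial>lborel \<partial>lborel)"
    by (rule lborel_pair.Fubini'[symmetric]) measurable
  also have "\<dots> = (\<integral>\<^sup>+ t. ennreal (4 * 2 powr (s - 1) / (s - 1)) * (epowr (h t) s * v t) \<partial>lborel)"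
  proof (rule nn_integral_cong)
    fix t :: real
    have "(\<integral>\<^sup>+ l. 4 * (B (s - 2) l (2 * h t) * h t * v t) \<partial>lborel)
        = 4 * ((\<integral>\<^sup>+ l. B (s - 2) l (2 * h t) \<partial>lborel) * h t * v t)"
      unfolding B_def by (simp add: nn_integral_cmult nn_integral_multc)
    also have "(\<integral>\<^sup>+ l. B (s - 2) l (2 * h t) \<partial>lborel) = epowr (2 * h t) (s - 1) / ennreal (s - 1)"
      using nn_integral_powr_below[of "s - 2" "2 * h t"] s by (simp add: B_def)
    also have "\<dots> = ennreal (2 powr (s - 1) / (s - 1)) * epowr (h t) (s - 1)"
      using epowr_ennreal[of 2 "s - 1"] s
      by (simp add: epowr_mult divide_ennreal[symmetric] ennreal_times_divide mult.commute)
    also have "4 * (ennreal (2 powr (s - 1) / (s - 1)) * epowr (h t) (s - 1) * h t * v t)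
       = 4 * ennreal (2 powr (s - 1) / (s - 1)) * (epowr (h t) (s - 1) * epowr (h t) 1 * v t)"
      by (simp add: mult_ac)
    also have "4 * ennreal (2 powr (s - 1) / (s - 1)) = ennreal (4 * (2 powr (s - 1) / (s - 1)))"
      using s by (subst ennreal_mult) auto
    finally show "(\<integral>\<^sup>+ l. 4 * (B (s - 2) l (2 * h t) * h t * v t) \<partial>lborel)
       = ennreal (4 * 2 powr (s - 1) / (s - 1)) * (epowr (h t) s * v t)"
      unfolding epowr_add by simp
  qed
  also have "\<dots> = ennreal (4 * 2 powr (s - 1) / (s - 1)) * (\<integral>\<^sup>+ t. epowr (h t) s * v t \<partial>lborel)"
    by (intro nn_integral_cmult) measurable
  finally show "(\<integral>\<^sup>+ t. epowr (?m t) s * v t \<partial>lborel) \<le> ennreal C * (\<integral>\<^sup>+ t. epowr (h t) s * v t \<partial>lborel)"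
    using s by (simp add: C_def ennreal_mult mult_left_mono mult.assoc flip: times_divide_eq_right)
qed

subsection \<open>Muckenhoupt weights on the line\<close>

text \<open>Weights on the line with A_1 constant at most \<open>C\<close> over rational intervals.
  They are real and strictly positive at every point, so that negative powers and dual weights are
  unproblematic.\<close>

definition A1w :: "real \<Rightarrow> (real \<Rightarrow> real) \<Rightarrow> bool" where
  "A1w C v \<longleftrightarrow> v \<in> borel_measurable borel \<and> (\<forall>t. 0 < v t) \<and>
     (AE t in lborel. maxfun (\<lambda>_. 1) (\<lambda>u. ennreal (v u)) t \<le> ennreal (C * v t))"

lemma AE_interval_ex:
  assumes "AE t in lborel. P t" "a < (b::real)"
  shows "\<exists>t\<in>{a<..<b}. P t"
proof (rule ccontr)
  assume "\<not> ?thesis"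
  then have "AE t in lborel. t \<notin> {a<..<b}"
    using assms(1) by (auto elim!: eventually_mono)
  then have "emeasure lborel {a<..<b} = 0"
    by (subst (asm) AE_iff_measurable[of "{a<..<b}"]) auto
  then show False using assms(2) by simp
qed

lemma set_nn_integral_interval_pos:
  assumes [measurable]: "f \<in> borel_measurable borel" and "\<And>t. 0 < f t" "a < (b::real)"
  shows "0 < (\<integral>\<^sup>+ t\<in>{a<..<b}. ennreal (f t) \<partial>lborel)"
proof (rule ccontr)
  assume "\<not> ?thesis"
  then have "AE t in lborel. ennreal (f t) * indicator {a<..<b} t = 0"
    by (simp add: nn_integral_0_iff_AE not_less)
  from AE_interval_ex[OF this \<open>a < b\<close>] assms(2) show False
    by (auto simp: ennreal_eq_0_iff) (metis linorder_not_less)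
qed

lemma maxfun_1_ge:
  assumes "a \<in> \<rat>" "b \<in> \<rat>" "a < t" "t < b"
  shows "(\<integral>\<^sup>+ u\<in>{a<..<b}. h u \<partial>lborel) \<le> ennreal (b - a) * maxfun (\<lambda>_. 1) h t"
proof -
  have "(\<integral>\<^sup>+ u\<in>{a<..<b}. h u \<partial>lborel) / ennreal (b - a) \<le> maxfun (\<lambda>_. 1) h t"
    using maxfun_ge[OF assms, of h "\<lambda>_. 1"] assms by simp
  then have "(\<integral>\<^sup>+ u\<in>{a<..<b}. h u \<partial>lborel) / ennreal (b - a) * ennreal (b - a)
      \<le> maxfun (\<lambda>_. 1) h t * ennreal (b - a)"
    by (intro mult_right_mono) auto
  then show ?thesis using assms
    by (simp add: mult.commute[of _ "ennreal (b - a)"] ennreal_mult_divide_cancel)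
qed

lemma maxfun_1_leI:
  assumes "\<And>a b. a \<in> \<rat> \<Longrightarrow> b \<in> \<rat> \<Longrightarrow> a < t \<Longrightarrow> t < b \<Longrightarrow>
     (\<integral>\<^sup>+ u\<in>{a<..<b}. h u \<partial>lborel) \<le> ennreal (b - a) * c"
  shows "maxfun (\<lambda>_. 1) h t \<le> c"
proof (rule maxfun_leI)
  fix a b :: real assume ab: "a \<in> \<rat>" "b \<in> \<rat>" "a < t" "t < b"
  have "(\<integral>\<^sup>+ u\<in>{a<..<b}. h u \<partial>lborel) / ennreal (b - a) \<le> ennreal (b - a) * c / ennreal (b - a)"
    by (intro divide_right_mono_ennreal assms ab)
  also have "\<dots> = c" using ab by (simp add: mult.commute ennreal_mult_divide_eq)
  finally show "(\<integral>\<^sup>+ u\<in>{a<..<b}. h u * 1 \<partial>lborel) / (\<integral>\<^sup>+ u\<in>{a<..<b}. 1 \<partial>lborel) \<le> c"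
    using ab by simp
qed

text \<open>One point of the interval at which the maximal bound holds already makes the integral
  finite, so local integrability follows from \<open>A1w\<close>. Read at almost all points, the
  same bound is a lower bound for \<open>v\<close> by its average, which is what negative powers
  need.\<close>

lemma A1w_interval:
  assumes v: "A1w C v" and C: "0 < C" and ab: "a \<in> \<rat>" "b \<in> \<rat>" "a < b"
  obtains x where "0 < x" "(\<integral>\<^sup>+ u\<in>{a<..<b}. ennreal (v u) \<partial>lborel) = ennreal x"
    "AE t in lborel. t \<in> {a<..<b} \<longrightarrow> x / (C * (b - a)) \<le> v t"
proof -
  have [measurable]: "v \<in> borel_measurable borel" and pos: "\<And>t. 0 < v t"
    and ae: "AE t in lborel. maxfun (\<lambda>_. 1) (\<lambda>u. ennreal (v u)) t \<le> ennreal (C * v t)"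
    using v unfolding A1w_def by auto
  let ?X = "\<integral>\<^sup>+ u\<in>{a<..<b}. ennreal (v u) \<partial>lborel"
  have ae2: "AE t in lborel. t \<in> {a<..<b} \<longrightarrow> ?X \<le> ennreal ((b - a) * (C * v t))"
    using ae
  proof eventually_elim
    case (elim t)
    show ?case
    proof
      assume t: "t \<in> {a<..<b}"
      have "?X \<le> ennreal (b - a) * ennreal (C * v t)"
        by (rule order_trans[OF maxfun_1_ge mult_left_mono[OF elim]]) (use ab t in auto)
      then show "?X \<le> ennreal ((b - a) * (C * v t))"
        using ab C pos[of t] by (subst ennreal_mult) auto
    qed
  qed
  from AE_interval_ex[OF this \<open>a < b\<close>] have "?X < top"
    by (auto intro: le_less_trans)
  moreover have "0 < ?X" using ab pos by (intro set_nn_integral_interval_pos) auto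
  ultimately obtain x where x: "?X = ennreal x" "0 < x"
    by (cases ?X) auto
  have "AE t in lborel. t \<in> {a<..<b} \<longrightarrow> x / (C * (b - a)) \<le> v t"
    using ae2
  proof eventually_elim
    case (elim t)
    then show ?case using x C ab pos[of t]
      by (auto simp: ennreal_le_iff field_simps)
  qed
  with x show ?thesis using that by blast
qed

text \<open>Weights in the factored form \<open>v0 * v1 powr (1 - s)\<close> with \<open>A\<^sub>1\<close> factors are the
  \<open>A\<^sub>s\<close> weights, by Jones' factorization theorem; no other weights are needed here.\<close>

lemma factored_weight_Ap:
  assumes v0: "A1w C v0" and v1: "A1w C v1" and C: "0 < C" and s: "1 < s"
    and ab: "a \<in> \<rat>" "b \<in> \<rat>" "a < b"
  shows "(\<integral>\<^sup>+ u\<in>{a<..<b}. ennreal (v0 u * v1 u powr (1 - s)) \<partial>lborel) *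
     epowr (\<integral>\<^sup>+ u\<in>{a<..<b}. ennreal (v1 u * v0 u powr (1 - s / (s - 1))) \<partial>lborel) (s - 1)
     \<le> ennreal ((C * (b - a)) powr s)"
proof -
  have [measurable]: "v0 \<in> borel_measurable borel" "v1 \<in> borel_measurable borel"
    and pos: "\<And>t. 0 < v0 t" "\<And>t. 0 < v1 t"
    using v0 v1 unfolding A1w_def by auto
  obtain x0 where x0: "0 < x0" "(\<integral>\<^sup>+ u\<in>{a<..<b}. ennreal (v0 u) \<partial>lborel) = ennreal x0"
    "AE t in lborel. t \<in> {a<..<b} \<longrightarrow> x0 / (C * (b - a)) \<le> v0 t"
    by (rule A1w_interval[OF v0 C ab]) (rule that)
  obtain x1 where x1: "0 < x1" "(\<integral>\<^sup>+ u\<in>{a<..<b}. ennreal (v1 u) \<partial>lborel) = ennreal x1"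
    "AE t in lborel. t \<in> {a<..<b} \<longrightarrow> x1 / (C * (b - a)) \<le> v1 t"
    by (rule A1w_interval[OF v1 C ab]) (rule that)
  \<comment> \<open>A negative power of \<open>v'\<close> is at most the same power of its lower
    bound on the interval, a constant. Both integrals have this shape, with the roles of
    \<open>v0\<close> and \<open>v1\<close> exchanged.\<close>
  have key: "(\<integral>\<^sup>+ u\<in>{a<..<b}. ennreal (v u * v' u powr e) \<partial>lborel) \<le> ennreal (x * (x' / (C * (b - a))) powr e)"
    if [measurable]: "v \<in> borel_measurable borel" "v' \<in> borel_measurable borel"
      and e: "e \<le> 0" and "\<And>t. 0 < v t" "\<And>t. 0 < v' t"  "0 < x'" "0 < x"
      and "(\<integral>\<^sup>+ u\<in>{a<..<b}. ennreal (v u) \<partial>lborel) = ennreal x"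
      and ae: "AE t in lborel. t \<in> {a<..<b} \<longrightarrow> x' / (C * (b - a)) \<le> v' t" for v v' e x x'
  proof -
    have "(\<integral>\<^sup>+ u\<in>{a<..<b}. ennreal (v u * v' u powr e) \<partial>lborel)
      \<le> (\<integral>\<^sup>+ u. ennreal (v u) * indicator {a<..<b} u * ennreal ((x' / (C * (b - a))) powr e) \<partial>lborel)"
    proof (rule nn_integral_mono_AE, use ae in eventually_elim)
      case (elim t)
      have "v' t powr e \<le> (x' / (C * (b - a))) powr e" if "t \<in> {a<..<b}"
        using elim that e C ab \<open>0 < x'\<close> by (intro powr_mono2') auto
      then show ?case using \<open>0 < v t\<close>
        by (auto simp: indicator_def intro!: ennreal_leI mult_left_mono simp flip: ennreal_mult)
    qed
    also have "\<dots> = ennreal x * ennreal ((x' / (C * (b - a))) powr e)"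
      using that by (simp add: nn_integral_multc)
    finally show ?thesis using \<open>0 < x\<close> by (simp add: ennreal_mult)
  qed
  let ?c = "C * (b - a)"
  have c: "0 < ?c" using C ab by simp
  have "(\<integral>\<^sup>+ u\<in>{a<..<b}. ennreal (v0 u * v1 u powr (1 - s)) \<partial>lborel) *
     epowr (\<integral>\<^sup>+ u\<in>{a<..<b}. ennreal (v1 u * v0 u powr (1 - s / (s - 1))) \<partial>lborel) (s - 1)
     \<le> ennreal (x0 * (x1 / ?c) powr (1 - s)) * epowr (ennreal (x1 * (x0 / ?c) powr (1 - s / (s - 1)))) (s - 1)"
    using s x0 x1 pos by (intro mult_mono epowr_mono key) (auto simp: field_simps)
  also have "\<dots> = ennreal (x0 * (x1 / ?c) powr (1 - s) * (x1 * (x0 / ?c) powr (1 - s / (s - 1))) powr (s - 1))"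
    using x0 x1 by (simp add: epowr_ennreal flip: ennreal_mult)
  \<comment> \<open>\<open>x0\<close> occurs with exponents 1 and -1, \<open>x1\<close> with 1-s and
    s-1: both cancel, and the powers of \<open>?c\<close> add up to \<open>s\<close>.\<close>
  also have "x0 * (x1 / ?c) powr (1 - s) * (x1 * (x0 / ?c) powr (1 - s / (s - 1))) powr (s - 1) = ?c powr s"
  proof -
    have "(1 - s / (s - 1)) * (s - 1) = -1" using s by (simp add: field_simps)
    then have "(x1 * (x0 / ?c) powr (1 - s / (s - 1))) powr (s - 1) = x1 powr (s - 1) * (x0 / ?c) powr (-1)"
      using x0 x1 c by (simp add: powr_mult powr_powr)
    also have "\<dots> = x1 powr (s - 1) * (?c / x0)"
      using x0 c by (simp add: powr_neg_one)
    also have "x0 * (x1 / ?c) powr (1 - s) * (x1 powr (s - 1) * (?c / x0))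
       = (x1 / ?c) powr (1 - s) * x1 powr (s - 1) * ?c" using x0 by simp
    also have "(x1 / ?c) powr (1 - s) * x1 powr (s - 1) = ?c powr (s - 1)"
      using x1 c powr_minus[of x1 "s - 1"] powr_minus[of ?c "s - 1"] by (simp add: powr_divide field_simps)
    also have "?c powr (s - 1) * ?c = ?c powr s"
      using c powr_add[of ?c "s - 1" 1] by simp
    finally show ?thesis .
  qed
  finally show ?thesis .
qed


text \<open>Lerner's argument: averages of \<open>h\<close> are controlled by the maximal functions with respect to the
  weight and its dual, both of which are bounded without any doubling condition.\<close>

lemma muckenhoupt:
  assumes s: "1 < s" and C: "0 < C"
  obtains K :: real where "0 < K"
    "\<And>v0 v1 h. A1w C v0 \<Longrightarrow> A1w C v1 \<Longrightarrow> h \<in> borel_measurable borel \<Longrightarrow>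
     (\<integral>\<^sup>+ t. epowr (maxfun (\<lambda>_. 1) h t) s * ennreal (v0 t * v1 t powr (1 - s)) \<partial>lborel)
       \<le> ennreal K * (\<integral>\<^sup>+ t. epowr (h t) s * ennreal (v0 t * v1 t powr (1 - s)) \<partial>lborel)"
proof -
  define s' where "s' = s / (s - 1)"
  have s': "1 < s'" using s by (simp add: s'_def field_simps)
  have conj: "(s - 1) * s' = s" "(1 - s') * (1 - s) = 1" using s by (simp_all add: s'_def field_simps)
  obtain c where c: "0 < c" "\<And>h v. h \<in> borel_measurable borel \<Longrightarrow> v \<in> borel_measurable borel \<Longrightarrow>
     (\<integral>\<^sup>+ t. epowr (maxfun v h t) s * v t \<partial>lborel) \<le> ennreal c * (\<integral>\<^sup>+ t. epowr (h t) s * v t \<partial>lborel)"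
    by (rule strong_type[OF s]) (rule that)
  obtain c' where c': "0 < c'" "\<And>h v. h \<in> borel_measurable borel \<Longrightarrow> v \<in> borel_measurable borel \<Longrightarrow>
     (\<integral>\<^sup>+ t. epowr (maxfun v h t) s' * v t \<partial>lborel) \<le> ennreal c' * (\<integral>\<^sup>+ t. epowr (h t) s' * v t \<partial>lborel)"
    by (rule strong_type[OF s']) (rule that)
  \<comment> \<open>\<open>c\<close> bounds the maximal function with respect to the dual weight in
    exponent \<open>s\<close>, \<open>c'\<close> the one with respect to the weight itself in
    exponent \<open>s'\<close>; the first factor is the constant of the pointwise bound, raised to
    \<open>s'\<close>.\<close>
  define K where "K = (C powr s) powr s' * (c' * c)"
  have "0 < K" using C c c' by (simp add: K_def)
  moreover have "(\<integral>\<^sup>+ t. epowr (maxfun (\<lambda>_. 1) h t) s * ennreal (v0 t * v1 t powr (1 - s)) \<partial>lborel)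
       \<le> ennreal K * (\<integral>\<^sup>+ t. epowr (h t) s * ennreal (v0 t * v1 t powr (1 - s)) \<partial>lborel)"
    if v0: "A1w C v0" and v1: "A1w C v1" and [measurable]: "h \<in> borel_measurable borel" for v0 v1 h
  proof -
    have [measurable]: "v0 \<in> borel_measurable borel" "v1 \<in> borel_measurable borel"
      and pos: "\<And>t. 0 < v0 t" "\<And>t. 0 < v1 t"
      using v0 v1 unfolding A1w_def by auto
    define w where "w t = v0 t * v1 t powr (1 - s)" for t
    \<comment> \<open>The dual weight w^(1-s'). It is factored in the same way, with exponent
      \<open>s'\<close> and with \<open>v0\<close> and \<open>v1\<close> exchanged.\<close>
    define \<sigma> where "\<sigma> t = v1 t * v0 t powr (1 - s')" for t
    have [measurable]: "w \<in> borel_measurable borel" "\<sigma> \<in> borel_measurable borel"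
      unfolding w_def \<sigma>_def by measurable
    have wp: "0 < w t" and \<sigma>p: "0 < \<sigma> t" for t
      using pos[of t] by (simp_all add: w_def \<sigma>_def less_imp_neq[symmetric])
    have \<sigma>w: "w t powr (1 - s') = \<sigma> t" for t
      using pos[of t] conj by (simp add: w_def \<sigma>_def powr_mult powr_powr mult.commute)
    have w\<sigma>: "\<sigma> t powr (1 - s) = w t" for t
      using pos[of t] conj by (simp add: w_def \<sigma>_def powr_mult powr_powr mult.commute)
    \<comment> \<open>Dividing by the weight makes the weighted average over an interval I equal to
      the integral of \<open>h\<close> over I divided by \<sigma>(I); likewise in
      \<open>P\<close>.\<close>
    define Q where "Q = maxfun (\<lambda>t. ennreal (\<sigma> t)) (\<lambda>t. h t * ennreal (1 / \<sigma> t))"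
    define P where "P = maxfun (\<lambda>t. ennreal (w t)) (\<lambda>t. epowr (Q t) (s - 1) * ennreal (1 / w t))"
    have [measurable]: "Q \<in> borel_measurable borel" "P \<in> borel_measurable borel"
      unfolding Q_def P_def by measurable
    have cancel: "x * ennreal (1 / \<sigma> t) * ennreal (\<sigma> t) = x" "x * ennreal (1 / w t) * ennreal (w t) = x" for x t
      using wp[of t] \<sigma>p[of t] by (simp_all add: mult.assoc flip: ennreal_mult)
    \<comment> \<open>On an interval of length l, (?H/l)^(s-1) equals [?W ?S^(s-1) / l^s] (l / ?W)
      (?H / ?S)^(s-1). The bracket is at most C^s, and (?H / ?S)^(s-1) is dominated by the average
      of Q^(s-1) over the interval.\<close>
    have MP: "epowr (maxfun (\<lambda>_. 1) h t) (s - 1) \<le> ennreal (C powr s) * P t" for t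
    proof -
      have "maxfun (\<lambda>_. 1) h t \<le> epowr (ennreal (C powr s) * P t) (1 / (s - 1))"
      proof (rule maxfun_1_leI)
        fix a b :: real assume ab: "a \<in> \<rat>" "b \<in> \<rat>" "a < t" "t < b"
        then have "a < b" by simp
        let ?H = "\<integral>\<^sup>+ u\<in>{a<..<b}. h u \<partial>lborel"
        let ?W = "\<integral>\<^sup>+ u\<in>{a<..<b}. ennreal (w u) \<partial>lborel"
        let ?S = "\<integral>\<^sup>+ u\<in>{a<..<b}. ennreal (\<sigma> u) \<partial>lborel"
        define l where "l = b - a"
        have l: "0 < l" using \<open>a < b\<close> by (simp add: l_def)
        have Ap: "?W * epowr ?S (s - 1) \<le> ennreal ((C * l) powr s)"
          using factored_weight_Ap[OF v0 v1 C s ab(1,2) \<open>a < b\<close>]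
          unfolding w_def \<sigma>_def s'_def l_def .
        have W0: "0 < ?W" and S0: "0 < ?S"
          using \<open>a < b\<close> wp \<sigma>p by (auto intro!: set_nn_integral_interval_pos)
        have fin: "?W < top" "?S < top"
        proof -
          have "?W * epowr ?S (s - 1) < top" using Ap by (rule le_less_trans) simp
          then show "?W < top" "?S < top"
            using W0 S0 by (auto simp: ennreal_mult_less_top)
        qed
        have av: "?H / ?S \<le> Q y" if "y \<in> {a<..<b}" for y
          using maxfun_ge[of a b y "\<lambda>t. h t * ennreal (1 / \<sigma> t)" "\<lambda>t. ennreal (\<sigma> t)"] ab that
          unfolding cancel Q_def by simp
        have "epowr (?H / ?S) (s - 1) * ennreal l = (\<integral>\<^sup>+ u\<in>{a<..<b}. epowr (?H / ?S) (s - 1) \<partial>lborel)"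
          using \<open>a < b\<close> by (simp add: l_def nn_integral_cmult)
        also have "\<dots> \<le> (\<integral>\<^sup>+ u\<in>{a<..<b}. epowr (Q u) (s - 1) \<partial>lborel)"
          using s av by (intro nn_integral_mono) (auto simp: indicator_def intro!: epowr_mono)
        also have "\<dots> = (\<integral>\<^sup>+ u\<in>{a<..<b}. epowr (Q u) (s - 1) * ennreal (1 / w u) * ennreal (w u) \<partial>lborel)"
          unfolding cancel ..
        also have "\<dots> \<le> ?W * P t"
        proof -
          have "(\<integral>\<^sup>+ u\<in>{a<..<b}. epowr (Q u) (s - 1) * ennreal (1 / w u) * ennreal (w u) \<partial>lborel) / ?W \<le> P t"
            using maxfun_ge[OF ab] unfolding P_def .
          then have "?W * ((\<integral>\<^sup>+ u\<in>{a<..<b}. epowr (Q u) (s - 1) * ennreal (1 / w u) * ennreal (w u) \<partial>lborel) / ?W) \<le> ?W * P t"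
            by (rule mult_left_mono) simp
          then show ?thesis using W0 fin by (cases ?W) (auto simp: ennreal_mult_divide_cancel)
        qed
        finally have 1: "epowr (?H / ?S) (s - 1) * ennreal l \<le> ?W * P t" .
        have HS: "?H = ?S * (?H / ?S)"
          using S0 fin by (cases ?S) (auto simp: ennreal_mult_divide_cancel)
        have "epowr ?H (s - 1) = epowr ?S (s - 1) * epowr (?H / ?S) (s - 1)"
          using arg_cong[OF HS, of "\<lambda>x. epowr x (s - 1)"] unfolding epowr_mult .
        then have "epowr ?H (s - 1) * ennreal l = epowr ?S (s - 1) * (epowr (?H / ?S) (s - 1) * ennreal l)"
          by (simp only: mult.assoc)
        also have "\<dots> \<le> epowr ?S (s - 1) * (?W * P t)"
          by (intro mult_left_mono 1) simp
        also have "\<dots> = (?W * epowr ?S (s - 1)) * P t" by (simp add: mult_ac)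
        also have "\<dots> \<le> ennreal ((C * l) powr s) * P t" by (intro mult_right_mono Ap) simp
        finally have "epowr ?H (s - 1) * ennreal l * ennreal (1 / l) \<le> ennreal ((C * l) powr s) * P t * ennreal (1 / l)"
          by (rule mult_right_mono) simp
        also have "epowr ?H (s - 1) * ennreal l * ennreal (1 / l) = epowr ?H (s - 1)"
          using l by (simp add: mult.assoc flip: ennreal_mult)
        also have "ennreal ((C * l) powr s) * P t * ennreal (1 / l) = ennreal ((C * l) powr s * (1 / l)) * P t"
          using l by (subst ennreal_mult) (auto simp: mult_ac)
        also have "(C * l) powr s * (1 / l) = l powr (s - 1) * C powr s"
          using l C powr_add[of l "s - 1" 1] by (simp add: powr_mult)
        also have "ennreal (l powr (s - 1) * C powr s) * P t = epowr (ennreal l) (s - 1) * (ennreal (C powr s) * P t)"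
          using l by (simp add: ennreal_mult epowr_ennreal mult.assoc)
        finally have "?H \<le> epowr (epowr (ennreal l) (s - 1) * (ennreal (C powr s) * P t)) (1 / (s - 1))"
          using s by (subst epowr_le_iff[symmetric]) auto
        also have "\<dots> = ennreal l * epowr (ennreal (C powr s) * P t) (1 / (s - 1))"
          using s by (subst epowr_mult) (simp add: epowr_inv)
        finally show "?H \<le> ennreal (b - a) * epowr (ennreal (C powr s) * P t) (1 / (s - 1))"
          unfolding l_def .
      qed
      then show ?thesis using s by (subst epowr_le_iff) auto
    qed
    have "(\<integral>\<^sup>+ t. epowr (maxfun (\<lambda>_. 1) h t) s * ennreal (w t) \<partial>lborel)
       \<le> (\<integral>\<^sup>+ t. ennreal ((C powr s) powr s') * (epowr (P t) s' * ennreal (w t)) \<partial>lborel)"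
    proof (rule nn_integral_mono)
      fix t
      have "epowr (maxfun (\<lambda>_. 1) h t) s = epowr (epowr (maxfun (\<lambda>_. 1) h t) (s - 1)) s'"
        by (simp add: epowr_epowr conj)
      also have "\<dots> \<le> epowr (ennreal (C powr s) * P t) s'"
        using s' by (intro epowr_mono MP) auto
      also have "\<dots> = ennreal ((C powr s) powr s') * epowr (P t) s'"
        by (simp add: epowr_mult epowr_ennreal)
      finally show "epowr (maxfun (\<lambda>_. 1) h t) s * ennreal (w t) \<le> ennreal ((C powr s) powr s') * (epowr (P t) s' * ennreal (w t))"
        unfolding mult.assoc[symmetric] by (rule mult_right_mono) simp
    qed
    also have "\<dots> = ennreal ((C powr s) powr s') * (\<integral>\<^sup>+ t. epowr (P t) s' * ennreal (w t) \<partial>lborel)"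
      by (intro nn_integral_cmult) measurable
    also have "(\<integral>\<^sup>+ t. epowr (P t) s' * ennreal (w t) \<partial>lborel)
        \<le> ennreal c' * (\<integral>\<^sup>+ t. epowr (epowr (Q t) (s - 1) * ennreal (1 / w t)) s' * ennreal (w t) \<partial>lborel)"
      unfolding P_def by (intro c') measurable
    also have "(\<integral>\<^sup>+ t. epowr (epowr (Q t) (s - 1) * ennreal (1 / w t)) s' * ennreal (w t) \<partial>lborel)
        = (\<integral>\<^sup>+ t. epowr (Q t) s * ennreal (\<sigma> t) \<partial>lborel)"
    proof (rule nn_integral_cong)
      fix t
      have "epowr (ennreal (1 / w t)) s' * ennreal (w t) = ennreal (\<sigma> t)"
        unfolding \<sigma>w[symmetric] using wp[of t] powr_diff[of "w t" 1 s']
        by (simp add: epowr_ennreal powr_divide flip: ennreal_mult)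
      then show "epowr (epowr (Q t) (s - 1) * ennreal (1 / w t)) s' * ennreal (w t) = epowr (Q t) s * ennreal (\<sigma> t)"
        by (simp add: epowr_mult epowr_epowr conj mult.assoc)
    qed
    also have "\<dots> \<le> ennreal c * (\<integral>\<^sup>+ t. epowr (h t * ennreal (1 / \<sigma> t)) s * ennreal (\<sigma> t) \<partial>lborel)"
      unfolding Q_def by (intro c) measurable
    also have "(\<integral>\<^sup>+ t. epowr (h t * ennreal (1 / \<sigma> t)) s * ennreal (\<sigma> t) \<partial>lborel)
        = (\<integral>\<^sup>+ t. epowr (h t) s * ennreal (w t) \<partial>lborel)"
    proof (rule nn_integral_cong)
      fix t
      have "epowr (ennreal (1 / \<sigma> t)) s * ennreal (\<sigma> t) = ennreal (w t)"
        unfolding w\<sigma>[symmetric] using \<sigma>p[of t] powr_diff[of "\<sigma> t" 1 s]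
        by (simp add: epowr_ennreal powr_divide flip: ennreal_mult)
      then show "epowr (h t * ennreal (1 / \<sigma> t)) s * ennreal (\<sigma> t) = epowr (h t) s * ennreal (w t)"
        by (simp add: epowr_mult mult.assoc)
    qed
    finally show ?thesis
      using c c' unfolding K_def w_def by (simp add: ennreal_mult mult_left_mono mult.assoc)
  qed
  ultimately show ?thesis by (rule that)
qed

subsection \<open>Rubio de Francia's iteration\<close>

lemma le_suminf_ennreal: "f i \<le> (\<Sum>i. f i)" for f :: "nat \<Rightarrow> ennreal"
  using sum_le_suminf[of f "{i}"] by simp

lemma suminf_half_powers_ennreal: "(\<Sum>k. ennreal ((1/2) ^ Suc k)) = 1"
proof -
  have "(\<Sum>k. ennreal ((1/2) ^ Suc k)) = ennreal 1"
    by (rule suminf_ennreal_eq[OF _ power_half_series]) simp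
  then show ?thesis by (simp only: ennreal_1)
qed

text \<open>The factors 2^-(i+1) sum to 1. Trading a sum for a supremum costs only a geometric
  factor, which the choice of the ratio in the iteration absorbs.\<close>

lemma suminf_le_SUP_ennreal: "(\<Sum>i. a i) \<le> (SUP i. 2 ^ (i + 1) * a i)" for a :: "nat \<Rightarrow> ennreal"
proof -
  let ?S = "SUP i. 2 ^ (i + 1) * a i"
  have "a i \<le> ennreal ((1/2) ^ Suc i) * ?S" for i
  proof -
    have "ennreal ((1/2) ^ Suc i) * 2 ^ (i + 1) = ennreal ((1/2) ^ Suc i) * ennreal (2 ^ (i + 1))"
      using ennreal_power[of 2 "i + 1"] by simp
    also have "\<dots> = 1"
      by (simp add: power_divide flip: ennreal_mult)
    finally have "a i = ennreal ((1/2) ^ Suc i) * (2 ^ (i + 1) * a i)"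
      by (simp only: mult.assoc[symmetric] mult_1)
    also have "\<dots> \<le> ennreal ((1/2) ^ Suc i) * ?S"
      by (intro mult_left_mono SUP_upper) auto
    finally show ?thesis .
  qed
  then have "(\<Sum>i. a i) \<le> (\<Sum>i. ennreal ((1/2) ^ Suc i) * ?S)"
    by (intro suminf_le) auto
  also have "\<dots> = (\<Sum>i. ennreal ((1/2) ^ Suc i)) * ?S" by simp
  finally show ?thesis unfolding suminf_half_powers_ennreal by simp
qed

text \<open>Applying \<open>T\<close> shifts the index by one, which costs 1/a. Norms do not enter,
  so the lemma serves the maximal function on the line as well as the supremum of the coordinatewise
  ones; \<open>S\<close> is a class on which \<open>T\<close> is countably subadditive.\<close>

lemma rubio_de_francia_iteration:
  fixes T :: "('a \<Rightarrow> ennreal) \<Rightarrow> 'a \<Rightarrow> ennreal" and a :: real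
  assumes h: "h \<in> S" and TS: "\<And>f. f \<in> S \<Longrightarrow> T f \<in> S" and a: "0 < a"
    and sub: "\<And>f x. (\<And>k. f k \<in> S) \<Longrightarrow> T (\<lambda>x. \<Sum>k. ennreal (a ^ k) * f k x) x \<le> (\<Sum>k. ennreal (a ^ k) * T (f k) x)"
  defines "U \<equiv> \<lambda>x. \<Sum>k. ennreal (a ^ k) * (T ^^ k) h x"
  shows "h x \<le> U x" "T U x \<le> ennreal (1 / a) * U x"
proof -
  have S: "(T ^^ k) h \<in> S" for k by (induction k) (auto intro: h TS)
  have "ennreal (a ^ 0) * (T ^^ 0) h x \<le> U x"
    unfolding U_def by (rule le_suminf_ennreal)
  then show "h x \<le> U x" by simp
  have "T U x \<le> (\<Sum>k. ennreal (a ^ k) * T ((T ^^ k) h) x)"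
    unfolding U_def by (rule sub) (rule S)
  also have "\<dots> = (\<Sum>k. ennreal (1 / a) * (ennreal (a ^ Suc k) * (T ^^ Suc k) h x))"
    using a by (intro suminf_cong) (simp add: mult.assoc[symmetric] flip: ennreal_mult)
  also have "\<dots> = ennreal (1 / a) * (\<Sum>k. ennreal (a ^ Suc k) * (T ^^ Suc k) h x)" by simp
  also have "(\<Sum>k. ennreal (a ^ Suc k) * (T ^^ Suc k) h x) \<le> U x"
  proof -
    have "(\<Sum>k. ennreal (a ^ k) * (T ^^ k) h x)
        = (\<Sum>k. ennreal (a ^ (k + 1)) * (T ^^ (k + 1)) h x) + (\<Sum>k<1. ennreal (a ^ k) * (T ^^ k) h x)"
      by (rule suminf_offset) auto
    then show ?thesis unfolding U_def by simp
  qed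
  finally show "T U x \<le> ennreal (1 / a) * U x" by (simp add: mult_left_mono)
qed

lemma maxfun_1_weighted_suminf:
  assumes [measurable]: "\<And>k. f k \<in> borel_measurable borel"
  shows "maxfun (\<lambda>_. 1) (\<lambda>u. \<Sum>k. ennreal (a ^ k) * f k u) t \<le> (\<Sum>k. ennreal (a ^ k) * maxfun (\<lambda>_. 1) (f k) t)"
proof (rule maxfun_1_leI)
  fix c d :: real assume cd: "c \<in> \<rat>" "d \<in> \<rat>" "c < t" "t < d"
  have "(\<integral>\<^sup>+ u\<in>{c<..<d}. (\<Sum>k. ennreal (a ^ k) * f k u) \<partial>lborel)
     = (\<integral>\<^sup>+ u. (\<Sum>k. ennreal (a ^ k) * (f k u * indicator {c<..<d} u)) \<partial>lborel)"
    by (simp add: mult.assoc[symmetric])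
  also have "\<dots> = (\<Sum>k. ennreal (a ^ k) * (\<integral>\<^sup>+ u\<in>{c<..<d}. f k u \<partial>lborel))"
    by (simp add: nn_integral_suminf nn_integral_cmult)
  also have "\<dots> \<le> (\<Sum>k. ennreal (a ^ k) * (ennreal (d - c) * maxfun (\<lambda>_. 1) (f k) t))"
    using cd by (intro suminf_le mult_left_mono maxfun_1_ge) auto
  also have "\<dots> = ennreal (d - c) * (\<Sum>k. ennreal (a ^ k) * maxfun (\<lambda>_. 1) (f k) t)"
    by (simp add: mult.left_commute)
  finally show "(\<integral>\<^sup>+ u\<in>{c<..<d}. (\<Sum>k. ennreal (a ^ k) * f k u) \<partial>lborel)
     \<le> ennreal (d - c) * (\<Sum>k. ennreal (a ^ k) * maxfun (\<lambda>_. 1) (f k) t)" .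
qed

text \<open>The s-th power of the norm in L^s of the factored weight. Exchanging \<open>v0\<close>
  and \<open>v1\<close> and passing to the conjugate exponent gives the dual weight.\<close>

definition wint :: "real \<Rightarrow> (real \<Rightarrow> real) \<Rightarrow> (real \<Rightarrow> real) \<Rightarrow> (real \<Rightarrow> ennreal) \<Rightarrow> ennreal" where
  "wint s v0 v1 F = (\<integral>\<^sup>+ t. epowr (F t) s * ennreal (v0 t * v1 t powr (1 - s)) \<partial>lborel)"

lemma A1w_mono:
  assumes v: "A1w C v" and CD: "C \<le> D"
  shows "A1w D v"
proof -
  have le: "ennreal (C * v t) \<le> ennreal (D * v t)" for t
    using v CD unfolding A1w_def by (intro ennreal_leI mult_right_mono) (auto intro: less_imp_le)
  have "AE t in lborel. maxfun (\<lambda>_. 1) (\<lambda>u. ennreal (v u)) t \<le> ennreal (C * v t)"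
    using v unfolding A1w_def by blast
  then have "AE t in lborel. maxfun (\<lambda>_. 1) (\<lambda>u. ennreal (v u)) t \<le> ennreal (D * v t)"
    by eventually_elim (rule order_trans[OF _ le])
  then show ?thesis using v unfolding A1w_def by blast
qed

text \<open>\<open>D\<close> depends on \<open>s\<close> and \<open>C\<close> only, both as A_1
  constant of \<open>u\<close> and as norm bound. Positivity of \<open>h\<close> makes
  \<open>u\<close> positive, and the finite norm makes the iteration finite almost
  everywhere.\<close>

lemma A1_majorant:
  assumes s: "1 < s" and C: "0 < C"
  obtains D :: real where "0 < D"
    "\<And>v0 v1 h. A1w C v0 \<Longrightarrow> A1w C v1 \<Longrightarrow> h \<in> borel_measurable borel \<Longrightarrow> (\<forall>t. 0 < h t) \<Longrightarrow>
       wint s v0 v1 h < top \<Longrightarrow>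
       \<exists>u. A1w D u \<and> (AE t in lborel. h t \<le> ennreal (u t)) \<and>
          wint s v0 v1 (\<lambda>t. ennreal (u t)) \<le> ennreal D * wint s v0 v1 h"
proof -
  let ?M = "maxfun (\<lambda>_. 1)"
  obtain K where K: "0 < K" "\<And>v0 v1 h. A1w C v0 \<Longrightarrow> A1w C v1 \<Longrightarrow> h \<in> borel_measurable borel \<Longrightarrow>
     wint s v0 v1 (?M h) \<le> ennreal K * wint s v0 v1 h"
    by (rule muckenhoupt[OF s C, folded wint_def]) (rule that)
  \<comment> \<open>\<open>K\<close> bounds the s-th power, so (2a)^s = 1/(2K) leaves 2^s 2^-k for
    the k-th iterate, the 2 in 2a paying for trading the sum for a supremum.\<close>
  define a where "a = 1 / (2 * (2 * K) powr (1 / s))"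
  have a: "0 < a" using K by (simp add: a_def)
  have "(2 * a) powr s = 1 / (2 * K)"
    using K s by (simp add: a_def powr_divide powr_powr)
  define c where "c = 2 * 2 powr s"
  define D where "D = max (1 / a) c"
  have "\<exists>u. A1w D u \<and> (AE t in lborel. h t \<le> ennreal (u t)) \<and>
          wint s v0 v1 (\<lambda>t. ennreal (u t)) \<le> ennreal D * wint s v0 v1 h"
    if v: "A1w C v0" "A1w C v1" and h [measurable]: "h \<in> borel_measurable borel"
      and hp: "\<forall>t. 0 < h t" and hfin: "wint s v0 v1 h < top" for v0 v1 h
  proof -
    have [measurable]: "v0 \<in> borel_measurable borel" "v1 \<in> borel_measurable borel"
      and pos: "\<And>t. 0 < v0 t" "\<And>t. 0 < v1 t"
      using v unfolding A1w_def by auto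
    define w where "w t = ennreal (v0 t * v1 t powr (1 - s))" for t
    have [measurable]: "w \<in> borel_measurable borel" unfolding w_def by measurable
    have wp: "0 < w t" for t using pos[of t] by (simp add: w_def)
    define f where "f k = (?M ^^ k) h" for k
    have fm [measurable]: "f k \<in> borel_measurable borel" for k
      unfolding f_def by (induction k) auto
    define U where "U t = (\<Sum>k. ennreal (a ^ k) * f k t)" for t
    have [measurable]: "U \<in> borel_measurable borel" unfolding U_def by measurable
    have hU: "h t \<le> U t" and MU: "?M U t \<le> ennreal (1 / a) * U t" for t
      unfolding U_def f_def
      using rubio_de_francia_iteration[of h "borel_measurable borel" ?M a t] a maxfun_1_weighted_suminf
      by auto
    have fk: "wint s v0 v1 (f k) \<le> ennreal (K ^ k) * wint s v0 v1 h" for k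
    proof (induction k)
      case (Suc k)
      have "wint s v0 v1 (f (Suc k)) \<le> ennreal K * wint s v0 v1 (f k)"
        using K(2)[OF v fm[of k]] by (simp add: f_def)
      also have "\<dots> \<le> ennreal K * (ennreal (K ^ k) * wint s v0 v1 h)"
        by (intro mult_left_mono Suc) auto
      finally show ?case using K by (simp add: ennreal_mult mult.assoc)
    qed (simp add: f_def)
    have Us: "epowr (U t) s \<le> (\<Sum>k. ennreal ((2 * (2 * a) ^ k) powr s) * epowr (f k t) s)" for t
    proof -
      have "U t \<le> (SUP k. 2 ^ (k + 1) * (ennreal (a ^ k) * f k t))"
        unfolding U_def by (rule suminf_le_SUP_ennreal)
      also have "\<dots> = (SUP k. ennreal (2 * (2 * a) ^ k) * f k t)"
      proof -
        have "2 ^ (k + 1) * ennreal (a ^ k) = ennreal (2 * (2 * a) ^ k)" for k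
        proof -
          have "2 ^ (k + 1) * ennreal (a ^ k) = ennreal (2 ^ (k + 1)) * ennreal (a ^ k)"
            using ennreal_power[of 2 "k + 1"] by simp
          also have "\<dots> = ennreal (2 ^ (k + 1) * a ^ k)"
            using a by (simp only: ennreal_mult zero_le_power zero_le_numeral less_imp_le)
          also have "2 ^ (k + 1) * a ^ k = 2 * (2 * a) ^ k" by (simp add: power_mult_distrib)
          finally show ?thesis .
        qed
        then show ?thesis by (simp only: mult.assoc[symmetric])
      qed
      finally have "epowr (U t) s \<le> (SUP k. epowr (ennreal (2 * (2 * a) ^ k) * f k t) s)"
        using s by (subst epowr_SUP[symmetric]) (auto intro!: epowr_mono)
      also have "\<dots> = (SUP k. ennreal ((2 * (2 * a) ^ k) powr s) * epowr (f k t) s)"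
        using a by (simp add: epowr_mult epowr_ennreal)
      also have "\<dots> \<le> (\<Sum>k. ennreal ((2 * (2 * a) ^ k) powr s) * epowr (f k t) s)"
        by (intro SUP_least le_suminf_ennreal)
      finally show ?thesis .
    qed
    have coef: "(2 * (2 * a) ^ k) powr s * K ^ k = 2 powr s * (1 / 2) ^ k" for k
    proof -
      have "((2 * a) ^ k) powr s = ((2 * a) powr s) ^ k"
        by (induction k) (simp_all add: powr_mult)
      then have "(2 * (2 * a) ^ k) powr s = 2 powr s * ((2 * a) powr s) ^ k"
        by (simp only: powr_mult)
      then show ?thesis using \<open>(2 * a) powr s = _\<close> K by (simp add: power_divide power_mult_distrib)
    qed
    have "wint s v0 v1 U \<le> (\<integral>\<^sup>+ t. (\<Sum>k. ennreal ((2 * (2 * a) ^ k) powr s) * epowr (f k t) s) * w t \<partial>lborel)"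
      unfolding wint_def w_def by (intro nn_integral_mono mult_right_mono Us) auto
    also have "\<dots> = (\<Sum>k. ennreal ((2 * (2 * a) ^ k) powr s) * wint s v0 v1 (f k))"
      unfolding wint_def w_def[symmetric]
      by (simp add: nn_integral_suminf nn_integral_cmult mult.assoc flip: ennreal_suminf_multc)
    also have "\<dots> \<le> (\<Sum>k. ennreal ((2 * (2 * a) ^ k) powr s) * (ennreal (K ^ k) * wint s v0 v1 h))"
      by (intro suminf_le mult_left_mono fk) auto
    also have "\<dots> = (\<Sum>k. ennreal (2 * 2 powr s) * (ennreal ((1 / 2) ^ Suc k) * wint s v0 v1 h))"
    proof (rule suminf_cong)
      fix k
      have "ennreal ((2 * (2 * a) ^ k) powr s) * ennreal (K ^ k) = ennreal (2 * 2 powr s) * ennreal ((1 / 2) ^ Suc k)"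
        using K coef[of k] by (simp flip: ennreal_mult)
      then show "ennreal ((2 * (2 * a) ^ k) powr s) * (ennreal (K ^ k) * wint s v0 v1 h)
          = ennreal (2 * 2 powr s) * (ennreal ((1 / 2) ^ Suc k) * wint s v0 v1 h)"
        unfolding mult.assoc[symmetric] by simp
    qed
    also have "\<dots> = ennreal c * ((\<Sum>k. ennreal ((1 / 2) ^ Suc k)) * wint s v0 v1 h)"
      by (simp add: c_def del: power_Suc)
    finally have wU: "wint s v0 v1 U \<le> ennreal c * wint s v0 v1 h"
      unfolding suminf_half_powers_ennreal by simp
    also have "\<dots> < top" using hfin by (simp add: ennreal_mult_less_top)
    finally have "wint s v0 v1 U < top" .
    then have "AE t in lborel. epowr (U t) s * w t \<noteq> \<infinity>"
      unfolding wint_def w_def[symmetric] by (intro nn_integral_PInf_AE) auto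
    then have Ufin: "AE t in lborel. U t \<noteq> top"
    proof eventually_elim
      case (elim t)
      then show ?case using wp[of t] by (cases "U t = top") (simp_all add: ennreal_top_mult zero_less_iff_neq_zero)
    qed
    \<comment> \<open>\<open>U\<close> is infinite at most on a null set; the value 1 there keeps
      \<open>u\<close> strictly positive, as \<open>A1w\<close> demands.\<close>
    define u where "u t = (if U t = top then 1 else enn2real (U t))" for t
    have [measurable]: "u \<in> borel_measurable borel" unfolding u_def by measurable
    have Up: "0 < U t" for t by (rule less_le_trans[OF hp[rule_format] hU])
    have up: "0 < u t" for t
      using Up[of t] by (cases "U t") (simp_all add: u_def)
    have uU: "AE t in lborel. ennreal (u t) = U t"
      using Ufin
    proof eventually_elim
      case (elim t)
      then show ?case by (cases "U t") (simp_all add: u_def)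
    qed
    have "AE t in lborel. ?M (\<lambda>t. ennreal (u t)) t \<le> ennreal (1 / a * u t)"
      using uU
    proof eventually_elim
      case (elim t)
      have "?M (\<lambda>t. ennreal (u t)) t \<le> ?M U t"
        by (intro maxfun_mono_AE, use uU in eventually_elim) simp
      also have "\<dots> \<le> ennreal (1 / a) * ennreal (u t)" using MU[of t] elim by simp
      also have "\<dots> = ennreal (1 / a * u t)" using a up[of t] by (subst ennreal_mult) simp_all
      finally show ?case .
    qed
    then have "A1w (1 / a) u" using up unfolding A1w_def by (intro conjI allI) simp_all
    moreover have "AE t in lborel. h t \<le> ennreal (u t)"
      using uU by eventually_elim (simp add: hU)
    moreover have "wint s v0 v1 (\<lambda>t. ennreal (u t)) = wint s v0 v1 U"
      unfolding wint_def
      by (intro nn_integral_cong_AE, use uU in eventually_elim) simp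
    moreover have "wint s v0 v1 U \<le> ennreal D * wint s v0 v1 h"
      by (rule order_trans[OF wU]) (auto simp: D_def intro!: mult_right_mono ennreal_leI)
    ultimately show ?thesis using A1w_mono[of "1 / a" u D] by (intro exI[of _ u]) (simp add: D_def)
  qed
  note maj = this
  have "0 < D" using a by (auto simp: D_def less_max_iff_disj)
  then show ?thesis by (rule that[of D]) (rule maj)
qed

lemma A1w_const: "1 \<le> C \<Longrightarrow> A1w C (\<lambda>_. 1)"
proof -
  assume "1 \<le> C"
  then have "maxfun (\<lambda>_. 1) (\<lambda>_. ennreal 1) t \<le> ennreal (C * 1)" for t
    by (intro order_trans[OF maxfun_1_leI[of t _ 1]]) simp_all
  then show ?thesis unfolding A1w_def by simp
qed

section \<open>Young-type inequalities and weighted extrapolation on the line\<close>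

lemma young_power_real:
  fixes f u v e :: real
  assumes "0 \<le> f" "0 < u" "0 < v" "0 < e" "1 < r"
  shows "f * v \<le> e * (u * v) + e powr (1 - r) * (f powr r * (v * u powr (1 - r)))"
\<comment> \<open>At f = e u both terms on the right equal f v; below, the first one suffices,
  above, the second. This is what turns exponent 1 and weight \<open>v\<close> into exponent
  \<open>r\<close> and weight v u^(1-r).\<close>
proof (cases "f \<le> e * u")
  case True
  then have "f * v \<le> e * u * v" using assms by (intro mult_right_mono) auto
  moreover have "0 \<le> e powr (1 - r) * (f powr r * (v * u powr (1 - r)))" using assms by simp
  ultimately show ?thesis by (simp add: mult.assoc)
next
  case False
  then have f: "0 < f" using assms by (meson less_le_trans mult_pos_pos not_le order.strict_trans)
  have "f = f powr r * f powr (1 - r)" using f by (simp flip: powr_add)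
  also have "f powr (1 - r) \<le> (e * u) powr (1 - r)"
    using False assms by (intro powr_mono2') auto
  finally have "f \<le> f powr r * (e * u) powr (1 - r)" by (simp add: mult_left_mono)
  then have "f * v \<le> f powr r * (e * u) powr (1 - r) * v" using assms by (intro mult_right_mono) auto
  also have "\<dots> = e powr (1 - r) * (f powr r * (v * u powr (1 - r)))"
    using assms by (simp add: powr_mult)
  also have "\<dots> \<le> e * (u * v) + e powr (1 - r) * (f powr r * (v * u powr (1 - r)))"
    using assms by simp
  finally show ?thesis .
qed

lemma young_power:
  fixes u v e :: real
  assumes "F \<le> ennreal u" "0 < u" "0 < v" "0 < e" "1 < r"
  shows "F * ennreal v \<le> ennreal e * (ennreal u * ennreal v)
           + ennreal (e powr (1 - r)) * (epowr F r * ennreal (v * u powr (1 - r)))"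
proof -
  obtain f where f: "F = ennreal f" "0 \<le> f"
    using assms(1) by (cases F) (auto simp: top_unique)
  have "ennreal (f * v) \<le> ennreal (e * (u * v) + e powr (1 - r) * (f powr r * (v * u powr (1 - r))))"
    using young_power_real[OF f(2) assms(2-)] by (rule ennreal_leI)
  also have "\<dots> = ennreal e * (ennreal u * ennreal v)
           + ennreal (e powr (1 - r)) * (ennreal (f powr r) * ennreal (v * u powr (1 - r)))"
    using assms f by (simp add: ennreal_mult)
  finally show ?thesis using assms f by (simp add: epowr_ennreal ennreal_mult)
qed

text \<open>Young's inequality between L^s(w) and its dual, by cases on which term dominates: at g =
  d (v/w)^(s'-1) both equal g v. The parameter \<open>d\<close> is left free for the later
  absorption.\<close>

lemma young_conj_real:
  fixes g v w d :: real
  assumes "0 \<le> g" "0 < v" "0 < w" "0 < d" "1 < s"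
  shows "g * v \<le> d * (v powr (s / (s - 1)) * w powr (1 - s / (s - 1))) + d powr (1 - s) * (g powr s * w)"
proof -
  define s' where "s' = s / (s - 1)"
  have s': "1 < s'" "(s' - 1) * (s - 1) = 1" using assms by (auto simp: s'_def field_simps)
  show ?thesis unfolding s'_def[symmetric]
  proof (cases "g \<le> d * (v / w) powr (s' - 1)")
    case True
    then have "g * v \<le> d * (v / w) powr (s' - 1) * v" using assms by (intro mult_right_mono) auto
    also have "d * (v / w) powr (s' - 1) * v = d * (v powr s' * w powr (1 - s'))"
      using assms powr_add[of v "s' - 1" 1] powr_minus[of w "s' - 1"]
      by (simp add: powr_divide divide_simps)
    finally show "g * v \<le> d * (v powr s' * w powr (1 - s')) + d powr (1 - s) * (g powr s * w)"
      using assms by (intro add_increasing2) (simp_all add: mult.assoc)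
  next
    case False
    then have lt: "d * (v / w) powr (s' - 1) < g" by simp
    have g: "0 < g" using assms lt by (smt (verit) mult_nonneg_nonneg powr_ge_zero)
    have "(v / w) powr (s' - 1) \<le> g / d" using lt assms by (simp add: field_simps)
    then have "((v / w) powr (s' - 1)) powr (s - 1) \<le> (g / d) powr (s - 1)"
      using assms by (intro powr_mono2) auto
    also have "((v / w) powr (s' - 1)) powr (s - 1) = v / w"
      using assms s' by (simp add: powr_powr)
    finally have "v \<le> (g / d) powr (s - 1) * w" using assms by (simp add: field_simps)
    then have "g * v \<le> g * ((g / d) powr (s - 1) * w)" using g by (intro mult_left_mono) auto
    also have "\<dots> = d powr (1 - s) * (g powr s * w)"
      using g assms powr_add[of g "s - 1" 1] powr_minus[of d "s - 1"]
      by (simp add: powr_divide field_simps)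
    finally show "g * v \<le> d * (v powr s' * w powr (1 - s')) + d powr (1 - s) * (g powr s * w)"
      using assms by (intro add_increasing) simp_all
  qed
qed

lemma young_conj:
  fixes v w d :: real
  assumes "0 < v" "0 < w" "0 < d" "1 < s"
  shows "G * ennreal v \<le> ennreal d * (epowr (ennreal v) (s / (s - 1)) * ennreal (w powr (1 - s / (s - 1))))
           + ennreal (d powr (1 - s)) * (epowr G s * ennreal w)"
proof (cases G)
  case (real g)
  have "ennreal (g * v) \<le> ennreal (d * (v powr (s / (s - 1)) * w powr (1 - s / (s - 1))) + d powr (1 - s) * (g powr s * w))"
    using young_conj_real[OF real(1) assms] by (rule ennreal_leI)
  also have "\<dots> = ennreal d * (ennreal (v powr (s / (s - 1))) * ennreal (w powr (1 - s / (s - 1))))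
           + ennreal (d powr (1 - s)) * (ennreal (g powr s) * ennreal w)"
    using assms real by (simp add: ennreal_mult)
  finally show ?thesis using assms real by (simp add: epowr_ennreal ennreal_mult)
next
  case top
  then show ?thesis using assms by (simp add: ennreal_mult_top ennreal_top_mult)
qed

lemma wint_mono: "(\<And>t. F t \<le> G t) \<Longrightarrow> 0 \<le> s \<Longrightarrow> wint s v0 v1 F \<le> wint s v0 v1 G"
  unfolding wint_def by (intro nn_integral_mono mult_right_mono epowr_mono) auto

lemma wint_add_le:
  assumes [measurable]: "F \<in> borel_measurable borel" "G \<in> borel_measurable borel"
      "v0 \<in> borel_measurable borel" "v1 \<in> borel_measurable borel"
    and s: "0 \<le> s"
  shows "wint s v0 v1 (\<lambda>t. F t + G t) \<le> ennreal (2 powr s) * (wint s v0 v1 F + wint s v0 v1 G)"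
proof -
  define w where "w t = ennreal (v0 t * v1 t powr (1 - s))" for t
  have [measurable]: "w \<in> borel_measurable borel" unfolding w_def by measurable
  have "wint s v0 v1 (\<lambda>t. F t + G t) \<le> (\<integral>\<^sup>+ t. ennreal (2 powr s) * (epowr (F t) s * w t + epowr (G t) s * w t) \<partial>lborel)"
    unfolding wint_def w_def[symmetric]
  proof (rule nn_integral_mono)
    fix t
    have "epowr (F t + G t) s * w t \<le> ennreal (2 powr s) * (epowr (F t) s + epowr (G t) s) * w t"
      using s by (intro mult_right_mono epowr_add_le) auto
    then show "epowr (F t + G t) s * w t \<le> ennreal (2 powr s) * (epowr (F t) s * w t + epowr (G t) s * w t)"
      by (simp only: distrib_right mult.assoc)
  qed
  also have "\<dots> = ennreal (2 powr s) * (wint s v0 v1 F + wint s v0 v1 G)"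
    unfolding wint_def w_def[symmetric] by (simp add: nn_integral_cmult nn_integral_add)
  finally show ?thesis .
qed

lemma wint_cmult:
  assumes [measurable]: "F \<in> borel_measurable borel" "v0 \<in> borel_measurable borel" "v1 \<in> borel_measurable borel"
  shows "wint s v0 v1 (\<lambda>t. c * F t) = epowr c s * wint s v0 v1 F"
  unfolding wint_def by (simp add: epowr_mult mult.assoc nn_integral_cmult)

text \<open>Pairs rather than an operator: the intended \<open>F\<close> and \<open>G\<close> are
  inner mixed norms, along a line, of a maximal function and of the function itself, and
  \<open>F\<close> is not determined by \<open>G\<close>. \<open>N\<close> is uniform over the
  family and over all weights of constant \<open>C\<close>.\<close>

definition weighted_bounded :: "real \<Rightarrow> ((real \<Rightarrow> ennreal) \<times> (real \<Rightarrow> ennreal)) set \<Rightarrow> bool" where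
  "weighted_bounded r \<P> \<longleftrightarrow> (\<forall>C>0. \<exists>N>0. \<forall>v0 v1. A1w C v0 \<longrightarrow> A1w C v1 \<longrightarrow>
     (\<forall>(F, G)\<in>\<P>. wint r v0 v1 F \<le> ennreal N * wint r v0 v1 G))"

lemma weighted_boundedE:
  assumes "weighted_bounded r \<P>" "0 < C"
  obtains N where "0 < N" "\<And>v0 v1 F G. A1w C v0 \<Longrightarrow> A1w C v1 \<Longrightarrow> (F, G) \<in> \<P> \<Longrightarrow>
      wint r v0 v1 F \<le> ennreal N * wint r v0 v1 G"
proof -
  obtain N where N: "0 < N" "\<forall>v0 v1. A1w C v0 \<longrightarrow> A1w C v1 \<longrightarrow>
     (\<forall>(F, G)\<in>\<P>. wint r v0 v1 F \<le> ennreal N * wint r v0 v1 G)"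
    using assms(1)[unfolded weighted_bounded_def, rule_format, OF assms(2)] by (elim exE conjE)
  have "wint r v0 v1 F \<le> ennreal N * wint r v0 v1 G"
    if "A1w C v0" "A1w C v1" "(F, G) \<in> \<P>" for v0 v1 F G
    using N(2)[rule_format, OF that(1,2,3)] by simp
  with N(1) show ?thesis by (rule that)
qed

text \<open>\<open>e\<close> and \<open>d\<close> are chosen to make each of the two terms
  containing \<open>T\<close> at most (a+b)/4, so half of \<open>a\<close> moves to the left.
  Subtraction requires reals, hence the finiteness assumptions in
  \<open>extrapolation_positive\<close>.\<close>

lemma extrapolation_absorb:
  fixes a b c d e T N r s :: real
  assumes "0 \<le> a" "0 \<le> b" "0 < c" "0 < N" "T \<le> 2 powr s * (a + b)"
    and e_def: "e = 1 / (8 * c * 2 powr s)"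
    and d_def: "d = 1 / (4 * c * 2 powr s * e powr (1 - r) * N)"
    and le: "a \<le> e * (2 * c * T) + e powr (1 - r) * N * (d * c * T + d powr (1 - s) * b)"
  shows "a \<le> (1 + 2 * (e powr (1 - r) * N * d powr (1 - s))) * b"
proof -
  let ?X = "2 powr s * (a + b)"
  have e: "0 < e" and d: "0 < d" using assms by (auto simp: e_def d_def)
  have "e * (2 * c * T) \<le> e * (2 * c * ?X)"
    using assms e by (intro mult_left_mono) auto
  also have "\<dots> = (a + b) / 4" using assms(3) by (simp add: e_def field_simps)
  finally have 1: "e * (2 * c * T) \<le> (a + b) / 4" .
  have "e powr (1 - r) * N * (d * c * T) \<le> e powr (1 - r) * N * (d * c * ?X)"
    using assms e d by (intro mult_left_mono) auto
  also have "\<dots> = (e powr (1 - r) * N * c * 2 powr s) * d * (a + b)" by simp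
  also have "(e powr (1 - r) * N * c * 2 powr s) * d = 1 / 4"
    using assms(3,4) e unfolding d_def by (simp add: field_simps)
  finally have 2: "e powr (1 - r) * N * (d * c * T) \<le> (a + b) / 4" by simp
  have "a \<le> (a + b) / 4 + (a + b) / 4 + e powr (1 - r) * N * d powr (1 - s) * b"
    using le 1 2 by (simp add: distrib_left mult.assoc)
  then show ?thesis by (simp add: field_simps)
qed

text \<open>The weight \<open>v * u powr (1 - r)\<close> is built from majorants \<open>u \<ge> F + G\<close> and
  \<open>v \<ge> (F + G) powr (s - 1) * w\<close>; this handles \<open>r < s\<close> and \<open>s < r\<close> at once.\<close>

lemma extrapolation_positive:
  assumes r: "1 < r" and s: "1 < s" and C: "0 < C" and bd: "weighted_bounded r \<P>"
  obtains K :: real where "0 < K"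
    "\<And>v0 v1 F G F' G'. A1w C v0 \<Longrightarrow> A1w C v1 \<Longrightarrow> (F, G) \<in> \<P> \<Longrightarrow>
       F' \<in> borel_measurable borel \<Longrightarrow> G' \<in> borel_measurable borel \<Longrightarrow>
       (\<forall>t. F' t \<le> F t) \<Longrightarrow> (\<forall>t. G t \<le> G' t) \<Longrightarrow> (\<forall>t. 0 < G' t) \<Longrightarrow>
       wint s v0 v1 F' < top \<Longrightarrow> wint s v0 v1 G' < top \<Longrightarrow>
       wint s v0 v1 F' \<le> ennreal K * wint s v0 v1 G'"
proof -
  define s' where "s' = s / (s - 1)"
  have s': "1 < s'" using s by (simp add: s'_def field_simps)
  have conj: "(s - 1) * s' = s" "(1 - s') * (1 - s) = 1" using s by (simp_all add: s'_def field_simps)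
  obtain D1 where D1: "0 < D1" 
    "\<And>v0 v1 h. A1w C v0 \<Longrightarrow> A1w C v1 \<Longrightarrow> h \<in> borel_measurable borel \<Longrightarrow> (\<forall>t. 0 < h t) \<Longrightarrow>
       wint s v0 v1 h < top \<Longrightarrow>
       \<exists>u. A1w D1 u \<and> (AE t in lborel. h t \<le> ennreal (u t)) \<and>
          wint s v0 v1 (\<lambda>t. ennreal (u t)) \<le> ennreal D1 * wint s v0 v1 h"
    by (rule A1_majorant[OF s C]) (rule that)
  obtain D2 where D2: "0 < D2"
    "\<And>v0 v1 h. A1w C v0 \<Longrightarrow> A1w C v1 \<Longrightarrow> h \<in> borel_measurable borel \<Longrightarrow> (\<forall>t. 0 < h t) \<Longrightarrow>
       wint s' v0 v1 h < top \<Longrightarrow>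
       \<exists>u. A1w D2 u \<and> (AE t in lborel. h t \<le> ennreal (u t)) \<and>
          wint s' v0 v1 (\<lambda>t. ennreal (u t)) \<le> ennreal D2 * wint s' v0 v1 h"
    by (rule A1_majorant[OF s' C]) (rule that)
  define D where "D = max D1 D2"
  have c: "0 < D" using D1 by (auto simp: D_def)
  obtain N where N: "0 < N" "\<And>v0 v1 F G. A1w D v0 \<Longrightarrow> A1w D v1 \<Longrightarrow> (F, G) \<in> \<P> \<Longrightarrow>
      wint r v0 v1 F \<le> ennreal N * wint r v0 v1 G"
    by (rule weighted_boundedE[OF bd c]) (rule that)
  define e where "e = 1 / (8 * D * 2 powr s)"
  define d where "d = 1 / (4 * D * 2 powr s * e powr (1 - r) * N)"
  have e: "0 < e" using c by (simp add: e_def)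
  have d: "0 < d" using c e N by (simp add: d_def)
  define K where "K = 1 + 2 * (e powr (1 - r) * N * d powr (1 - s))"
  have "0 < K" using N by (simp add: K_def add_pos_nonneg)
  moreover have "wint s v0 v1 F' \<le> ennreal K * wint s v0 v1 G'"
    if v: "A1w C v0" "A1w C v1" and FG: "(F, G) \<in> \<P>"
      and [measurable]: "F' \<in> borel_measurable borel" "G' \<in> borel_measurable borel"
      and F'0: "\<forall>t. F' t \<le> F t" and G'0: "\<forall>t. G t \<le> G' t" "\<forall>t. 0 < G' t"
      and fin: "wint s v0 v1 F' < top" "wint s v0 v1 G' < top" for v0 v1 F G F' G'
  proof -
    have [measurable]: "v0 \<in> borel_measurable borel" "v1 \<in> borel_measurable borel"
      and pos: "\<And>t. 0 < v0 t" "\<And>t. 0 < v1 t"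
      using v unfolding A1w_def by auto
    note F' = F'0[rule_format] and G' = G'0[rule_format]
    define w where "w t = v0 t * v1 t powr (1 - s)" for t
    define \<sigma> where "\<sigma> t = v1 t * v0 t powr (1 - s')" for t
    have [measurable]: "w \<in> borel_measurable borel" "\<sigma> \<in> borel_measurable borel"
      unfolding w_def \<sigma>_def by measurable
    have wp: "0 < w t" and \<sigma>p: "0 < \<sigma> t" for t
      using pos[of t] by (simp_all add: w_def \<sigma>_def less_imp_neq[symmetric])
    have \<sigma>w: "\<sigma> t = w t powr (1 - s')" for t
      using pos[of t] conj by (simp add: w_def \<sigma>_def powr_mult powr_powr mult.commute)
    have wint_w: "wint s v0 v1 f = (\<integral>\<^sup>+ t. epowr (f t) s * ennreal (w t) \<partial>lborel)" for f
      by (simp add: wint_def w_def)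
    have wint_\<sigma>: "wint s' v1 v0 f = (\<integral>\<^sup>+ t. epowr (f t) s' * ennreal (\<sigma> t) \<partial>lborel)" for f
      by (simp add: wint_def \<sigma>_def)
    \<comment> \<open>The finite norm of \<open>F'\<close> allows absorption; positivity of
      \<open>G'\<close> makes \<open>H\<close> positive, hence admissible for
      \<open>A1_majorant\<close>.\<close>
    define H where "H t = F' t + G' t" for t
    define T where "T = wint s v0 v1 H"
    have [measurable]: "H \<in> borel_measurable borel" unfolding H_def by measurable
    have Hp: "0 < H t" for t using G'(2)[of t] by (simp add: H_def add_nonneg_pos)
    have T_le: "T \<le> ennreal (2 powr s) * (wint s v0 v1 F' + wint s v0 v1 G')"
      unfolding T_def H_def using s by (intro wint_add_le) auto
    also have "\<dots> < top" using fin by (simp add: ennreal_mult_less_top)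
    finally have Tfin: "T < top" .
    obtain u where u: "A1w D1 u" "AE t in lborel. H t \<le> ennreal (u t)"
      "wint s v0 v1 (\<lambda>t. ennreal (u t)) \<le> ennreal D1 * T"
      using D1(2)[of v0 v1 H] v Hp Tfin unfolding T_def by auto
    \<comment> \<open>The function dual to \<open>H\<close>: its integral in L^s'(\<sigma>) equals
      that of \<open>H\<close> in L^s(w), since (s-1) s' = s and w^s' \<sigma> = w.\<close>
    define h where "h t = epowr (H t) (s - 1) * ennreal (w t)" for t
    have [measurable]: "h \<in> borel_measurable borel" unfolding h_def by measurable
    have hp: "0 < h t" for t using Hp[of t] wp[of t] by (simp add: h_def ennreal_zero_less_mult_iff)
    have hT: "wint s' v1 v0 h = T"
      unfolding T_def wint_w wint_\<sigma>
    proof (rule nn_integral_cong)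
      fix t
      have "ennreal (w t powr s') * ennreal (\<sigma> t) = ennreal (w t)"
        using wp[of t] unfolding \<sigma>w by (simp flip: ennreal_mult powr_add)
      then show "epowr (h t) s' * ennreal (\<sigma> t) = epowr (H t) s * ennreal (w t)"
        using wp[of t] by (simp add: h_def epowr_mult epowr_epowr conj epowr_ennreal mult.assoc)
    qed
    obtain v where v': "A1w D2 v" "AE t in lborel. h t \<le> ennreal (v t)"
      "wint s' v1 v0 (\<lambda>t. ennreal (v t)) \<le> ennreal D2 * T"
      using D2(2)[of v1 v0 h] v hp Tfin unfolding hT by auto
    have [measurable]: "u \<in> borel_measurable borel" "v \<in> borel_measurable borel"
      and up: "\<And>t. 0 < u t" and vp: "\<And>t. 0 < v t"
      using u(1) v'(1) unfolding A1w_def by auto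
    have uD: "A1w D u" and vD: "A1w D v"
      using u(1) v'(1) by (auto intro: A1w_mono simp: D_def)
    have uT: "wint s v0 v1 (\<lambda>t. ennreal (u t)) \<le> ennreal D * T"
      using u(3) by (rule order_trans) (auto simp: D_def intro!: mult_right_mono ennreal_leI)
    have vT: "wint s' v1 v0 (\<lambda>t. ennreal (v t)) \<le> ennreal D * T"
      using v'(3) by (rule order_trans) (auto simp: D_def intro!: mult_right_mono ennreal_leI)
    have HV: "(\<integral>\<^sup>+ t. f t * ennreal (v t) \<partial>lborel) \<le> ennreal \<delta> * (ennreal D * T) + ennreal (\<delta> powr (1 - s)) * wint s v0 v1 f"
      if [measurable]: "f \<in> borel_measurable borel" and "0 < \<delta>" for f \<delta>
    proof -
      have "(\<integral>\<^sup>+ t. f t * ennreal (v t) \<partial>lborel) \<le> (\<integral>\<^sup>+ t. ennreal \<delta> * (epowr (ennreal (v t)) s' * ennreal (\<sigma> t))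
           + ennreal (\<delta> powr (1 - s)) * (epowr (f t) s * ennreal (w t)) \<partial>lborel)"
        unfolding \<sigma>w s'_def using young_conj[OF vp wp \<open>0 < \<delta>\<close> s] by (intro nn_integral_mono)
      also have "\<dots> = ennreal \<delta> * wint s' v1 v0 (\<lambda>t. ennreal (v t)) + ennreal (\<delta> powr (1 - s)) * wint s v0 v1 f"
        unfolding wint_w wint_\<sigma> by (simp add: nn_integral_add nn_integral_cmult)
      also have "\<dots> \<le> ennreal \<delta> * (ennreal D * T) + ennreal (\<delta> powr (1 - s)) * wint s v0 v1 f"
        by (intro add_mono mult_left_mono vT) auto
      finally show ?thesis .
    qed
    have UV: "(\<integral>\<^sup>+ t. ennreal (u t) * ennreal (v t) \<partial>lborel) \<le> ennreal (2 * D) * T"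
    proof -
      have "(\<integral>\<^sup>+ t. ennreal (u t) * ennreal (v t) \<partial>lborel) \<le> ennreal D * T + wint s v0 v1 (\<lambda>t. ennreal (u t))"
        using HV[of "\<lambda>t. ennreal (u t)" 1] by simp
      also have "\<dots> \<le> ennreal D * T + ennreal D * T" by (intro add_left_mono uT)
      also have "\<dots> = ennreal (2 * D) * T"
        using c ennreal_plus[of D D] by (simp only: mult_2 distrib_right less_imp_le)
      finally show ?thesis .
    qed
    \<comment> \<open>Since G \<le> u almost everywhere and r > 1, G^r u^(1-r) \<le> G. So the
      r-integral of \<open>G\<close> against the constructed weight reduces to an integral against
      \<open>v\<close>, which \<open>HV\<close> returns to exponent \<open>s\<close>.\<close>
    have GV: "wint r v u G \<le> (\<integral>\<^sup>+ t. G' t * ennreal (v t) \<partial>lborel)"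
      unfolding wint_def
    proof (rule nn_integral_mono_AE, use u(2) in eventually_elim)
      case (elim t)
      have "G t \<le> H t" using G'(1)[of t] by (simp add: H_def add_increasing)
      then have "G t \<le> ennreal (u t)" using elim by (rule order_trans)
      then obtain g where g: "G t = ennreal g" "0 \<le> g" "g \<le> u t"
        using up[of t] by (cases "G t") (auto simp: top_unique)
      have "g powr r * u t powr (1 - r) \<le> g"
      proof (cases "g = 0")
        case False
        have "u t powr (1 - r) \<le> g powr (1 - r)" using g r False by (intro powr_mono2') auto
        then have "g powr r * u t powr (1 - r) \<le> g powr r * g powr (1 - r)" by (intro mult_left_mono) auto
        also have "\<dots> = g" using g False by (simp flip: powr_add)
        finally show ?thesis .
      qed simp
      then have "g powr r * (v t * u t powr (1 - r)) \<le> g * v t"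
        using vp[of t] by (simp add: mult.left_commute mult_left_mono mult.commute[of _ "v t"])
      then have "ennreal (g powr r * (v t * u t powr (1 - r))) \<le> ennreal (g * v t)" by (rule ennreal_leI)
      then have "epowr (G t) r * ennreal (v t * u t powr (1 - r)) \<le> G t * ennreal (v t)"
        using g vp[of t] by (simp add: epowr_ennreal flip: ennreal_mult)
      also have "\<dots> \<le> G' t * ennreal (v t)" by (intro mult_right_mono G') auto
      finally show ?case .
    qed
    have "wint s v0 v1 F' \<le> (\<integral>\<^sup>+ t. F' t * ennreal (v t) \<partial>lborel)"
      unfolding wint_w
    proof (rule nn_integral_mono_AE, use v'(2) in eventually_elim)
      case (elim t)
      have "epowr (F' t) s = F' t * epowr (F' t) (s - 1)" using epowr_add[of "F' t" 1 "s - 1"] by simp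
      also have "\<dots> \<le> F' t * epowr (H t) (s - 1)"
        using s by (intro mult_left_mono epowr_mono) (auto simp: H_def)
      finally have "epowr (F' t) s * ennreal (w t) \<le> F' t * h t"
        unfolding h_def mult.assoc[symmetric] by (rule mult_right_mono) simp
      also have "\<dots> \<le> F' t * ennreal (v t)" using elim by (rule mult_left_mono) simp
      finally show ?case .
    qed
    also have "\<dots> \<le> (\<integral>\<^sup>+ t. ennreal e * (ennreal (u t) * ennreal (v t)) +
         ennreal (e powr (1 - r)) * (epowr (F' t) r * ennreal (v t * u t powr (1 - r))) \<partial>lborel)"
    proof (rule nn_integral_mono_AE, use u(2) in eventually_elim)
      case (elim t)
      have "F' t \<le> H t" by (simp add: H_def)
      then have "F' t \<le> ennreal (u t)" using elim by (rule order_trans)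
      then show ?case by (rule young_power[OF _ up vp e r])
    qed
    also have "\<dots> = ennreal e * (\<integral>\<^sup>+ t. ennreal (u t) * ennreal (v t) \<partial>lborel) + ennreal (e powr (1 - r)) * wint r v u F'"
      unfolding wint_def by (simp add: nn_integral_add nn_integral_cmult)
    also have "\<dots> \<le> ennreal e * (ennreal (2 * D) * T)
        + ennreal (e powr (1 - r)) * (ennreal N * (ennreal d * (ennreal D * T) + ennreal (d powr (1 - s)) * wint s v0 v1 G'))"
    proof (intro add_mono mult_left_mono UV)
      have "wint r v u F' \<le> wint r v u F"
        unfolding wint_def using F' r by (intro nn_integral_mono mult_right_mono epowr_mono) auto
      also have "\<dots> \<le> ennreal N * wint r v u G" by (rule N(2)[OF vD uD FG])
      also have "\<dots> \<le> ennreal N * (ennreal d * (ennreal D * T) + ennreal (d powr (1 - s)) * wint s v0 v1 G')"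
        using GV HV[of G' d] d by (intro mult_left_mono) (auto intro: order_trans)
      finally show "wint r v u F' \<le> ennreal N * (ennreal d * (ennreal D * T) + ennreal (d powr (1 - s)) * wint s v0 v1 G')" .
    qed auto
    finally have main: "wint s v0 v1 F' \<le> ennreal e * (ennreal (2 * D) * T)
        + ennreal (e powr (1 - r)) * (ennreal N * (ennreal d * (ennreal D * T) + ennreal (d powr (1 - s)) * wint s v0 v1 G'))" .
    obtain a where a: "wint s v0 v1 F' = ennreal a" "0 \<le> a" using fin(1) by (cases "wint s v0 v1 F'") auto
    obtain b where b: "wint s v0 v1 G' = ennreal b" "0 \<le> b" using fin(2) by (cases "wint s v0 v1 G'") auto
    obtain x where x: "T = ennreal x" "0 \<le> x" using Tfin by (cases T) auto
    have "x \<le> 2 powr s * (a + b)"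
      using T_le unfolding a b x using a b by (simp add: ennreal_le_iff flip: ennreal_plus ennreal_mult)
    moreover have "a \<le> e * (2 * D * x) + e powr (1 - r) * N * (d * D * x + d powr (1 - s) * b)"
      using main unfolding a(1) b(1) x(1) using a(2) b(2) x(2) c d e N(1)
      by (simp add: ennreal_le_iff mult.assoc flip: ennreal_plus ennreal_mult)
    ultimately have "a \<le> K * b"
      unfolding K_def using a b c N(1) by (intro extrapolation_absorb[OF _ _ _ _ _ e_def d_def]) auto
    then show ?thesis unfolding a b using \<open>0 < K\<close> b
      by (simp add: ennreal_leI flip: ennreal_mult)
  qed
  note main = this
  show ?thesis by (rule that[OF \<open>0 < K\<close>]) (rule main)
qed


text \<open>Finiteness and positivity are removed by a strictly positive function \<open>e\<close>
  of finite norm: \<open>F\<close> is replaced by its truncations at n e, and a small multiple of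
  \<open>e\<close> is added to \<open>G\<close>.\<close>

lemma extrapolation:
  assumes r: "1 < r" and s: "1 < s" and bd: "weighted_bounded r \<P>"
    and meas: "\<And>F G. (F, G) \<in> \<P> \<Longrightarrow> F \<in> borel_measurable borel \<and> G \<in> borel_measurable borel"
  shows "weighted_bounded s \<P>"
  unfolding weighted_bounded_def
proof (intro allI impI)
  fix C :: real assume C: "0 < C"
  obtain K where K: "0 < K"
    "\<And>v0 v1 F G F' G'. A1w C v0 \<Longrightarrow> A1w C v1 \<Longrightarrow> (F, G) \<in> \<P> \<Longrightarrow>
       F' \<in> borel_measurable borel \<Longrightarrow> G' \<in> borel_measurable borel \<Longrightarrow>
       (\<forall>t. F' t \<le> F t) \<Longrightarrow> (\<forall>t. G t \<le> G' t) \<Longrightarrow> (\<forall>t. 0 < G' t) \<Longrightarrow>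
       wint s v0 v1 F' < top \<Longrightarrow> wint s v0 v1 G' < top \<Longrightarrow>
       wint s v0 v1 F' \<le> ennreal K * wint s v0 v1 G'"
    by (rule extrapolation_positive[OF r s C bd]) (rule that)
  define N where "N = K * 2 powr s"
  have "0 < N" using K by (simp add: N_def)
  moreover have "wint s v0 v1 F \<le> ennreal N * wint s v0 v1 G"
    if v: "A1w C v0" "A1w C v1" and FG: "(F, G) \<in> \<P>" for v0 v1 F G
  proof (cases "wint s v0 v1 G = top")
    case False
    then have Gfin: "wint s v0 v1 G < top" by (simp add: less_top)
    have [measurable]: "v0 \<in> borel_measurable borel" "v1 \<in> borel_measurable borel"
      and pos: "\<And>t. 0 < v0 t" "\<And>t. 0 < v1 t"
      using v unfolding A1w_def by auto
    have [measurable]: "F \<in> borel_measurable borel" "G \<in> borel_measurable borel"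
      using meas[OF FG] by auto
    define w where "w t = v0 t * v1 t powr (1 - s)" for t
    have [measurable]: "w \<in> borel_measurable borel" unfolding w_def by measurable
    have wp: "0 < w t" for t using pos[of t] by (simp add: w_def less_imp_neq[symmetric])
    have wint_w: "wint s v0 v1 f = (\<integral>\<^sup>+ t. epowr (f t) s * ennreal (w t) \<partial>lborel)" for f
      by (simp add: wint_def w_def)
    obtain \<phi> :: "real \<Rightarrow> ennreal" where \<phi>m: "\<phi> \<in> borel_measurable lborel"
      and \<phi>: "integral\<^sup>N lborel \<phi> \<noteq> \<infinity>" "\<forall>x\<in>space lborel. 0 < \<phi> x \<and> \<phi> x < \<infinity>"
      using sigma_finite_measure.Ex_finite_integrable_function[OF sigma_finite_lborel] by (elim bexE conjE)
    have [measurable]: "\<phi> \<in> borel_measurable borel" using \<phi>m by simp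
    define e where "e t = epowr (\<phi> t * ennreal (1 / w t)) (1 / s)" for t
    have [measurable]: "e \<in> borel_measurable borel" unfolding e_def by measurable
    have ep: "0 < e t" for t using \<phi> wp[of t] by (simp add: e_def ennreal_zero_less_mult_iff)
    have "epowr (e t) s * ennreal (w t) = \<phi> t" for t
      using s wp[of t] by (simp add: e_def epowr_inv' mult.assoc flip: ennreal_mult)
    then have we: "wint s v0 v1 e = integral\<^sup>N lborel \<phi>" by (simp add: wint_w)
    obtain E where E: "wint s v0 v1 e = ennreal E" "0 \<le> E"
      using \<phi>(1) unfolding we by (cases "integral\<^sup>N lborel \<phi>") auto
    define f where "f n t = inf (F t) (of_nat n * e t)" for n :: nat and t
    have [measurable]: "f n \<in> borel_measurable borel" for n unfolding f_def by measurable
    have fn: "wint s v0 v1 (f n) \<le> ennreal N * wint s v0 v1 G" for n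
    proof (rule ennreal_le_epsilon)
      fix \<epsilon> :: real assume \<epsilon>: "0 < \<epsilon>"
      \<comment> \<open>Makes the contribution of \<open>e\<close> at most \<epsilon>; E + 1 instead
        of \<open>E\<close> excludes a zero denominator.\<close>
      define \<eta> where "\<eta> = (\<epsilon> / (N * (E + 1))) powr (1 / s)"
      have \<eta>: "0 < \<eta>" using \<epsilon> E \<open>0 < N\<close> by (simp add: \<eta>_def)
      define G' where "G' t = G t + ennreal \<eta> * e t" for t
      have [measurable]: "G' \<in> borel_measurable borel" unfolding G'_def by measurable
      have "wint s v0 v1 (\<lambda>t. ennreal \<eta> * e t) = ennreal (\<eta> powr s * E)"
        using \<eta> by (simp add: wint_cmult epowr_ennreal E ennreal_mult)
      then have G'_le: "wint s v0 v1 G' \<le> ennreal (2 powr s) * (wint s v0 v1 G + ennreal (\<eta> powr s * E))"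
        unfolding G'_def using wint_add_le[of G "\<lambda>t. ennreal \<eta> * e t" v0 v1 s] s by simp
      also have "\<dots> < top" using Gfin by (simp add: ennreal_mult_less_top)
      finally have G'fin: "wint s v0 v1 G' < top" .
      have "wint s v0 v1 (f n) \<le> wint s v0 v1 (\<lambda>t. of_nat n * e t)"
        using s by (intro wint_mono) (auto simp: f_def)
      also have "\<dots> < top"
        by (simp add: wint_cmult E ennreal_mult_less_top of_nat_less_top)
      finally have ffin: "wint s v0 v1 (f n) < top" .
      have "wint s v0 v1 (f n) \<le> ennreal K * wint s v0 v1 G'"
      proof (rule K(2)[OF v FG _ _ _ _ _ ffin G'fin])
        show "\<forall>t. 0 < G' t" using ep \<eta> by (auto simp: G'_def ennreal_zero_less_mult_iff add_nonneg_pos)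
      qed (auto simp: f_def G'_def)
      also have "\<dots> \<le> ennreal K * (ennreal (2 powr s) * (wint s v0 v1 G + ennreal (\<eta> powr s * E)))"
        by (intro mult_left_mono G'_le) simp
      also have "\<dots> = ennreal N * wint s v0 v1 G + ennreal (N * (\<eta> powr s * E))"
        using K(1) E(2) by (simp add: N_def ennreal_mult distrib_left mult.assoc)
      also have "\<dots> \<le> ennreal N * wint s v0 v1 G + ennreal \<epsilon>"
      proof (intro add_left_mono ennreal_leI)
        have "\<eta> powr s = \<epsilon> / (N * (E + 1))"
          using s \<epsilon> E \<open>0 < N\<close> by (simp add: \<eta>_def powr_powr)
        then have "N * (\<eta> powr s * E) = \<epsilon> * (E / (E + 1))"
          using \<open>0 < N\<close> by simp
        also have "\<dots> \<le> \<epsilon> * 1"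
          using \<epsilon> E by (intro mult_left_mono) auto
        finally show "N * (\<eta> powr s * E) \<le> \<epsilon>" by simp
      qed
      finally show "wint s v0 v1 (f n) \<le> ennreal N * wint s v0 v1 G + ennreal \<epsilon>" .
    qed
    have "F t = (SUP n. f n t)" for t
    proof -
      have "(SUP n. of_nat n * e t) = top"
        using ep[of t] by (simp add: SUP_mult_right_ennreal[symmetric] ennreal_SUP_of_nat_eq_top ennreal_top_mult)
      then have "inf (F t) (SUP n. of_nat n * e t) = F t" by (simp only: inf_top_right)
      then show ?thesis unfolding f_def inf_SUP by simp
    qed
    then have "epowr (F t) s * ennreal (w t) = (SUP n. epowr (f n t) s * ennreal (w t))" for t
      using s by (simp add: epowr_SUP SUP_mult_right_ennreal)
    then have "wint s v0 v1 F = (\<integral>\<^sup>+ t. (SUP n. epowr (f n t) s * ennreal (w t)) \<partial>lborel)"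
      unfolding wint_w by simp
    also have "\<dots> = (SUP n. wint s v0 v1 (f n))"
      unfolding wint_w
    proof (rule nn_integral_monotone_convergence_SUP)
      show "incseq (\<lambda>n t. epowr (f n t) s * ennreal (w t))"
        unfolding incseq_def le_fun_def f_def using s
        by (intro allI impI mult_right_mono epowr_mono inf_mono) auto
    qed auto
    also have "\<dots> \<le> ennreal N * wint s v0 v1 G" by (intro SUP_least fn)
    finally show ?thesis .
  qed (use \<open>0 < N\<close> in \<open>simp add: ennreal_mult_top\<close>)
  ultimately show "\<exists>N>0. \<forall>v0 v1. A1w C v0 \<longrightarrow> A1w C v1 \<longrightarrow>
     (\<forall>(F, G)\<in>\<P>. wint s v0 v1 F \<le> ennreal N * wint s v0 v1 G)"
    by (intro exI[of _ N]) auto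
qed

subsection \<open>Mixed norms and coordinatewise maximal functions\<close>

text \<open>The same iterated norm for [0,\<infinity>]-valued functions of full sequences.
  Coordinates from k on are parameters, so partial norms stay functions of a point and may be
  multiplied, bounded and updated freely.\<close>

fun mixed :: "(nat \<Rightarrow> real) \<Rightarrow> ((nat \<Rightarrow> real) \<Rightarrow> ennreal) \<Rightarrow> nat \<Rightarrow> (nat \<Rightarrow> real) \<Rightarrow> ennreal" where
  "mixed q h 0 x = h x"
| "mixed q h (Suc k) x = epowr (\<integral>\<^sup>+ t. epowr (mixed q h k (x(k := t))) (q k) \<partial>lborel) (1 / q k)"

abbreviation seqs :: "(nat \<Rightarrow> real) measure" where
  "seqs \<equiv> \<Pi>\<^sub>M i\<in>UNIV. borel"

lemma in_space_seqs [simp]: "x \<in> space seqs"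
  by (simp add: space_PiM)

lemma measurable_seqs_upd [measurable (raw)]:
  assumes f: "f \<in> M \<rightarrow>\<^sub>M seqs" and g: "g \<in> M \<rightarrow>\<^sub>M borel"
  shows "(\<lambda>z. (f z)(k := g z)) \<in> M \<rightarrow>\<^sub>M seqs"
proof (rule measurable_PiM_single')
  fix i :: nat
  show "(\<lambda>z. ((f z)(k := g z)) i) \<in> M \<rightarrow>\<^sub>M borel"
    using g measurable_compose[OF f measurable_component_singleton[of i]]
    by (cases "i = k") auto
qed (auto simp: space_PiM)

lemma measurable_mixed_basic: "h \<in> borel_measurable seqs \<Longrightarrow> mixed q h k \<in> borel_measurable seqs"
proof (induction k)
  case (Suc k)
  then have [measurable]: "mixed q h k \<in> borel_measurable seqs" by simp
  show ?case unfolding mixed.simps by measurable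
next
  case 0
  moreover have "mixed q h 0 = h" by (rule ext) simp
  ultimately show ?case by simp
qed

lemma measurable_mixed [measurable (raw)]:
  "f \<in> M \<rightarrow>\<^sub>M seqs \<Longrightarrow> h \<in> borel_measurable seqs \<Longrightarrow> (\<lambda>z. mixed q h k (f z)) \<in> borel_measurable M"
  using measurable_compose[OF _ measurable_mixed_basic] .

lemma mixed_mono:
  assumes "\<And>x. f x \<le> g x" "\<And>i. i < k \<Longrightarrow> 0 < q i"
  shows "mixed q f k x \<le> mixed q g k x"
  using assms(2)
proof (induction k arbitrary: x)
  case (Suc k)
  then have "0 \<le> q k" "0 \<le> 1 / q k" and le: "\<And>x. mixed q f k x \<le> mixed q g k x"
    by (auto intro: less_imp_le)
  then show ?case unfolding mixed.simps by (intro epowr_mono nn_integral_mono)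
qed (simp add: assms)

lemma mixed_le_cmult_Suc:
  assumes le: "\<And>x. mixed q f k x \<le> c * mixed q g k x" and q: "0 < q k"
    and [measurable]: "g \<in> borel_measurable seqs"
  shows "mixed q f (Suc k) x \<le> c * mixed q g (Suc k) x"
proof -
  have "(\<integral>\<^sup>+ t. epowr (mixed q f k (x(k := t))) (q k) \<partial>lborel)
      \<le> (\<integral>\<^sup>+ t. epowr (c * mixed q g k (x(k := t))) (q k) \<partial>lborel)"
    using q by (intro nn_integral_mono epowr_mono le) auto
  also have "\<dots> = epowr c (q k) * (\<integral>\<^sup>+ t. epowr (mixed q g k (x(k := t))) (q k) \<partial>lborel)"
    unfolding epowr_mult by (intro nn_integral_cmult) measurable
  finally have "mixed q f (Suc k) x \<le> epowr (epowr c (q k) * (\<integral>\<^sup>+ t. epowr (mixed q g k (x(k := t))) (q k) \<partial>lborel)) (1 / q k)"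
    using q by (simp add: epowr_mono)
  then show ?thesis using q by (simp add: epowr_mult epowr_inv)
qed

text \<open>Outer norms are monotone and homogeneous, so an inequality in the first k coordinates
  passes to all n. For the maximal function in coordinate j this leaves only the coordinates up to
  j.\<close>

lemma mixed_le_cmult:
  assumes le: "\<And>x. mixed q f k x \<le> c * mixed q g k x" and q: "\<And>i. i < n \<Longrightarrow> 0 < q i"
    and g: "g \<in> borel_measurable seqs" and kn: "k \<le> n"
  shows "mixed q f n x \<le> c * mixed q g n x"
  using kn q
proof (induction n arbitrary: x rule: dec_induct)
  case (step n)
  then show ?case by (intro mixed_le_cmult_Suc g) auto
qed (rule le)

lemma mixed_cmult_le:
  assumes "\<And>i. i < n \<Longrightarrow> 0 < q i" "g \<in> borel_measurable seqs"
  shows "mixed q (\<lambda>x. c * g x) n x \<le> c * mixed q g n x"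
  by (rule mixed_le_cmult[of _ _ 0]) (use assms in auto)

lemma mixed_zero [simp]: "mixed q (\<lambda>_. 0) k x = 0"
  by (induction k arbitrary: x) auto

section \<open>Maximal functions in one coordinate\<close>

definition coord_max :: "nat \<Rightarrow> ((nat \<Rightarrow> real) \<Rightarrow> ennreal) \<Rightarrow> (nat \<Rightarrow> real) \<Rightarrow> ennreal" where
  "coord_max j h x = maxfun (\<lambda>_. 1) (\<lambda>u. h (x(j := u))) (x j)"

lemma coord_max_upd: "coord_max j h (x(j := t)) = maxfun (\<lambda>_. 1) (\<lambda>u. h (x(j := u))) t"
  by (simp add: coord_max_def)

lemma measurable_coord_max [measurable]:
  assumes [measurable]: "h \<in> borel_measurable seqs"
  shows "coord_max j h \<in> borel_measurable seqs"
proof -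
  have [measurable]: "(\<lambda>x. x j) \<in> borel_measurable seqs"
    by (rule measurable_component_singleton) simp
  show ?thesis
    unfolding coord_max_def maxfun_def
    by (intro borel_measurable_SUP countable_rat_pairs) measurable
qed

text \<open>Why \<open>s\<close> is arbitrary in the induction: with one more coordinate k, Tonelli
  works at exponent \<open>q k\<close>, where it keeps the constant, and the extrapolation theorem
  leads from there to every other exponent. The weights in coordinate j are carried along because
  extrapolation starts from weighted bounds.\<close>

lemma weighted_bounded_coord_max:
  assumes "k \<le> j" "\<And>i. i < k \<Longrightarrow> 1 < q i" "1 < s"
  shows "weighted_bounded s
     {(\<lambda>t. mixed q (coord_max j h) k (x(j := t)), \<lambda>t. mixed q h k (x(j := t))) |h x. h \<in> borel_measurable seqs}"
  using assms
proof (induction k arbitrary: s)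
  case 0
  show ?case unfolding weighted_bounded_def
  proof (intro allI impI)
    fix C :: real assume C: "0 < C"
    obtain K where K: "0 < K" "\<And>v0 v1 h. A1w C v0 \<Longrightarrow> A1w C v1 \<Longrightarrow> h \<in> borel_measurable borel \<Longrightarrow>
       wint s v0 v1 (maxfun (\<lambda>_. 1) h) \<le> ennreal K * wint s v0 v1 h"
      by (rule muckenhoupt[OF \<open>1 < s\<close> C, folded wint_def]) (rule that)
    show "\<exists>N>0. \<forall>v0 v1. A1w C v0 \<longrightarrow> A1w C v1 \<longrightarrow>
     (\<forall>(F, G)\<in>{(\<lambda>t. mixed q (coord_max j h) 0 (x(j := t)), \<lambda>t. mixed q h 0 (x(j := t))) |h x. h \<in> borel_measurable seqs}.
        wint s v0 v1 F \<le> ennreal N * wint s v0 v1 G)"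
    proof (intro exI[of _ K] conjI allI impI ballI, rule K(1), clarify)
      fix v0 v1 x and h :: "(nat \<Rightarrow> real) \<Rightarrow> ennreal" assume v: "A1w C v0" "A1w C v1" and [measurable]: "h \<in> borel_measurable seqs"
      have "x \<in> space seqs" by (simp add: space_PiM)
      then have "(\<lambda>t. h (x(j := t))) \<in> borel_measurable borel" by measurable
      from K(2)[OF v this]
      show "wint s v0 v1 (\<lambda>t. mixed q (coord_max j h) 0 (x(j := t))) \<le> ennreal K * wint s v0 v1 (\<lambda>t. mixed q h 0 (x(j := t)))"
        by (simp add: coord_max_upd)
    qed
  qed
next
  case (Suc k)
  define r where "r = q k"
  have r: "1 < r" using Suc.prems by (simp add: r_def)
  have j: "k < j" using Suc.prems by simp
  let ?P = "\<lambda>k. {(\<lambda>t. mixed q (coord_max j h) k (x(j := t)), \<lambda>t. mixed q h k (x(j := t))) |h x. h \<in> borel_measurable seqs}"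
  have IH: "weighted_bounded r (?P k)" using Suc.prems r by (intro Suc.IH) auto
  have "weighted_bounded r (?P (Suc k))"
    unfolding weighted_bounded_def
  proof (intro allI impI)
    fix C :: real assume C: "0 < C"
    obtain N where N: "0 < N" "\<And>v0 v1 F G. A1w C v0 \<Longrightarrow> A1w C v1 \<Longrightarrow> (F, G) \<in> ?P k \<Longrightarrow>
        wint r v0 v1 F \<le> ennreal N * wint r v0 v1 G"
      by (rule weighted_boundedE[OF IH C]) (rule that)
    show "\<exists>N>0. \<forall>v0 v1. A1w C v0 \<longrightarrow> A1w C v1 \<longrightarrow>
       (\<forall>(F, G)\<in>?P (Suc k). wint r v0 v1 F \<le> ennreal N * wint r v0 v1 G)"
    proof (intro exI[of _ N] conjI allI impI ballI, rule N(1), clarify)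
      fix v0 v1 x and h :: "(nat \<Rightarrow> real) \<Rightarrow> ennreal"
      assume v: "A1w C v0" "A1w C v1" and [measurable]: "h \<in> borel_measurable seqs"
      have [measurable]: "v0 \<in> borel_measurable borel" "v1 \<in> borel_measurable borel"
        using v unfolding A1w_def by auto
      \<comment> \<open>At exponent \<open>r\<close> = \<open>q k\<close> the outer power cancels
        the root in the norm of coordinate k, and the two integrations can be interchanged.\<close>
      have fub: "wint r v0 v1 (\<lambda>t. mixed q f (Suc k) (x(j := t)))
          = (\<integral>\<^sup>+ u. wint r v0 v1 (\<lambda>t. mixed q f k (x(k := u, j := t))) \<partial>lborel)"
        if [measurable]: "f \<in> borel_measurable seqs" for f
      proof -
        have x: "x \<in> space seqs" by (simp add: space_PiM)
        define w where "w t = ennreal (v0 t * v1 t powr (1 - r))" for t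
        have [measurable]: "w \<in> borel_measurable borel" unfolding w_def by measurable
        have "wint r v0 v1 (\<lambda>t. mixed q f (Suc k) (x(j := t)))
           = (\<integral>\<^sup>+ t. (\<integral>\<^sup>+ u. epowr (mixed q f k (x(j := t, k := u))) r \<partial>lborel) * w t \<partial>lborel)"
          using r unfolding wint_def w_def mixed.simps r_def[symmetric] by (simp add: epowr_inv')
        also have "\<dots> = (\<integral>\<^sup>+ t. \<integral>\<^sup>+ u. epowr (mixed q f k (x(k := u, j := t))) r * w t \<partial>lborel \<partial>lborel)"
          using j x by (intro nn_integral_cong) (simp add: fun_upd_twist nn_integral_multc)
        also have "\<dots> = (\<integral>\<^sup>+ u. \<integral>\<^sup>+ t. epowr (mixed q f k (x(k := u, j := t))) r * w t \<partial>lborel \<partial>lborel)"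
          by (rule lborel_pair.Fubini'[symmetric]) (use x in measurable)
        finally show ?thesis unfolding wint_def w_def .
      qed
      have "wint r v0 v1 (\<lambda>t. mixed q (coord_max j h) (Suc k) (x(j := t)))
          \<le> (\<integral>\<^sup>+ u. ennreal N * wint r v0 v1 (\<lambda>t. mixed q h k (x(k := u, j := t))) \<partial>lborel)"
        unfolding fub[OF measurable_coord_max[OF \<open>h \<in> borel_measurable seqs\<close>]]
        by (intro nn_integral_mono N(2)[OF v]) auto
      also have "\<dots> = ennreal N * wint r v0 v1 (\<lambda>t. mixed q h (Suc k) (x(j := t)))"
        unfolding fub[OF \<open>h \<in> borel_measurable seqs\<close>]
      proof (rule nn_integral_cmult)
        have x: "x \<in> space seqs" by (simp add: space_PiM)
        show "(\<lambda>u. wint r v0 v1 (\<lambda>t. mixed q h k (x(k := u, j := t)))) \<in> borel_measurable lborel"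
          unfolding wint_def using x by measurable
      qed
      finally show "wint r v0 v1 (\<lambda>t. mixed q (coord_max j h) (Suc k) (x(j := t)))
          \<le> ennreal N * wint r v0 v1 (\<lambda>t. mixed q h (Suc k) (x(j := t)))" .
    qed
  qed
  then show ?case
  proof (rule extrapolation[OF r \<open>1 < s\<close>])
    fix F G assume "(F, G) \<in> ?P (Suc k)"
    then obtain h x where FG: "F = (\<lambda>t. mixed q (coord_max j h) (Suc k) (x(j := t)))"
        "G = (\<lambda>t. mixed q h (Suc k) (x(j := t)))" and [measurable]: "h \<in> borel_measurable seqs"
      by auto
    have "x \<in> space seqs" by (simp add: space_PiM)
    then show "F \<in> borel_measurable borel \<and> G \<in> borel_measurable borel"
      unfolding FG by (intro conjI) measurable
  qed
qed

text \<open>With both factors of the weight equal to 1 and the exponent \<open>q j\<close>, the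
  weighted integral in coordinate j is the next step of the mixed norm itself.\<close>

lemma mixed_coord_max_le:
  assumes j: "j < n" and q: "\<And>i. i < n \<Longrightarrow> 1 < q i"
  obtains K :: real where "0 < K"
    "\<And>h x. h \<in> borel_measurable seqs \<Longrightarrow> mixed q (coord_max j h) n x \<le> ennreal K * mixed q h n x"
proof -
  define s where "s = q j"
  have s: "1 < s" using q j by (simp add: s_def)
  have "weighted_bounded s
     {(\<lambda>t. mixed q (coord_max j h) j (x(j := t)), \<lambda>t. mixed q h j (x(j := t))) |h x. h \<in> borel_measurable seqs}"
    using q j s by (intro weighted_bounded_coord_max) auto
  note bd = this
  obtain N where N: "0 < N"
    "\<And>v0 v1 F G. A1w 1 v0 \<Longrightarrow> A1w 1 v1 \<Longrightarrow>
       (F, G) \<in> {(\<lambda>t. mixed q (coord_max j h) j (x(j := t)), \<lambda>t. mixed q h j (x(j := t))) |h x. h \<in> borel_measurable seqs} \<Longrightarrow>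
        wint s v0 v1 F \<le> ennreal N * wint s v0 v1 G"
    by (rule weighted_boundedE[OF bd zero_less_one]) (rule that)
  define K where "K = N powr (1 / s)"
  have K: "0 < K" using N by (simp add: K_def)
  have "mixed q (coord_max j h) n x \<le> ennreal K * mixed q h n x"
    if h: "h \<in> borel_measurable seqs" for h x
  proof (rule mixed_le_cmult[where k="Suc j"])
    fix x
    have "wint s (\<lambda>_. 1) (\<lambda>_. 1) (\<lambda>t. mixed q (coord_max j h) j (x(j := t)))
        \<le> ennreal N * wint s (\<lambda>_. 1) (\<lambda>_. 1) (\<lambda>t. mixed q h j (x(j := t)))"
      using h by (intro N(2) A1w_const) auto
    then have "mixed q (coord_max j h) (Suc j) x
        \<le> epowr (ennreal N * wint s (\<lambda>_. 1) (\<lambda>_. 1) (\<lambda>t. mixed q h j (x(j := t)))) (1 / s)"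
      using s by (simp add: wint_def s_def[symmetric] epowr_mono)
    also have "\<dots> = ennreal K * mixed q h (Suc j) x"
      using s N(1) by (simp add: wint_def s_def[symmetric] epowr_mult epowr_ennreal K_def)
    finally show "mixed q (coord_max j h) (Suc j) x \<le> ennreal K * mixed q h (Suc j) x" .
  next
    show "0 < q i" if "i < n" for i using q[OF that] by simp
  qed (use h j in auto)
  with K show ?thesis by (intro that[of K])
qed

text \<open>The factor \<open>2 ^ (k * (i + 1))\<close> replaces the triangle inequality: every norm in the
  iteration is only used through \<open>(SUP i. u i) powr r \<le> (\<Sum>i. u i powr r)\<close>.\<close>

lemma mixed_SUP_le:
  fixes u :: "nat \<Rightarrow> (nat \<Rightarrow> real) \<Rightarrow> ennreal"
  assumes q: "\<And>i. i < k \<Longrightarrow> 1 \<le> q i" and u: "\<And>i. u i \<in> borel_measurable seqs"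
  shows "mixed q (\<lambda>x. SUP i. u i x) k x \<le> (SUP i. 2 ^ (k * (i + 1)) * mixed q (u i) k x)"
  using q
proof (induction k arbitrary: x)
  case (Suc k)
  note [measurable] = u
  define r where "r = q k"
  have r: "1 \<le> r" using Suc.prems by (simp add: r_def)
  have x: "x \<in> space seqs" by (simp add: space_PiM)
  let ?A = "\<lambda>i. \<integral>\<^sup>+ t. epowr (mixed q (u i) k (x(k := t))) r \<partial>lborel"
  have "(\<integral>\<^sup>+ t. epowr (mixed q (\<lambda>x. SUP i. u i x) k (x(k := t))) r \<partial>lborel)
     \<le> (\<integral>\<^sup>+ t. (\<Sum>i. epowr (2 ^ (k * (i + 1))) r * epowr (mixed q (u i) k (x(k := t))) r) \<partial>lborel)"
  proof (rule nn_integral_mono)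
    fix t
    have "epowr (mixed q (\<lambda>x. SUP i. u i x) k (x(k := t))) r
        \<le> epowr (SUP i. 2 ^ (k * (i + 1)) * mixed q (u i) k (x(k := t))) r"
      using r Suc by (intro epowr_mono Suc.IH) auto
    also have "\<dots> = (SUP i. epowr (2 ^ (k * (i + 1))) r * epowr (mixed q (u i) k (x(k := t))) r)"
      using r by (simp add: epowr_SUP epowr_mult)
    also have "\<dots> \<le> (\<Sum>i. epowr (2 ^ (k * (i + 1))) r * epowr (mixed q (u i) k (x(k := t))) r)"
      by (intro SUP_least le_suminf_ennreal)
    finally show "epowr (mixed q (\<lambda>x. SUP i. u i x) k (x(k := t))) r
        \<le> (\<Sum>i. epowr (2 ^ (k * (i + 1))) r * epowr (mixed q (u i) k (x(k := t))) r)" .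
  qed
  also have "\<dots> = (\<Sum>i. epowr (2 ^ (k * (i + 1))) r * ?A i)"
    using x by (simp add: nn_integral_suminf nn_integral_cmult)
  also have "\<dots> \<le> (SUP i. 2 ^ (i + 1) * (epowr (2 ^ (k * (i + 1))) r * ?A i))"
    by (rule suminf_le_SUP_ennreal)
  finally have "mixed q (\<lambda>x. SUP i. u i x) (Suc k) x
      \<le> epowr (SUP i. 2 ^ (i + 1) * (epowr (2 ^ (k * (i + 1))) r * ?A i)) (1 / r)"
    using r by (simp add: r_def[symmetric] epowr_mono)
  also have "\<dots> = (SUP i. epowr (2 ^ (i + 1)) (1 / r) * (2 ^ (k * (i + 1)) * epowr (?A i) (1 / r)))"
    using r by (simp add: epowr_SUP epowr_mult epowr_inv)
  also have "\<dots> \<le> (SUP i. 2 ^ (Suc k * (i + 1)) * mixed q (u i) (Suc k) x)"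
  proof (rule SUP_mono')
    fix i :: nat
    have "epowr (2 ^ (i + 1)) (1 / r) \<le> (2 ^ (i + 1) :: ennreal)"
    proof -
      have e: "(2 ^ (i + 1) :: ennreal) = ennreal (2 ^ (i + 1))"
        using ennreal_power[of 2 "i + 1"] by simp
      have "(1::real) \<le> 2 ^ (i + 1)" by (rule one_le_power) simp
      then have "(2 ^ (i + 1) :: real) powr (1 / r) \<le> 2 ^ (i + 1)"
        using r powr_mono[of "1 / r" 1 "2 ^ (i + 1) :: real"] by (simp add: field_simps)
      then show ?thesis unfolding e by (subst epowr_ennreal) (auto intro: ennreal_leI)
    qed
    then have "epowr (2 ^ (i + 1)) (1 / r) * (2 ^ (k * (i + 1)) * epowr (?A i) (1 / r))
       \<le> 2 ^ (i + 1) * (2 ^ (k * (i + 1)) * epowr (?A i) (1 / r))"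
      by (rule mult_right_mono) simp
    also have "\<dots> = 2 ^ (Suc k * (i + 1)) * mixed q (u i) (Suc k) x"
      by (simp add: r_def power_add mult_ac)
    finally show "epowr (2 ^ (i + 1)) (1 / r) * (2 ^ (k * (i + 1)) * epowr (?A i) (1 / r))
       \<le> 2 ^ (Suc k * (i + 1)) * mixed q (u i) (Suc k) x" .
  qed
  finally show ?case .
qed simp

lemma mixed_SUP_coord_max_le:
  assumes q: "\<And>i. i < n \<Longrightarrow> 1 < q i"
  obtains K :: real where "0 < K"
    "\<And>h x. h \<in> borel_measurable seqs \<Longrightarrow>
       mixed q (\<lambda>x. SUP j\<in>{..<n}. coord_max j h x) n x \<le> ennreal K * mixed q h n x"
proof -
  have "\<forall>j\<in>{..<n}. \<exists>K. 0 < K \<and>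
     (\<forall>h x. h \<in> borel_measurable seqs \<longrightarrow> mixed q (coord_max j h) n x \<le> ennreal K * mixed q h n x)"
  proof
    fix j assume "j \<in> {..<n}"
    then have j: "j < n" by simp
    obtain K where K: "0 < K" "\<And>h x. h \<in> borel_measurable seqs \<Longrightarrow> mixed q (coord_max j h) n x \<le> ennreal K * mixed q h n x"
      by (rule mixed_coord_max_le[where q=q and n=n, OF j q]) (assumption, rule that)
    then show "\<exists>K. 0 < K \<and>
     (\<forall>h x. h \<in> borel_measurable seqs \<longrightarrow> mixed q (coord_max j h) n x \<le> ennreal K * mixed q h n x)"
      by (intro exI[of _ K]) simp
  qed
  from bchoice[OF this] obtain k where k: "\<And>j. j < n \<Longrightarrow> 0 < k j"
    "\<And>j h x. j < n \<Longrightarrow> h \<in> borel_measurable seqs \<Longrightarrow> mixed q (coord_max j h) n x \<le> ennreal (k j) * mixed q h n x"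
    by auto
  \<comment> \<open>2^(n (n+1)) bounds the losses 2^(n (i+1)) for i < n; the added 1 keeps
    \<open>K\<close> positive for n = 0.\<close>
  define K where "K = 2 ^ (n * (n + 1)) * (1 + (\<Sum>j<n. k j))"
  have nn: "0 \<le> (\<Sum>j<n. k j)" using k(1) by (intro sum_nonneg) (auto intro: less_imp_le)
  have "0 < K" using nn by (simp add: K_def)
  moreover have "mixed q (\<lambda>x. SUP j\<in>{..<n}. coord_max j h x) n x \<le> ennreal K * mixed q h n x"
    if h [measurable]: "h \<in> borel_measurable seqs" for h x
  proof -
    \<comment> \<open>The finite supremum is padded with zeros to a sequence, the form required by
      \<open>mixed_SUP_le\<close>.\<close>
    define u where "u i = (if i < n then coord_max i h else (\<lambda>_. 0))" for i
    have u: "u i \<in> borel_measurable seqs" for i unfolding u_def by (cases "i < n") auto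
    have "mixed q (\<lambda>x. SUP j\<in>{..<n}. coord_max j h x) n x \<le> mixed q (\<lambda>x. SUP i. u i x) n x"
    proof (rule mixed_mono)
      fix x
      show "(SUP j\<in>{..<n}. coord_max j h x) \<le> (SUP i. u i x)"
      proof (rule SUP_least)
        fix j assume "j \<in> {..<n}"
        then have "coord_max j h x = u j x" by (simp add: u_def)
        then show "coord_max j h x \<le> (SUP i. u i x)" by (simp only:) (rule SUP_upper, simp)
      qed
    qed (use q in \<open>auto intro: less_trans[OF zero_less_one]\<close>)
    also have "\<dots> \<le> (SUP i. 2 ^ (n * (i + 1)) * mixed q (u i) n x)"
      using q by (intro mixed_SUP_le u) (auto intro: less_imp_le)
    also have "\<dots> \<le> ennreal K * mixed q h n x"
    proof (rule SUP_least)
      fix i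
      show "2 ^ (n * (i + 1)) * mixed q (u i) n x \<le> ennreal K * mixed q h n x"
      proof (cases "i < n")
        case True
        have e: "(2 ^ (n * (i + 1)) :: ennreal) = ennreal (2 ^ (n * (i + 1)))"
          using ennreal_power[of 2 "n * (i + 1)"] by simp
        have "2 ^ (n * (i + 1)) * mixed q (u i) n x \<le> ennreal (2 ^ (n * (i + 1))) * (ennreal (k i) * mixed q h n x)"
          unfolding e using True k(2)[OF True h] by (intro mult_left_mono) (auto simp: u_def)
        also have "\<dots> = ennreal (2 ^ (n * (i + 1)) * k i) * mixed q h n x"
          using k(1)[OF True] by (simp add: ennreal_mult mult.assoc)
        also have "\<dots> \<le> ennreal K * mixed q h n x"
        proof (intro mult_right_mono ennreal_leI)
          have "k i \<le> (\<Sum>j<n. k j)" using True k(1) by (intro member_le_sum) (auto intro: less_imp_le)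
          moreover have "(2::real) ^ (n * (i + 1)) \<le> 2 ^ (n * (n + 1))"
            using True by (intro power_increasing) auto
          ultimately show "2 ^ (n * (i + 1)) * k i \<le> K"
            unfolding K_def using k(1)[OF True] nn by (intro mult_mono) auto
        qed simp
        finally show ?thesis .
      qed (simp add: u_def)
    qed
    finally show ?thesis .
  qed
  note main = this
  show ?thesis by (rule that[OF \<open>0 < K\<close>]) (rule main)
qed

text \<open>The supremum of all coordinate maximal functions is iterated, so that a single
  \<open>W\<close> satisfies the condition in every direction, at every point. \<open>D\<close> is
  fixed before \<open>h\<close>.\<close>

lemma mixed_majorant:
  assumes q: "\<And>i. i < n \<Longrightarrow> 1 < q i"
  obtains D :: real where "0 < D"
    "\<And>h x. h \<in> borel_measurable seqs \<Longrightarrow> mixed q h n x < top \<Longrightarrow>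
      \<exists>W\<in>borel_measurable seqs. (\<forall>y. h y \<le> W y) \<and>
        (\<forall>j<n. \<forall>y. coord_max j W y \<le> ennreal D * W y) \<and> mixed q W n x < top"
proof -
  define S where "S h x = (SUP j\<in>{..<n}. coord_max j h x)" for h x
  obtain K where K0: "0 < K" "\<And>h x. h \<in> borel_measurable seqs \<Longrightarrow>
      mixed q (\<lambda>x. SUP j\<in>{..<n}. coord_max j h x) n x \<le> ennreal K * mixed q h n x"
    by (rule mixed_SUP_coord_max_le[where q=q and n=n, OF q]) (assumption, rule that)
  note K = K0[folded S_def]
  have qpos: "0 < q i" if "i < n" for i using q[OF that] by simp
  \<comment> \<open>In the k-th term 2^(k+1) comes from trading the sum for a supremum, 2^(n (k+1))
    from \<open>mixed_SUP_le\<close> and K^k from the operator; with this \<open>a\<close> the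
    product with a^k is 2^(n+1) for every k, which is enough under a supremum.\<close>
  define a where "a = 1 / (2 ^ (n + 1) * K)"
  have a: "0 < a" using K by (simp add: a_def)
  have "\<exists>W\<in>borel_measurable seqs. (\<forall>y. h y \<le> W y) \<and>
        (\<forall>j<n. \<forall>y. coord_max j W y \<le> ennreal (1 / a) * W y) \<and> mixed q W n x < top"
    if h [measurable]: "h \<in> borel_measurable seqs" and fin: "mixed q h n x < top" for h x
  proof -
    have Sm: "S f \<in> borel_measurable seqs" if [measurable]: "f \<in> borel_measurable seqs" for f
      unfolding S_def by (intro borel_measurable_SUP) auto
    have sub: "S (\<lambda>x. \<Sum>k. ennreal (a ^ k) * f k x) x \<le> (\<Sum>k. ennreal (a ^ k) * S (f k) x)"
      if f: "\<And>k. f k \<in> borel_measurable seqs" for f x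
      unfolding S_def[of "\<lambda>x. \<Sum>k. ennreal (a ^ k) * f k x"]
    proof (rule SUP_least)
      fix j assume j: "j \<in> {..<n}"
      note [measurable] = f
      have "coord_max j (\<lambda>x. \<Sum>k. ennreal (a ^ k) * f k x) x \<le> (\<Sum>k. ennreal (a ^ k) * coord_max j (f k) x)"
        unfolding coord_max_def by (rule maxfun_1_weighted_suminf) measurable
      also have "\<dots> \<le> (\<Sum>k. ennreal (a ^ k) * S (f k) x)"
        using j by (intro suminf_le mult_left_mono) (auto simp: S_def intro: SUP_upper)
      finally show "coord_max j (\<lambda>x. \<Sum>k. ennreal (a ^ k) * f k x) x \<le> (\<Sum>k. ennreal (a ^ k) * S (f k) x)" .
    qed
    define f where "f k = (S ^^ k) h" for k
    have fm [measurable]: "f k \<in> borel_measurable seqs" for k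
      unfolding f_def by (induction k) (auto intro: Sm)
    define W where "W x = (\<Sum>k. ennreal (a ^ k) * f k x)" for x
    have Wm: "W \<in> borel_measurable seqs" unfolding W_def by measurable
    have hW: "h y \<le> W y" for y
      unfolding W_def f_def by (rule rubio_de_francia_iteration(1)[where S="borel_measurable seqs", OF h Sm a sub])
    have SW: "S W y \<le> ennreal (1 / a) * W y" for y
      unfolding W_def f_def by (rule rubio_de_francia_iteration(2)[where S="borel_measurable seqs", OF h Sm a sub])
    have fk: "mixed q (f k) n x \<le> ennreal (K ^ k) * mixed q h n x" for k
    proof (induction k)
      case (Suc k)
      have "mixed q (f (Suc k)) n x \<le> ennreal K * mixed q (f k) n x"
        using K(2)[OF fm[of k]] by (simp add: f_def)
      also have "\<dots> \<le> ennreal K * (ennreal (K ^ k) * mixed q h n x)"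
        by (intro mult_left_mono Suc) auto
      finally show ?case using K by (simp add: ennreal_mult mult.assoc)
    qed (simp add: f_def)
    have "mixed q W n x \<le> mixed q (\<lambda>x. SUP k. 2 ^ (k + 1) * (ennreal (a ^ k) * f k x)) n x"
      unfolding W_def by (intro mixed_mono suminf_le_SUP_ennreal qpos)
    also have "\<dots> \<le> (SUP k. 2 ^ (n * (k + 1)) * mixed q (\<lambda>x. 2 ^ (k + 1) * (ennreal (a ^ k) * f k x)) n x)"
      using q by (intro mixed_SUP_le) (auto intro: less_imp_le)
    also have "\<dots> \<le> ennreal (2 ^ (n + 1)) * mixed q h n x"
    proof (rule SUP_least)
      fix k :: nat
      have e: "(2 ^ m :: ennreal) = ennreal (2 ^ m)" for m
        using ennreal_power[of 2 m] by simp
      have "mixed q (\<lambda>x. 2 ^ (k + 1) * (ennreal (a ^ k) * f k x)) n x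
          \<le> 2 ^ (k + 1) * ennreal (a ^ k) * mixed q (f k) n x"
        unfolding mult.assoc[symmetric] by (intro mixed_cmult_le qpos fm)
      also have "\<dots> \<le> 2 ^ (k + 1) * ennreal (a ^ k) * (ennreal (K ^ k) * mixed q h n x)"
        by (intro mult_left_mono fk) auto
      finally have "2 ^ (n * (k + 1)) * mixed q (\<lambda>x. 2 ^ (k + 1) * (ennreal (a ^ k) * f k x)) n x
        \<le> 2 ^ (n * (k + 1)) * (2 ^ (k + 1) * ennreal (a ^ k) * (ennreal (K ^ k) * mixed q h n x))"
        by (rule mult_left_mono) simp
      also have "\<dots> = ennreal (2 ^ (n * (k + 1)) * (2 ^ (k + 1) * a ^ k * K ^ k)) * mixed q h n x"
        unfolding e using a K(1) by (simp only: ennreal_mult mult.assoc zero_le_power zero_le_numeral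
            less_imp_le mult_nonneg_nonneg)
      also have "2 ^ (n * (k + 1)) * (2 ^ (k + 1) * a ^ k * K ^ k) = (2 ^ (n + 1) :: real)"
      proof -
        have "2 ^ (n * (k + 1)) * (2 ^ (k + 1) * a ^ k * K ^ k) = 2 ^ (n + 1) * (2 ^ (n + 1) * a * K) ^ k"
          by (simp add: power_mult_distrib power_mult[symmetric] power_add mult_ac)
        also have "2 ^ (n + 1) * a * K = 1" using K(1) by (simp add: a_def)
        finally show ?thesis by simp
      qed
      finally show "2 ^ (n * (k + 1)) * mixed q (\<lambda>x. 2 ^ (k + 1) * (ennreal (a ^ k) * f k x)) n x
        \<le> ennreal (2 ^ (n + 1)) * mixed q h n x" .
    qed
    also have "\<dots> < top" using fin by (simp add: ennreal_mult_less_top)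
    finally have Wfin: "mixed q W n x < top" .
    have "coord_max j W y \<le> ennreal (1 / a) * W y" if "j < n" for j y
    proof -
      have "coord_max j W y \<le> S W y" unfolding S_def using that by (intro SUP_upper) auto
      then show ?thesis using SW by (rule order_trans)
    qed
    then show ?thesis using Wm hW Wfin by (intro bexI[of _ W]) auto
  qed
  note main = this
  have "0 < 1 / a" using a by simp
  then show ?thesis by (rule that) (rule main)
qed

subsection \<open>Duality for mixed norms\<close>

lemma young_ennreal:
  assumes "1 < r"
  shows "x * y \<le> epowr x r + epowr y (r / (r - 1))"
proof (cases "y \<le> epowr x (r - 1)")
  case True
  then have "x * y \<le> x * epowr x (r - 1)" by (rule mult_left_mono) simp
  also have "\<dots> = epowr x r" using epowr_add[of x 1 "r - 1"] by simp
  finally show ?thesis by (simp add: add_increasing2)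
next
  case False
  then have "x \<le> epowr y (1 / (r - 1))" using assms by (simp flip: epowr_le_iff)
  then have "x * y \<le> epowr y (1 / (r - 1)) * y" by (rule mult_right_mono) simp
  also have "\<dots> = epowr y (1 / (r - 1) + 1)" using epowr_add[of y "1 / (r - 1)" 1] by simp
  also have "1 / (r - 1) + 1 = r / (r - 1)" using assms by (simp add: field_simps)
  finally show ?thesis by (simp add: add_increasing)
qed

text \<open>After normalising both norms to 1, Young's inequality without the factors 1/r and 1/r'
  gives the sum 1 + 1; the resulting factor 2 is harmless here.\<close>

lemma nn_integral_holder_2:
  assumes r: "1 < r" and [measurable]: "F \<in> borel_measurable M" "G \<in> borel_measurable M"
  shows "(\<integral>\<^sup>+ t. F t * G t \<partial>M) \<le> 2 * (epowr (\<integral>\<^sup>+ t. epowr (F t) r \<partial>M) (1 / r) *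
            epowr (\<integral>\<^sup>+ t. epowr (G t) (r / (r - 1)) \<partial>M) (1 / (r / (r - 1))))"
proof -
  define r' where "r' = r / (r - 1)"
  have r': "0 < r'" using r by (simp add: r'_def)
  define A where "A = (\<integral>\<^sup>+ t. epowr (F t) r \<partial>M)"
  define B where "B = (\<integral>\<^sup>+ t. epowr (G t) r' \<partial>M)"
  show ?thesis unfolding r'_def[symmetric] A_def[symmetric] B_def[symmetric]
  proof (cases "A = 0 \<or> B = 0")
    case True
    then have "AE t in M. F t * G t = 0"
    proof
      assume "A = 0"
      then have "AE t in M. epowr (F t) r = 0" unfolding A_def by (subst (asm) nn_integral_0_iff_AE) auto
      then show ?thesis by eventually_elim simp
    next
      assume "B = 0"
      then have "AE t in M. epowr (G t) r' = 0" unfolding B_def by (subst (asm) nn_integral_0_iff_AE) auto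
      then show ?thesis by eventually_elim simp
    qed
    then have "(\<integral>\<^sup>+ t. F t * G t \<partial>M) = 0" by (subst nn_integral_0_iff_AE) auto
    then show "(\<integral>\<^sup>+ t. F t * G t \<partial>M) \<le> 2 * (epowr A (1 / r) * epowr B (1 / r'))" by simp
  next
    case False
    show "(\<integral>\<^sup>+ t. F t * G t \<partial>M) \<le> 2 * (epowr A (1 / r) * epowr B (1 / r'))"
    proof (cases "A = top \<or> B = top")
      case True
      with False show ?thesis by (auto simp: ennreal_mult_top ennreal_top_mult)
    next
      case fin: False
      have pos: "\<exists>c>0. x = ennreal c" if "x \<noteq> 0" "x \<noteq> top" for x
        using that by (cases x) (auto simp: less_le)
      have nz: "epowr A (1 / r) \<noteq> 0" "epowr A (1 / r) \<noteq> top" "epowr B (1 / r') \<noteq> 0" "epowr B (1 / r') \<noteq> top"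
        using False fin by simp_all
      obtain \<alpha> where \<alpha>: "epowr A (1 / r) = ennreal \<alpha>" "0 < \<alpha>"
        using pos[OF nz(1,2)] by auto
      obtain \<beta> where \<beta>: "epowr B (1 / r') = ennreal \<beta>" "0 < \<beta>"
        using pos[OF nz(3,4)] by auto
      have A: "A = ennreal (\<alpha> powr r)" using \<alpha> r epowr_inv'[of r A] by (simp add: epowr_ennreal)
      have B: "B = ennreal (\<beta> powr r')" using \<beta> r' epowr_inv'[of r' B] by (simp add: epowr_ennreal)
      have c: "ennreal \<alpha> * ennreal (1 / \<alpha>) = 1" "ennreal \<beta> * ennreal (1 / \<beta>) = 1"
        using \<alpha> \<beta> by (simp_all flip: ennreal_mult)
      have "(\<integral>\<^sup>+ t. F t * G t \<partial>M) \<le> (\<integral>\<^sup>+ t. ennreal \<alpha> * ennreal \<beta> *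
          (ennreal ((1 / \<alpha>) powr r) * epowr (F t) r + ennreal ((1 / \<beta>) powr r') * epowr (G t) r') \<partial>M)"
      proof (rule nn_integral_mono)
        fix t
        have "F t * G t = (ennreal \<alpha> * ennreal (1 / \<alpha>)) * (ennreal \<beta> * ennreal (1 / \<beta>)) * (F t * G t)"
          unfolding c by simp
        also have "\<dots> = ennreal \<alpha> * ennreal \<beta> * ((ennreal (1 / \<alpha>) * F t) * (ennreal (1 / \<beta>) * G t))"
          by (simp only: mult_ac)
        also have "\<dots> \<le> ennreal \<alpha> * ennreal \<beta> * (epowr (ennreal (1 / \<alpha>) * F t) r + epowr (ennreal (1 / \<beta>) * G t) r')"
          unfolding r'_def by (intro mult_left_mono young_ennreal r) simp
        also have "\<dots> = ennreal \<alpha> * ennreal \<beta> *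
          (ennreal ((1 / \<alpha>) powr r) * epowr (F t) r + ennreal ((1 / \<beta>) powr r') * epowr (G t) r')"
          using \<alpha> \<beta> by (simp only: epowr_mult epowr_ennreal zero_le_divide_1_iff less_imp_le)
        finally show "F t * G t \<le> ennreal \<alpha> * ennreal \<beta> *
          (ennreal ((1 / \<alpha>) powr r) * epowr (F t) r + ennreal ((1 / \<beta>) powr r') * epowr (G t) r')" .
      qed
      also have "\<dots> = ennreal \<alpha> * ennreal \<beta> * (ennreal ((1 / \<alpha>) powr r) * A + ennreal ((1 / \<beta>) powr r') * B)"
        unfolding A_def B_def by (simp add: nn_integral_cmult nn_integral_add)
      also have "ennreal ((1 / \<alpha>) powr r) * A = 1" unfolding A using \<alpha> by (simp add: powr_divide flip: ennreal_mult)
      also have "ennreal ((1 / \<beta>) powr r') * B = 1" unfolding B using \<beta> by (simp add: powr_divide flip: ennreal_mult)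
      also have "(1 + 1 :: ennreal) = 2" by simp
      finally show ?thesis unfolding \<alpha>(1) \<beta>(1) by (simp only: mult.commute[of 2])
    qed
  qed
qed

lemma mixed_holder:
  assumes r: "\<And>i. i < k \<Longrightarrow> 1 < r i" and F: "F \<in> borel_measurable seqs" and G: "G \<in> borel_measurable seqs"
  shows "mixed (\<lambda>_. 1) (\<lambda>x. F x * G x) k x
     \<le> 2 ^ k * (mixed r F k x * mixed (\<lambda>i. r i / (r i - 1)) G k x)"
  using r
proof (induction k arbitrary: x)
  case (Suc k)
  note [measurable] = F G
  let ?r' = "\<lambda>i. r i / (r i - 1)"
  have "mixed (\<lambda>_. 1) (\<lambda>x. F x * G x) (Suc k) x
     \<le> (\<integral>\<^sup>+ t. 2 ^ k * (mixed r F k (x(k := t)) * mixed ?r' G k (x(k := t))) \<partial>lborel)"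
    using Suc by (simp add: nn_integral_mono)
  also have "\<dots> = 2 ^ k * (\<integral>\<^sup>+ t. mixed r F k (x(k := t)) * mixed ?r' G k (x(k := t)) \<partial>lborel)"
    by (intro nn_integral_cmult) simp
  also have "\<dots> \<le> 2 ^ k * (2 * (mixed r F (Suc k) x * mixed ?r' G (Suc k) x))"
    unfolding mixed.simps using Suc.prems by (intro mult_left_mono nn_integral_holder_2) auto
  finally show ?case by (simp only: power_Suc mult_ac)
qed simp

lemma mixed_upd_below: "i < k \<Longrightarrow> mixed q h k (x(i := t)) = mixed q h k x"
proof (induction k arbitrary: x)
  case (Suc k)
  show ?case
  proof (cases "i = k")
    case False
    then have "i < k" using Suc.prems by simp
    have "x(i := t, k := u) = x(k := u, i := t)" for u using False by (rule fun_upd_twist)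
    then show ?thesis by (simp only: mixed.simps Suc.IH[OF \<open>i < k\<close>])
  qed (simp only: mixed.simps fun_upd_upd)
qed simp

lemma mixed_mult_above:
  assumes "\<And>y i t. i < k \<Longrightarrow> \<rho> (y(i := t)) = \<rho> y" "\<And>i. i < k \<Longrightarrow> 0 < q i"
    and [measurable]: "g \<in> borel_measurable seqs"
  shows "mixed q (\<lambda>x. \<rho> x * g x) k y = \<rho> y * mixed q g k y"
  using assms(1,2)
proof (induction k arbitrary: y)
  case (Suc k)
  have q: "0 < q k" using Suc.prems by simp
  have "mixed q (\<lambda>x. \<rho> x * g x) (Suc k) y
      = epowr (\<integral>\<^sup>+ t. epowr (\<rho> y) (q k) * epowr (mixed q g k (y(k := t))) (q k) \<partial>lborel) (1 / q k)"
  proof -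
    have "mixed q (\<lambda>x. \<rho> x * g x) k (y(k := t)) = \<rho> (y(k := t)) * mixed q g k (y(k := t))" for t
      by (intro Suc.IH Suc.prems) auto
    then show ?thesis by (simp only: mixed.simps Suc.prems(1)[OF lessI] epowr_mult)
  qed
  also have "\<dots> = epowr (epowr (\<rho> y) (q k) * (\<integral>\<^sup>+ t. epowr (mixed q g k (y(k := t))) (q k) \<partial>lborel)) (1 / q k)"
    by (subst nn_integral_cmult) simp_all
  finally show ?case using q by (simp add: epowr_mult epowr_inv)
qed simp

lemma mixed_epowr:
  assumes c: "0 < c" and q: "\<And>i. i < k \<Longrightarrow> 0 < q i"
  shows "mixed q (\<lambda>x. epowr (h x) c) k x = epowr (mixed (\<lambda>i. c * q i) h k x) c"
  using q
proof (induction k arbitrary: x)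
  case (Suc k)
  then show ?case using c by (simp add: epowr_epowr)
qed simp

text \<open>The extremal function of mixed-norm duality. With N_i the norm in the first i
  coordinates it is the product over i < k of (N_i / N_(i+1))^(r_i - 1); for one coordinate this is
  the familiar (F / norm of F)^(r-1).\<close>

fun dual_fun :: "(nat \<Rightarrow> real) \<Rightarrow> ((nat \<Rightarrow> real) \<Rightarrow> ennreal) \<Rightarrow> nat \<Rightarrow> (nat \<Rightarrow> real) \<Rightarrow> ennreal" where
  "dual_fun r F 0 x = 1"
| "dual_fun r F (Suc k) x =
     epowr (mixed r F k x / mixed r F (Suc k) x) (r k - 1) * dual_fun r F k x"

lemma measurable_dual_fun [measurable]:
  assumes [measurable]: "F \<in> borel_measurable seqs"
  shows "dual_fun r F k \<in> borel_measurable seqs"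
proof (induction k)
  case (Suc k)
  note [measurable] = Suc measurable_mixed_basic[OF assms]
  have "dual_fun r F (Suc k) = (\<lambda>x. epowr (mixed r F k x / mixed r F (Suc k) x) (r k - 1) * dual_fun r F k x)"
    by (rule ext) (rule dual_fun.simps)
  then show ?case by (simp only:) measurable
next
  case 0
  have "dual_fun r F 0 = (\<lambda>_. 1)" by (rule ext) simp
  then show ?case by simp
qed

lemma mixed_dual_fun_step:
  assumes "\<And>i. i \<le> k \<Longrightarrow> 0 < q i" and [measurable]: "F \<in> borel_measurable seqs" "g \<in> borel_measurable seqs"
  shows "mixed q (\<lambda>x. epowr (mixed r F k x / mixed r F (Suc k) x) e * g x) k (x(k := t))
     = epowr (mixed r F k (x(k := t)) / mixed r F (Suc k) x) e * mixed q g k (x(k := t))"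
proof -
  have "mixed r F (Suc k) (x(k := t)) = mixed r F (Suc k) x" by (rule mixed_upd_below) simp
  moreover have "mixed q (\<lambda>x. epowr (mixed r F k x / mixed r F (Suc k) x) e * g x) k (x(k := t))
     = epowr (mixed r F k (x(k := t)) / mixed r F (Suc k) (x(k := t))) e * mixed q g k (x(k := t))"
    using assms by (intro mixed_mult_above) (simp_all only: mixed_upd_below less_SucI less_imp_le)
  ultimately show ?thesis by simp
qed

text \<open>By induction the inner dual norm is at most the newest factor, and (r-1) r' = r turns
  its integral into that of (N_k / N_(k+1))^r, which is 1 in general. If the norm is 0 or infinite,
  the quotients vanish almost everywhere and the integral is 0.\<close>

lemma mixed_dual_fun_le_1:
  assumes r: "\<And>i. i < k \<Longrightarrow> 1 < r i" and [measurable]: "F \<in> borel_measurable seqs"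
  shows "mixed (\<lambda>i. r i / (r i - 1)) (dual_fun r F k) k x \<le> 1"
  using r
proof (induction k arbitrary: x)
  case (Suc k)
  let ?r' = "\<lambda>i. r i / (r i - 1)"
  have rk: "1 < r k" using Suc.prems by auto
  have r'pos: "0 < ?r' i" if "i \<le> k" for i using Suc.prems[of i] that by simp
  define m where "m = mixed r F (Suc k) x"
  have mI: "(\<integral>\<^sup>+ t. epowr (mixed r F k (x(k := t))) (r k) \<partial>lborel) = epowr m (r k)"
    using rk by (simp add: m_def epowr_inv')
  have "(\<integral>\<^sup>+ t. epowr (mixed ?r' (dual_fun r F (Suc k)) k (x(k := t))) (?r' k) \<partial>lborel)
     \<le> (\<integral>\<^sup>+ t. epowr (mixed r F k (x(k := t)) / m) (r k) \<partial>lborel)"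
  proof (rule nn_integral_mono)
    fix t
    have "mixed ?r' (dual_fun r F (Suc k)) k (x(k := t))
        = epowr (mixed r F k (x(k := t)) / m) (r k - 1) * mixed ?r' (dual_fun r F k) k (x(k := t))"
      unfolding m_def dual_fun.simps using r'pos by (intro mixed_dual_fun_step) auto
    also have "\<dots> \<le> epowr (mixed r F k (x(k := t)) / m) (r k - 1) * 1"
      using Suc by (intro mult_left_mono) auto
    finally have "epowr (mixed ?r' (dual_fun r F (Suc k)) k (x(k := t))) (?r' k)
       \<le> epowr (epowr (mixed r F k (x(k := t)) / m) (r k - 1)) (?r' k)"
      using r'pos[of k] by (intro epowr_mono) auto
    also have "\<dots> = epowr (mixed r F k (x(k := t)) / m) (r k)"
      using rk by (simp add: epowr_epowr)
    finally show "epowr (mixed ?r' (dual_fun r F (Suc k)) k (x(k := t))) (?r' k)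
       \<le> epowr (mixed r F k (x(k := t)) / m) (r k)" .
  qed
  also have "\<dots> \<le> 1"
  proof (cases "m = 0")
    case True
    then have "AE t in lborel. epowr (mixed r F k (x(k := t))) (r k) = 0"
      using nn_integral_0_iff_AE[of "\<lambda>t. epowr (mixed r F k (x(k := t))) (r k)" lborel] mI by simp
    then have "AE t in lborel. epowr (mixed r F k (x(k := t)) / m) (r k) = 0"
      by eventually_elim simp
    then have "(\<integral>\<^sup>+ t. epowr (mixed r F k (x(k := t)) / m) (r k) \<partial>lborel) = 0"
      by (subst nn_integral_0_iff_AE) auto
    then show ?thesis by simp
  next
    case False
    have "(\<integral>\<^sup>+ t. epowr (mixed r F k (x(k := t)) / m) (r k) \<partial>lborel) = epowr m (r k) * epowr (inverse m) (r k)"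
      unfolding mI[symmetric] by (simp add: divide_ennreal_def epowr_mult nn_integral_multc)
    also have "\<dots> = epowr (m * inverse m) (r k)" by (simp add: epowr_mult)
    also have "\<dots> \<le> 1"
    proof (cases m)
      case (real c)
      then have "m * inverse m = 1" using False by (simp add: inverse_ennreal flip: ennreal_mult)
      then show ?thesis by simp
    qed simp
    finally show ?thesis .
  qed
  finally have "mixed ?r' (dual_fun r F (Suc k)) (Suc k) x \<le> epowr 1 (1 / ?r' k)"
    unfolding mixed.simps by (rule epowr_mono) (use rk in auto)
  then show ?case by (simp only: epowr_1_left)
qed simp

text \<open>Pairing \<open>F\<close> with its dual function recovers the norm. An infinite norm in
  the denominator would make the pairing 0, hence the finiteness assumption.\<close>

lemma mixed_le_dual_fun:
  assumes r: "\<And>i. i < k \<Longrightarrow> 1 < r i" and F [measurable]: "F \<in> borel_measurable seqs"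
    and fin: "mixed r F k x < top"
  shows "mixed r F k x \<le> mixed (\<lambda>_. 1) (\<lambda>y. F y * dual_fun r F k y) k x"
  using r fin
proof (induction k arbitrary: x)
  case (Suc k)
  have rk: "1 < r k" using Suc.prems by auto
  define m where "m = mixed r F (Suc k) x"
  have mI: "(\<integral>\<^sup>+ t. epowr (mixed r F k (x(k := t))) (r k) \<partial>lborel) = epowr m (r k)"
    using rk by (simp add: m_def epowr_inv')
  have mfin: "m < top" using Suc.prems by (simp only: m_def)
  show ?case
  proof (cases "m = 0")
    case False
    then obtain c where c: "m = ennreal c" "0 < c" using mfin by (cases m) (auto simp: less_le)
    \<comment> \<open>The inner norms are finite for almost every value of the last coordinate, so
      the induction hypothesis may be used under the integral.\<close>
    have "AE t in lborel. epowr (mixed r F k (x(k := t))) (r k) \<noteq> \<infinity>"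
      using mfin by (intro nn_integral_PInf_AE) (auto simp: mI less_top)
    then have fink: "AE t in lborel. mixed r F k (x(k := t)) < top"
      by eventually_elim (simp add: less_top)
    have "m = ennreal (c powr r k * c powr (1 - r k))"
      using c by (simp flip: powr_add)
    also have "\<dots> = epowr m (r k) * ennreal (c powr (1 - r k))"
      using c by (simp add: epowr_ennreal ennreal_mult)
    also have "\<dots> = (\<integral>\<^sup>+ t. epowr (mixed r F k (x(k := t))) (r k) * ennreal (c powr (1 - r k)) \<partial>lborel)"
      unfolding mI[symmetric] by (simp add: nn_integral_multc)
    also have "\<dots> = (\<integral>\<^sup>+ t. epowr (mixed r F k (x(k := t)) / m) (r k - 1) * mixed r F k (x(k := t)) \<partial>lborel)"
    proof (rule nn_integral_cong)
      fix t
      have "epowr (inverse m) (r k - 1) = ennreal (c powr (1 - r k))"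
        using c by (simp add: inverse_ennreal epowr_ennreal powr_minus[symmetric] inverse_powr)
      then show "epowr (mixed r F k (x(k := t))) (r k) * ennreal (c powr (1 - r k))
          = epowr (mixed r F k (x(k := t)) / m) (r k - 1) * mixed r F k (x(k := t))"
        using epowr_add[of "mixed r F k (x(k := t))" "r k - 1" 1]
        by (simp add: divide_ennreal_def epowr_mult mult_ac)
    qed
    also have "\<dots> \<le> (\<integral>\<^sup>+ t. mixed (\<lambda>_. 1) (\<lambda>y. F y * dual_fun r F (Suc k) y) k (x(k := t)) \<partial>lborel)"
    proof (rule nn_integral_mono_AE, use fink in eventually_elim)
      case (elim t)
      have eq: "(\<lambda>y. F y * dual_fun r F (Suc k) y)
        = (\<lambda>y. epowr (mixed r F k y / mixed r F (Suc k) y) (r k - 1) * (F y * dual_fun r F k y))"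
        by (rule ext) (simp only: dual_fun.simps mult_ac)
      have "mixed (\<lambda>_. 1) (\<lambda>y. F y * dual_fun r F (Suc k) y) k (x(k := t))
        = epowr (mixed r F k (x(k := t)) / m) (r k - 1) * mixed (\<lambda>_. 1) (\<lambda>y. F y * dual_fun r F k y) k (x(k := t))"
        unfolding m_def eq by (intro mixed_dual_fun_step) auto
      moreover have "mixed r F k (x(k := t)) \<le> mixed (\<lambda>_. 1) (\<lambda>y. F y * dual_fun r F k y) k (x(k := t))"
        by (rule Suc.IH[OF _ elim]) (rule Suc.prems(1), simp)
      ultimately show ?case by (simp add: mult_left_mono)
    qed
    also have "\<dots> = mixed (\<lambda>_. 1) (\<lambda>y. F y * dual_fun r F (Suc k) y) (Suc k) x"
      by simp
    finally show ?thesis unfolding m_def .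
  qed (simp add: m_def)
qed simp

subsection \<open>Balls, boxes and null sets in the product space\<close>

abbreviation Pn :: "nat \<Rightarrow> (nat \<Rightarrow> real) measure" where
  "Pn n \<equiv> \<Pi>\<^sub>M i\<in>{..<n}. lborel"

lemma merge_measurable_seqs:
  "(\<lambda>z i. if i < n then z i else x i) \<in> Pn n \<rightarrow>\<^sub>M seqs"
proof (rule measurable_PiM_single')
  fix i :: nat
  show "(\<lambda>z. if i < n then z i else x i) \<in> Pn n \<rightarrow>\<^sub>M borel"
  proof (cases "i < n")
    case True
    then have "(\<lambda>z. z i) \<in> Pn n \<rightarrow>\<^sub>M lborel" by (intro measurable_component_singleton) auto
    then show ?thesis using True by simp
  qed simp
qed (auto simp: space_PiM)

lemma merge_undefined:
  assumes "z \<in> space (Pn n)" "x \<in> space (Pn n)"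
  shows "(\<lambda>i. if i < n then z i else x i) = z"
  using assms by (intro ext) (auto simp: space_PiM PiE_def extensional_def)

lemma borel_measurable_Pn:
  assumes "h \<in> borel_measurable seqs"
  shows "h \<in> borel_measurable (Pn n)"
proof -
  have "(\<lambda>z. h (\<lambda>i. if i < n then z i else undefined)) \<in> borel_measurable (Pn n)"
    by (rule measurable_compose[OF merge_measurable_seqs assms])
  moreover have "h (\<lambda>i. if i < n then z i else undefined) = h z" if "z \<in> space (Pn n)" for z
    using that by (intro arg_cong[of _ _ h] ext) (auto simp: space_PiM PiE_def extensional_def)
  ultimately show ?thesis by (subst (asm) measurable_cong) auto
qed

lemma mixed_1_Suc: "mixed (\<lambda>_. 1) h (Suc k) x = (\<integral>\<^sup>+ t. mixed (\<lambda>_. 1) h k (x(k := t)) \<partial>lborel)"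
  by simp

text \<open>Tonelli, in a form that survives induction: beyond n the point agrees with an arbitrary
  \<open>x\<close>, while points of the product space are undefined there.\<close>

lemma nn_integral_Pn_merge:
  assumes "h \<in> borel_measurable seqs"
  shows "(\<integral>\<^sup>+ z. h (\<lambda>i. if i < n then z i else x i) \<partial>Pn n) = mixed (\<lambda>_. 1) h n x"
proof (induction n arbitrary: x)
  case 0
  show ?case by (simp add: PiM_empty nn_integral_count_space_finite)
next
  case (Suc n)
  interpret product_sigma_finite "\<lambda>_::nat. lborel :: real measure" by standard
  have "(\<integral>\<^sup>+ z. h (\<lambda>i. if i < Suc n then z i else x i) \<partial>Pn (Suc n))
     = (\<integral>\<^sup>+ t. \<integral>\<^sup>+ z. h (\<lambda>i. if i < Suc n then (z(n := t)) i else x i) \<partial>Pn n \<partial>lborel)"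
    unfolding lessThan_Suc
  proof (rule product_nn_integral_insert_rev)
    show "(\<lambda>z. h (\<lambda>i. if i < Suc n then z i else x i)) \<in> borel_measurable (Pi\<^sub>M (insert n {..<n}) (\<lambda>i. lborel))"
      using measurable_compose[OF merge_measurable_seqs assms, of "Suc n"] unfolding lessThan_Suc .
  qed auto
  also have "\<dots> = (\<integral>\<^sup>+ t. \<integral>\<^sup>+ z. h (\<lambda>i. if i < n then z i else (x(n := t)) i) \<partial>Pn n \<partial>lborel)"
  proof (intro nn_integral_cong arg_cong[of _ _ h] ext)
    fix t z i
    show "(if i < Suc n then (z(n := t)) i else x i) = (if i < n then z i else (x(n := t)) i)"
      by (auto simp: less_Suc_eq)
  qed
  also have "\<dots> = mixed (\<lambda>_. 1) h (Suc n) x" by (simp only: Suc mixed_1_Suc)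
  finally show ?case .
qed

lemma nn_integral_Pn:
  assumes "h \<in> borel_measurable seqs" "x \<in> space (Pn n)"
  shows "(\<integral>\<^sup>+ z. h z \<partial>Pn n) = mixed (\<lambda>_. 1) h n x"
  unfolding nn_integral_Pn_merge[OF assms(1), symmetric]
  using assms(2) by (intro nn_integral_cong) (simp add: merge_undefined)

text \<open>A finite norm forces finite inner norms on almost every section, down to the values of
  \<open>W\<close> themselves.\<close>

lemma mixed_finite_AE:
  assumes [measurable]: "W \<in> borel_measurable seqs" and q: "\<And>i. i < k \<Longrightarrow> 0 < q i"
    and fin: "mixed q W k x < top"
  shows "mixed (\<lambda>_. 1) (indicator {y. W y = top}) k x = 0"
  using q fin
proof (induction k arbitrary: x)
  case (Suc k)
  have "(\<integral>\<^sup>+ t. epowr (mixed q W k (x(k := t))) (q k) \<partial>lborel) \<noteq> \<infinity>"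
  proof -
    have "(\<integral>\<^sup>+ t. epowr (mixed q W k (x(k := t))) (q k) \<partial>lborel) < top"
      using Suc.prems(2) by (simp only: mixed.simps epowr_less_top_iff)
    then show ?thesis unfolding infinity_ennreal_def by (rule less_imp_neq)
  qed
  then have "AE t in lborel. epowr (mixed q W k (x(k := t))) (q k) \<noteq> \<infinity>"
    by (intro nn_integral_PInf_AE) auto
  then have "AE t in lborel. mixed (\<lambda>_. 1) (indicator {y. W y = top}) k (x(k := t)) = 0"
  proof eventually_elim
    case (elim t)
    then have "mixed q W k (x(k := t)) < top" by (simp add: less_top)
    then show ?case by (rule Suc.IH[rotated]) (rule Suc.prems(1), simp)
  qed
  then have "(\<integral>\<^sup>+ t. mixed (\<lambda>_. 1) (indicator {y. W y = top}) k (x(k := t)) \<partial>lborel) = (\<integral>\<^sup>+ t. 0 \<partial>(lborel::real measure))"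
    by (rule nn_integral_cong_AE)
  then show ?case by simp
qed (auto simp: indicator_def)

text \<open>The inductive bound on the section through x(k := t) is a multiple of \<open>W\<close>
  at that point, and integrating it over the last side is the one-dimensional condition at
  \<open>x\<close>. The condition has to hold at every point, since an exceptional null set could
  contain whole sections.\<close>

lemma strong_A1_box:
  assumes [measurable]: "W \<in> borel_measurable seqs"
    and A1: "\<And>j y. j < k \<Longrightarrow> coord_max j W y \<le> ennreal D * W y" and D: "0 < D"
    and ab: "\<And>j. j < k \<Longrightarrow> a j \<in> \<rat> \<and> b j \<in> \<rat> \<and> a j < x j \<and> x j < b j"
  shows "mixed (\<lambda>_. 1) (\<lambda>y. (\<Prod>j<k. indicator {a j<..<b j} (y j)) * W y) k x
      \<le> ennreal (\<Prod>j<k. D * (b j - a j)) * W x"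
  using A1 ab
proof (induction k arbitrary: x)
  case (Suc k)
  have [measurable]: "(\<lambda>x. x j) \<in> borel_measurable seqs" for j
    by (rule measurable_component_singleton) simp
  let ?g = "\<lambda>y. (\<Prod>j<k. indicator {a j<..<b j} (y j)) * W y"
  let ?c = "\<Prod>j<k. D * (b j - a j)"
  have abk: "a k \<in> \<rat>" "b k \<in> \<rat>" "a k < x k" "x k < b k" using Suc.prems(2)[of k] by auto
  have c0: "0 \<le> ?c"
  proof (rule prod_nonneg)
    fix j assume "j \<in> {..<k}"
    then show "0 \<le> D * (b j - a j)" using Suc.prems(2)[of j] D by auto
  qed
  have "mixed (\<lambda>_. 1) (\<lambda>y. (\<Prod>j<Suc k. indicator {a j<..<b j} (y j)) * W y) (Suc k) x
     = (\<integral>\<^sup>+ t. mixed (\<lambda>_. 1) (\<lambda>y. indicator {a k<..<b k} (y k) * ?g y) k (x(k := t)) \<partial>lborel)"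
  proof -
    have "(\<lambda>y. (\<Prod>j<Suc k. indicator {a j<..<b j} (y j)) * W y) = (\<lambda>y. indicator {a k<..<b k} (y k) * ?g y)"
    proof
      fix y :: "nat \<Rightarrow> real"
      have "(\<Prod>j<Suc k. f j) * w = f k * ((\<Prod>j<k. f j) * w)" for f :: "nat \<Rightarrow> ennreal" and w
        by (simp add: mult_ac)
      then show "(\<Prod>j<Suc k. indicator {a j<..<b j} (y j)) * W y = indicator {a k<..<b k} (y k) * ?g y" .
    qed
    then show ?thesis by (simp only: mixed_1_Suc)
  qed
  also have "\<dots> = (\<integral>\<^sup>+ t. indicator {a k<..<b k} t * mixed (\<lambda>_. 1) ?g k (x(k := t)) \<partial>lborel)"
  proof (rule nn_integral_cong)
    fix t
    have "mixed (\<lambda>_. 1) (\<lambda>y. indicator {a k<..<b k} (y k) * ?g y) k (x(k := t))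
       = indicator {a k<..<b k} ((x(k := t)) k) * mixed (\<lambda>_. 1) ?g k (x(k := t))"
      by (rule mixed_mult_above) auto
    then show "mixed (\<lambda>_. 1) (\<lambda>y. indicator {a k<..<b k} (y k) * ?g y) k (x(k := t))
       = indicator {a k<..<b k} t * mixed (\<lambda>_. 1) ?g k (x(k := t))" by (simp only: fun_upd_same)
  qed
  also have "\<dots> \<le> (\<integral>\<^sup>+ t. ennreal ?c * (W (x(k := t)) * indicator {a k<..<b k} t) \<partial>lborel)"
  proof (rule nn_integral_mono)
    fix t
    have "mixed (\<lambda>_. 1) ?g k (x(k := t)) \<le> ennreal ?c * W (x(k := t))"
    proof (rule Suc.IH)
      fix j assume "j < k"
      then show "a j \<in> \<rat> \<and> b j \<in> \<rat> \<and> a j < (x(k := t)) j \<and> (x(k := t)) j < b j"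
        using Suc.prems(2)[of j] by auto
    qed (rule Suc.prems(1), simp)
    then have "indicator {a k<..<b k} t * mixed (\<lambda>_. 1) ?g k (x(k := t)) \<le> indicator {a k<..<b k} t * (ennreal ?c * W (x(k := t)))"
      by (rule mult_left_mono) simp
    then show "indicator {a k<..<b k} t * mixed (\<lambda>_. 1) ?g k (x(k := t)) \<le> ennreal ?c * (W (x(k := t)) * indicator {a k<..<b k} t)"
      by (simp only: mult_ac)
  qed
  also have "\<dots> = ennreal ?c * (\<integral>\<^sup>+ t\<in>{a k<..<b k}. W (x(k := t)) \<partial>lborel)"
    by (rule nn_integral_cmult) simp
  also have "\<dots> \<le> ennreal ?c * (ennreal (b k - a k) * (ennreal D * W x))"
  proof (rule mult_left_mono)
    have "(\<integral>\<^sup>+ t\<in>{a k<..<b k}. W (x(k := t)) \<partial>lborel) \<le> ennreal (b k - a k) * coord_max k W x"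
      unfolding coord_max_def by (rule maxfun_1_ge[OF abk])
    also have "\<dots> \<le> ennreal (b k - a k) * (ennreal D * W x)"
      by (intro mult_left_mono Suc.prems(1)) auto
    finally show "(\<integral>\<^sup>+ t\<in>{a k<..<b k}. W (x(k := t)) \<partial>lborel) \<le> ennreal (b k - a k) * (ennreal D * W x)" .
  qed simp
  also have "\<dots> = ennreal (?c * (D * (b k - a k))) * W x"
    using c0 D abk by (simp add: ennreal_mult mult_ac)
  also have "?c * (D * (b k - a k)) = (\<Prod>j<Suc k. D * (b j - a j))" by (simp only: prod.lessThan_Suc)
  finally show ?case .
qed simp

lemma eball_coord:
  assumes "y \<in> eball n x r" "i < n"
  shows "\<bar>y i - x i\<bar> < r"
proof -
  have "(y i - x i)\<^sup>2 \<le> (\<Sum>i<n. (y i - x i)\<^sup>2)"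
    using assms(2) by (intro member_le_sum) auto
  then have "\<bar>y i - x i\<bar> \<le> sqrt (\<Sum>i<n. (y i - x i)\<^sup>2)"
    by (intro real_le_rsqrt) simp
  also have "\<dots> < r" using assms(1) by (simp add: eball_def)
  finally show ?thesis .
qed

lemma eball_measurable [measurable]: "eball n x r \<in> sets (Pn n)"
proof -
  have comp: "(\<lambda>z. z i) \<in> borel_measurable (Pn n)" if "i \<in> {..<n}" for i
    using measurable_component_singleton[OF that, of "\<lambda>_. lborel :: real measure"] by simp
  have [measurable]: "(\<lambda>y. \<Sum>i<n. (y i - x i)\<^sup>2) \<in> borel_measurable (Pn n)"
    by (intro borel_measurable_sum borel_measurable_power borel_measurable_diff comp) auto
  have "{y \<in> space (Pn n). sqrt (\<Sum>i<n. (y i - x i)\<^sup>2) < r} \<in> sets (Pn n)"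
    by measurable
  then show ?thesis by (simp add: eball_def Rn_def)
qed

lemma emeasure_cube:
  assumes "0 \<le> d"
  shows "emeasure (Pn n) (Pi\<^sub>E {..<n} (\<lambda>i. {x i - d<..<x i + d})) = ennreal ((2 * d) ^ n)"
proof -
  interpret product_sigma_finite "\<lambda>_::nat. lborel :: real measure" by standard
  have "emeasure (Pn n) (Pi\<^sub>E {..<n} (\<lambda>i. {x i - d<..<x i + d})) = (\<Prod>i<n. emeasure lborel {x i - d<..<x i + d})"
    by (rule emeasure_PiM) auto
  also have "\<dots> = (\<Prod>i<n. ennreal (2 * d))" using assms by (intro prod.cong) auto
  also have "\<dots> = ennreal ((2 * d) ^ n)" using assms by (simp add: ennreal_power)
  finally show ?thesis .
qed

text \<open>The inscribed cube has half side r/n because the Euclidean norm is at most the sum of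
  the absolute values of the coordinates. The circumscribed cube gives finiteness, without which
  \<open>measure\<close> would return 0.\<close>

lemma measure_eball_ge:
  assumes n: "1 \<le> n" and r: "0 < r"
  shows "(2 * (r / n)) ^ n \<le> measure (Rn n) (eball n x r)"
    and "0 < emeasure (Pn n) (eball n x r)"
proof -
  let ?Q = "\<lambda>d. Pi\<^sub>E {..<n} (\<lambda>i. {x i - d<..<x i + d})"
  have sub: "?Q (r / n) \<subseteq> eball n x r"
  proof
    fix y assume y: "y \<in> ?Q (r / n)"
    have "sqrt (\<Sum>i<n. (y i - x i)\<^sup>2) \<le> (\<Sum>i<n. \<bar>y i - x i\<bar>)"
      using L2_set_le_sum_abs[of "\<lambda>i. y i - x i" "{..<n}"] by (simp add: L2_set_def)
    also have "\<dots> < (\<Sum>i<n. r / n)"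
    proof (rule sum_strict_mono)
      fix i assume "i \<in> {..<n}"
      then have "y i \<in> {x i - r / n<..<x i + r / n}" by (rule PiE_mem[OF y])
      then show "\<bar>y i - x i\<bar> < r / n" by (simp add: abs_less_iff)
    qed (use n in \<open>auto simp: lessThan_empty_iff\<close>)
    also have "\<dots> = r" using n by simp
    finally show "y \<in> eball n x r" using y by (simp add: eball_def Rn_def space_PiM PiE_iff)
  qed
  have sup: "eball n x r \<subseteq> ?Q r"
  proof
    fix y assume y: "y \<in> eball n x r"
    then have "y \<in> extensional {..<n}" by (auto simp: eball_def Rn_def space_PiM PiE_iff)
    moreover have "y i \<in> {x i - r<..<x i + r}" if "i < n" for i
      using eball_coord[OF y that] by auto
    ultimately show "y \<in> ?Q r" by (auto simp: PiE_iff)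
  qed
  have Qm: "?Q d \<in> sets (Pn n)" for d by (intro sets_PiM_I_finite) auto
  have ge: "ennreal ((2 * (r / n)) ^ n) \<le> emeasure (Pn n) (eball n x r)"
    using emeasure_mono[OF sub, of "Pn n"] emeasure_cube[of "r / n" n x] r by simp
  have "emeasure (Pn n) (eball n x r) \<le> ennreal ((2 * r) ^ n)"
    using emeasure_mono[OF sup Qm] emeasure_cube[of r n x] r by simp
  then have "emeasure (Pn n) (eball n x r) \<noteq> top" by (auto simp: top_unique)
  then have "emeasure (Pn n) (eball n x r) = ennreal (measure (Rn n) (eball n x r))"
    by (simp add: Rn_def emeasure_eq_ennreal_measure)
  then show "(2 * (r / n)) ^ n \<le> measure (Rn n) (eball n x r)"
    using ge by (simp add: ennreal_le_iff)
  have "0 < ennreal ((2 * (r / n)) ^ n)" using n r by simp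
  then show "0 < emeasure (Pn n) (eball n x r)" using ge by (rule less_le_trans)
qed

lemma strong_A1_ball:
  assumes W: "W \<in> borel_measurable seqs"
    and A1: "\<And>j y. j < n \<Longrightarrow> coord_max j W y \<le> ennreal D * W y" and D: "0 < D"
    and r: "0 < r" and y: "y \<in> eball n x r"
  shows "(\<integral>\<^sup>+ z. indicator (eball n x r) z * W z \<partial>Pn n) \<le> ennreal ((D * (4 * r)) ^ n) * W y"
proof -
  have [measurable]: "(\<lambda>x. x j) \<in> borel_measurable seqs" for j
    by (rule measurable_component_singleton) simp
  \<comment> \<open>The box must have rational endpoints and contain the ball; a margin of less than
    r on each side keeps its sides below 4r.\<close>
  have "\<exists>a\<in>\<rat>. x i - 2 * r < a \<and> a < x i - r" for i
    using Rats_dense_in_real[of "x i - 2 * r" "x i - r"] r by auto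
  then obtain a where a: "\<And>i. a i \<in> \<rat>" "\<And>i. x i - 2 * r < a i" "\<And>i. a i < x i - r"
    by metis
  have "\<exists>b\<in>\<rat>. x i + r < b \<and> b < x i + 2 * r" for i
    using Rats_dense_in_real[of "x i + r" "x i + 2 * r"] r by auto
  then obtain b where b: "\<And>i. b i \<in> \<rat>" "\<And>i. x i + r < b i" "\<And>i. b i < x i + 2 * r"
    by metis
  let ?I = "\<lambda>y. \<Prod>j<n. indicator {a j<..<b j} (y j) :: ennreal"
  have box: "a j < z j \<and> z j < b j" if "z \<in> eball n x r" "j < n" for z j
    using eball_coord[OF that] a(3)[of j] b(2)[of j] by linarith
  have ys: "y \<in> space (Pn n)" using y by (simp add: eball_def Rn_def)
  have "(\<integral>\<^sup>+ z. indicator (eball n x r) z * W z \<partial>Pn n) \<le> (\<integral>\<^sup>+ z. ?I z * W z \<partial>Pn n)"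
  proof (intro nn_integral_mono mult_right_mono)
    fix z
    show "indicator (eball n x r) z \<le> ?I z"
      using box[of z] by (cases "z \<in> eball n x r") (auto simp: indicator_def)
  qed auto
  also have "\<dots> = mixed (\<lambda>_. 1) (\<lambda>z. ?I z * W z) n y"
  proof (rule nn_integral_Pn[OF _ ys])
    show "(\<lambda>z. ?I z * W z) \<in> borel_measurable seqs" using W by measurable
  qed
  also have "\<dots> \<le> ennreal (\<Prod>j<n. D * (b j - a j)) * W y"
    using a b box[OF y] by (intro strong_A1_box W A1 D) auto
  also have "\<dots> \<le> ennreal ((D * (4 * r)) ^ n) * W y"
  proof (intro mult_right_mono ennreal_leI)
    have "(\<Prod>j<n. D * (b j - a j)) \<le> (\<Prod>j<n. D * (4 * r))"
    proof (intro prod_mono conjI mult_left_mono)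
      fix j
      show "b j - a j \<le> 4 * r" using a(2)[of j] b(3)[of j] by linarith
      show "0 \<le> D * (b j - a j)" using a(3)[of j] b(2)[of j] D r by (intro mult_nonneg_nonneg) auto
    qed (use D in auto)
    then show "(\<Prod>j<n. D * (b j - a j)) \<le> (D * (4 * r)) ^ n" by simp
  qed simp
  finally show ?thesis .
qed

text \<open>The averages over a ball are compared with \<open>W\<close> at every point where it is
  finite; \<open>enn2real\<close> sends the value \<open>top\<close> to 0, which happens on a null
  set only.\<close>

lemma A1_weight_of_strong:
  assumes n: "1 \<le> n" and W: "W \<in> borel_measurable seqs"
    and A1: "\<And>j y. j < n \<Longrightarrow> coord_max j W y \<le> ennreal D * W y" and D: "0 < D"
    and fin: "AE z in Pn n. W z < top"
  shows "A1_weight n (\<lambda>z. enn2real (W z))"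
proof -
  define w where "w z = enn2real (W z)" for z
  have WP [measurable]: "W \<in> borel_measurable (Pn n)" using W by (rule borel_measurable_Pn)
  have wP [measurable]: "w \<in> borel_measurable (Pn n)" unfolding w_def by measurable
  have wR: "w \<in> borel_measurable (Rn n)" unfolding Rn_def using wP by (rule measurable_completion)
  have w0: "0 \<le> w z" for z by (simp add: w_def)
  have ball: "(\<integral>\<^sup>+ z. ennreal (indicator (eball n x r) z * w z) \<partial>Rn n) \<le> ennreal ((D * (4 * r)) ^ n * w y)"
    if r: "0 < r" and y: "y \<in> eball n x r" "W y < top" for x r y
  proof -
    have "(\<integral>\<^sup>+ z. ennreal (indicator (eball n x r) z * w z) \<partial>Rn n)
        \<le> (\<integral>\<^sup>+ z. indicator (eball n x r) z * W z \<partial>Pn n)"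
      unfolding Rn_def nn_integral_completion
    proof (rule nn_integral_mono)
      fix z
      have "ennreal (w z) \<le> W z" by (cases "W z") (auto simp: w_def)
      then show "ennreal (indicator (eball n x r) z * w z) \<le> indicator (eball n x r) z * W z"
        by (simp add: indicator_def)
    qed
    also have "\<dots> \<le> ennreal ((D * (4 * r)) ^ n) * W y"
      by (rule strong_A1_ball[OF W A1 D r y(1)])
    also have "\<dots> = ennreal ((D * (4 * r)) ^ n * w y)"
      using D r y(2) w0[of y] by (simp add: w_def ennreal_mult)
    finally show ?thesis .
  qed
  have ind: "(\<lambda>z. indicator (eball n x r) z * w z) \<in> borel_measurable (Rn n)" for x r
  proof -
    have "(\<lambda>z. indicator (eball n x r) z * w z) \<in> borel_measurable (Pn n)" by measurable
    then show ?thesis unfolding Rn_def by (rule measurable_completion)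
  qed
  \<comment> \<open>The ratio between the bound for the enclosing box and the volume of the
    inscribed cube: D (4r) / (2r/n) = 2 n D in each coordinate.\<close>
  have "A1_cond n w ((2 * n * D) ^ n)"
    unfolding A1_cond_def
  proof (intro ballI allI impI)
    fix x r assume r: "(0::real) < r"
    have "AE y in Rn n. W y < top" unfolding Rn_def using fin by (rule AE_completion)
    then show "AE y in Rn n. y \<in> eball n x r \<longrightarrow>
        1 / measure (Rn n) (eball n x r) * (\<integral>z\<in>eball n x r. w z \<partial>Rn n) \<le> (2 * n * D) ^ n * w y"
    proof eventually_elim
      case (elim y)
      show ?case
      proof
        assume y: "y \<in> eball n x r"
        let ?B = "\<integral>z\<in>eball n x r. w z \<partial>Rn n"
        have "?B = enn2real (\<integral>\<^sup>+ z. ennreal (indicator (eball n x r) z * w z) \<partial>Rn n)"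
          unfolding set_lebesgue_integral_def real_scaleR_def
          by (rule integral_eq_nn_integral[OF ind]) (simp add: w0)
        also have "\<dots> \<le> (D * (4 * r)) ^ n * w y"
          using ball[OF r y elim] D r w0[of y] by (intro enn2real_leI) auto
        finally have B: "?B \<le> (D * (4 * r)) ^ n * w y" .
        have B0: "0 \<le> ?B" unfolding set_lebesgue_integral_def real_scaleR_def
          by (intro Bochner_Integration.integral_nonneg mult_nonneg_nonneg w0) auto
        have m: "(2 * (r / n)) ^ n \<le> measure (Rn n) (eball n x r)" by (rule measure_eball_ge[OF n r])
        have c: "0 < (2 * (r / n)) ^ n" using n r by simp
        have "1 / measure (Rn n) (eball n x r) * ?B \<le> 1 / (2 * (r / n)) ^ n * ((D * (4 * r)) ^ n * w y)"
          using m c B B0 by (intro mult_mono divide_left_mono mult_pos_pos) (auto intro: less_le_trans)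
        also have "1 / (2 * (r / n)) ^ n * ((D * (4 * r)) ^ n * w y) = (D * (4 * r) / (2 * (r / n))) ^ n * w y"
        proof -
          have "1 / c ^ n * (a ^ n * v) = (a / c) ^ n * v" for a c v :: real
            by (simp add: power_divide)
          then show ?thesis .
        qed
        also have "D * (4 * r) / (2 * (r / n)) = 2 * n * D" using n r by (simp add: field_simps)
        finally show "1 / measure (Rn n) (eball n x r) * ?B \<le> (2 * n * D) ^ n * w y" .
      qed
    qed
  qed
  moreover have "0 < (2 * n * D) ^ n" using n D by simp
  moreover have "set_integrable (Rn n) (eball n x r) w" if r: "0 < r" for x r
  proof -
    \<comment> \<open>A ball has positive measure, so \<open>W\<close> is finite somewhere in it;
      the bound at that single point gives integrability.\<close>
    have "\<exists>y\<in>eball n x r. W y < top"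
    proof (rule ccontr)
      assume "\<not> ?thesis"
      then have "AE z in Pn n. z \<notin> eball n x r" using fin by (auto elim: eventually_mono)
      then have "emeasure (Pn n) (eball n x r) = 0"
        by (subst (asm) AE_iff_measurable[OF eball_measurable[of n x r]]) (auto simp: eball_def Rn_def)
      then show False using measure_eball_ge(2)[OF n r, of x] by simp
    qed
    then obtain y where y: "y \<in> eball n x r" "W y < top" by blast
    have "(\<integral>\<^sup>+ z. ennreal (indicator (eball n x r) z * w z) \<partial>Rn n) < \<infinity>"
      using ball[OF r y] by (rule le_less_trans) simp
    then show ?thesis
      unfolding set_integrable_def real_scaleR_def
      by (intro integrableI_nonneg ind) (auto simp: w0)
  qed
  ultimately show ?thesis
    using wR w0 unfolding A1_weight_def w_def[symmetric] by blast
qed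

section \<open>Null sets and Borel representatives for mixed norms\<close>

lemma mixed_partial_mixed: "mixed_partial q f k x = mixed q (\<lambda>x. ennreal \<bar>f x\<bar>) k x"
  by (induction k arbitrary: x) simp_all

lemma restrict_measurable_seqs: "(\<lambda>x. restrict x {..<n}) \<in> seqs \<rightarrow>\<^sub>M Pn n"
proof (rule measurable_PiM_single')
  fix i assume "i \<in> {..<n}"
  have "(\<lambda>x. x i) \<in> borel_measurable seqs" by (rule measurable_component_singleton) simp
  then show "(\<lambda>x. restrict x {..<n} i) \<in> seqs \<rightarrow>\<^sub>M lborel"
    using \<open>i \<in> {..<n}\<close> by simp
qed (auto simp: space_PiM split: if_splits)

text \<open>The mixed norm reads values on single lines, so invariance under null sets is a
  statement about sections. By Tonelli for the indicator of \<open>A\<close> almost every section is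
  null, and the integrands are exchanged coordinate by coordinate; \<open>f\<close> and
  \<open>g\<close> may be non-measurable on sections.\<close>

lemma mixed_cong_null:
  assumes A: "A \<in> null_sets (Pn n)"
    and fg: "\<And>y. y \<in> extensional {..<n} \<Longrightarrow> y \<notin> A \<Longrightarrow> f y = g y"
  shows "mixed q f n (\<lambda>_. undefined) = mixed q g n (\<lambda>_. undefined)"
proof -
  define N where "N x = (indicator A (restrict x {..<n}) :: ennreal)" for x
  have [measurable]: "A \<in> sets (Pn n)" using A by auto
  have N [measurable]: "N \<in> borel_measurable seqs"
    unfolding N_def by (rule measurable_compose[OF restrict_measurable_seqs]) measurable
  have step: "mixed q f k x = mixed q g k x"
    if "mixed (\<lambda>_. 1) N k x = 0" "k \<le> n" "x \<in> extensional {..<n}" for k x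
    using that
  proof (induction k arbitrary: x)
    case 0
    then have "x \<notin> A" by (simp add: N_def extensional_restrict indicator_def split: if_splits)
    then show ?case using fg 0 by simp
  next
    case (Suc k)
    have "(\<integral>\<^sup>+ t. mixed (\<lambda>_. 1) N k (x(k := t)) \<partial>lborel) = 0" using Suc.prems(1) by simp
    then have "AE t in lborel. mixed (\<lambda>_. 1) N k (x(k := t)) = 0"
      by (subst (asm) nn_integral_0_iff_AE) simp_all
    then have "AE t in lborel. epowr (mixed q f k (x(k := t))) (q k) = epowr (mixed q g k (x(k := t))) (q k)"
    proof eventually_elim
      case (elim t)
      have "x(k := t) \<in> extensional {..<n}" using Suc.prems by (auto simp: extensional_def)
      then have "mixed q f k (x(k := t)) = mixed q g k (x(k := t))"
        by (rule Suc.IH[OF elim Suc_leD[OF Suc.prems(2)]])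
      then show ?case by simp
    qed
    from nn_integral_cong_AE[OF this] show ?case by (simp only: mixed.simps)
  qed
  have "(\<integral>\<^sup>+ z. N (\<lambda>i. if i < n then z i else undefined) \<partial>Pn n) = (\<integral>\<^sup>+ z. indicator A z \<partial>Pn n)"
  proof (rule nn_integral_cong)
    fix z assume "z \<in> space (Pn n)"
    then have "restrict (\<lambda>i. if i < n then z i else undefined) {..<n} = z"
      by (intro ext) (auto simp: space_PiM PiE_def extensional_def restrict_def)
    then show "N (\<lambda>i. if i < n then z i else undefined) = indicator A z" by (simp add: N_def)
  qed
  also have "\<dots> = 0" using A by (simp add: null_setsD1)
  finally have "mixed (\<lambda>_. 1) N n (\<lambda>_. undefined) = 0"
    unfolding nn_integral_Pn_merge[OF N] .
  then show ?thesis by (rule step) (auto simp: extensional_def)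
qed

subsection \<open>The extrapolation theorem\<close>

lemma mixed_cong_exponents: "(\<And>i. i < k \<Longrightarrow> q i = q' i) \<Longrightarrow> mixed q h k x = mixed q' h k x"
  by (induction k arbitrary: x) simp_all

lemma undefined_in_space_Pn: "(\<lambda>_. undefined) \<in> space (Pn n)"
  by (auto simp: space_PiM PiE_def extensional_def)

text \<open>A function measurable for the completion may have sections that are not Borel. The
  representative depends on \<open>f\<close> only and is good for all exponents at once.\<close>

lemma mixed_norm_borel_representative:
  assumes f: "f \<in> borel_measurable (Rn n)"
  shows "\<exists>\<phi>. \<phi> \<in> borel_measurable seqs \<and> (AE z in Pn n. ennreal \<bar>f z\<bar> = \<phi> z) \<and>
    (\<forall>q. mixed_norm n q f = mixed q \<phi> n (\<lambda>_. undefined))"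
proof -
  have "f \<in> borel_measurable (completion (Pn n))" using f by (simp add: Rn_def)
  from completion_ex_borel_measurable_real[OF this]
  obtain f' where f' [measurable]: "f' \<in> borel_measurable (Pn n)" and ae: "AE z in Pn n. f z = f' z"
    by auto
  define \<phi> where "\<phi> x = ennreal \<bar>f' (restrict x {..<n})\<bar>" for x
  have "(\<lambda>z. ennreal \<bar>f' z\<bar>) \<in> borel_measurable (Pn n)" by measurable
  then have m: "\<phi> \<in> borel_measurable seqs"
    unfolding \<phi>_def by (rule measurable_compose[OF restrict_measurable_seqs])
  have \<phi>eq: "\<phi> z = ennreal \<bar>f' z\<bar>" if "z \<in> extensional {..<n}" for z
    using that by (simp add: \<phi>_def extensional_restrict)
  have ae\<phi>: "AE z in Pn n. ennreal \<bar>f z\<bar> = \<phi> z"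
  proof (rule AE_mp[OF ae], rule AE_I2, rule impI)
    fix z assume "z \<in> space (Pn n)" "f z = f' z"
    then show "ennreal \<bar>f z\<bar> = \<phi> z" by (subst \<phi>eq) (auto simp: space_PiM PiE_def)
  qed
  obtain A where A: "{z \<in> space (Pn n). f z \<noteq> f' z} \<subseteq> A" "A \<in> null_sets (Pn n)"
    using ae by (elim AE_E) (auto simp: null_sets_def)
  have "mixed_norm n q f = mixed q \<phi> n (\<lambda>_. undefined)" for q
    unfolding mixed_norm_def mixed_partial_mixed
  proof (rule mixed_cong_null[OF A(2)])
    fix y assume y: "y \<in> extensional {..<n}" "y \<notin> A"
    then have "f y = f' y" using A(1) by (auto simp: space_PiM PiE_def)
    then show "ennreal \<bar>f y\<bar> = \<phi> y" using y(1) by (simp add: \<phi>eq)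
  qed
  with m ae\<phi> show ?thesis by (intro exI[of _ \<phi>]) simp
qed

text \<open>For 0 < a < b the conjugate of b/a is 1 / (a (1/a - 1/b)); so both sides of the last
  claim are 1 / (p0 d) with d = 1/q0 - 1/q = 1/p0 - 1/p. The upper bound on \<open>q\<close> enters
  as positivity of 1/p.\<close>

lemma conjugate_exponent_arith:
  fixes p0 q0 p q :: real
  assumes "0 < q0" "q0 < p0" "q0 < q" "q < p0 * q0 / (p0 - q0)" "1 / q - 1 / p = 1 / q0 - 1 / p0"
  shows "1 < p / p0" "1 < q / q0"
    "q0 / p0 * (q / q0 / (q / q0 - 1)) = p / p0 / (p / p0 - 1)"
proof -
  have q: "0 < q" and "0 < p0" using assms by linarith+
  show s: "1 < q / q0" using assms by simp
  have "1 / (p0 * q0 / (p0 - q0)) < 1 / q"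
    using assms q by (intro divide_strict_left_mono) auto
  also have "1 / (p0 * q0 / (p0 - q0)) = 1 / q0 - 1 / p0"
    using assms by (simp add: field_simps)
  finally have "0 < 1 / p" using assms(5) by linarith
  then have p: "0 < p" by simp
  have "1 / q < 1 / q0" using assms q by (intro divide_strict_left_mono) auto
  then have "1 / p < 1 / p0" using assms(5) by linarith
  then have "p0 < p" using p assms by (simp add: divide_simps)
  then show r: "1 < p / p0" using assms by simp
  have eq: "1 / q0 - 1 / q = 1 / p0 - 1 / p" using assms(5) by linarith
  have conj: "b / a / (b / a - 1) = 1 / (a * (1 / a - 1 / b))" if "0 < a" "a < b" for a b :: real
  proof -
    have "b / a - 1 = (b - a) / a" "a * (1 / a - 1 / b) = (b - a) / b"
      using that by (simp_all add: field_simps)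
    then show ?thesis using that by simp
  qed
  note 1 = conj[OF assms(1,3)] and 2 = conj[OF \<open>0 < p0\<close> \<open>p0 < p\<close>]
  show "q0 / p0 * (q / q0 / (q / q0 - 1)) = p / p0 / (p / p0 - 1)"
    unfolding 1 2 eq using assms by simp
qed

theorem theorem5p3:
  fixes n :: nat and p0 q0 :: real
    and F :: "(((nat \<Rightarrow> real) \<Rightarrow> real) \<times> ((nat \<Rightarrow> real) \<Rightarrow> real)) set"
  assumes "n \<ge> 1" and "0 < q0" and "q0 < p0"
    and F_meas: "\<forall>(f, g)\<in>F. f \<in> borel_measurable (Rn n) \<and> g \<in> borel_measurable (Rn n)"
    and F_nonneg: "\<forall>(f, g)\<in>F. \<forall>x\<in>space (Rn n). 0 \<le> f x \<and> 0 \<le> g x"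
    and F_nonzero: "\<forall>(f, g)\<in>F. (\<exists>x\<in>space (Rn n). f x \<noteq> 0) \<and> (\<exists>x\<in>space (Rn n). g x \<noteq> 0)"
    and extrap: "\<exists>\<Phi> :: real \<Rightarrow> real. \<forall>w. A1_weight n w \<longrightarrow> (\<forall>(f, g)\<in>F.
        epowr (\<integral>\<^sup>+ x. ennreal (f x powr p0 * w x) \<partial>Rn n) (1 / p0) < \<infinity> \<longrightarrow>
        epowr (\<integral>\<^sup>+ x. ennreal (f x powr p0 * w x) \<partial>Rn n) (1 / p0)
          \<le> ennreal (\<Phi> (A1_const n w)) *
            epowr (\<integral>\<^sup>+ x. ennreal (g x powr q0 * w x powr (q0 / p0)) \<partial>Rn n) (1 / q0))"
  shows "\<forall>q p :: nat \<Rightarrow> real.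
           (\<forall>i<n. q0 < q i \<and> q i < p0 * q0 / (p0 - q0) \<and> 1 / q i - 1 / p i = 1 / q0 - 1 / p0) \<longrightarrow>
           (\<exists>C' :: real. \<forall>(f, g)\<in>F. mixed_norm n p f < \<infinity> \<longrightarrow>
               mixed_norm n p f \<le> ennreal C' * mixed_norm n q g)"
proof (intro allI impI, rule ccontr)
  fix q p :: "nat \<Rightarrow> real"
  assume exps: "\<forall>i<n. q0 < q i \<and> q i < p0 * q0 / (p0 - q0) \<and> 1 / q i - 1 / p i = 1 / q0 - 1 / p0"
    and no: "\<not> (\<exists>C' :: real. \<forall>(f, g)\<in>F. mixed_norm n p f < \<infinity> \<longrightarrow>
               mixed_norm n p f \<le> ennreal C' * mixed_norm n q g)"
  have p0: "0 < p0" using assms(2,3) by simp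
  have q0: "0 < q0" by fact
  obtain \<Phi> where \<Phi>: "\<forall>w. A1_weight n w \<longrightarrow> (\<forall>(f, g)\<in>F.
        epowr (\<integral>\<^sup>+ x. ennreal (f x powr p0 * w x) \<partial>Rn n) (1 / p0) < \<infinity> \<longrightarrow>
        epowr (\<integral>\<^sup>+ x. ennreal (f x powr p0 * w x) \<partial>Rn n) (1 / p0)
          \<le> ennreal (\<Phi> (A1_const n w)) *
            epowr (\<integral>\<^sup>+ x. ennreal (g x powr q0 * w x powr (q0 / p0)) \<partial>Rn n) (1 / q0))"
    using extrap by (rule exE)
  define U :: "nat \<Rightarrow> real" where "U = (\<lambda>_. undefined)"
  have U: "U \<in> space (Pn n)" unfolding U_def by (rule undefined_in_space_Pn)
  \<comment> \<open>f^p0 is measured with exponents \<open>r\<close>, g^q0 with exponents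
    \<open>s\<close>; \<open>r'\<close> is dual to \<open>r\<close> and, by \<open>conj\<close>,
    also q0/p0 times the dual of \<open>s\<close>.\<close>
  define r where "r i = p i / p0" for i
  define s where "s i = q i / q0" for i
  define r' where "r' i = r i / (r i - 1)" for i
  have r1: "1 < r i" and s1: "1 < s i" and conj: "q0 / p0 * (s i / (s i - 1)) = r' i" if "i < n" for i
    unfolding r_def s_def r'_def
    using conjugate_exponent_arith[OF assms(2,3), of "q i" "p i"] exps that by blast+
  have r'1: "1 < r' i" if "i < n" for i using r1[OF that] by (simp add: r'_def)
  \<comment> \<open>The inverse of the loss of the j-th term in \<open>mixed_SUP_le\<close>, so that
    the supremum of the scaled dual functions still has norm at most 1.\<close>
  define \<beta> :: "nat \<Rightarrow> real" where "\<beta> j = 1 / 2 ^ (n * (j + 1))" for j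
  have \<beta>: "0 < \<beta> j" for j by (simp add: \<beta>_def)
  \<comment> \<open>Scaling the j-th dual function by \<beta> j weakens the estimate for the j-th
    pair by (1/\<beta> j)^(1/p0). The violated constants contain this factor and moreover
    \<open>j\<close>, which eventually reaches the fixed \<open>L\<close>.\<close>
  have "\<forall>j::nat. \<exists>fg. fg \<in> F \<and> mixed_norm n p (fst fg) < \<infinity> \<and>
      \<not> mixed_norm n p (fst fg) \<le> ennreal (j * (1 / \<beta> j) powr (1 / p0)) * mixed_norm n q (snd fg)"
  proof (rule allI, rule ccontr)
    fix j :: nat
    assume "\<not> (\<exists>fg. fg \<in> F \<and> mixed_norm n p (fst fg) < \<infinity> \<and>
      \<not> mixed_norm n p (fst fg) \<le> ennreal (j * (1 / \<beta> j) powr (1 / p0)) * mixed_norm n q (snd fg))"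
    then have "\<forall>(f, g)\<in>F. mixed_norm n p f < \<infinity> \<longrightarrow>
        mixed_norm n p f \<le> ennreal (j * (1 / \<beta> j) powr (1 / p0)) * mixed_norm n q g"
      by force
    with no show False by (elim notE) (rule exI)
  qed
  from choice[OF this] obtain fg where fg: "\<And>j::nat. fg j \<in> F" "\<And>j. mixed_norm n p (fst (fg j)) < \<infinity>"
      "\<And>j. \<not> mixed_norm n p (fst (fg j)) \<le> ennreal (j * (1 / \<beta> j) powr (1 / p0)) * mixed_norm n q (snd (fg j))"
    by auto
  define f where "f j = fst (fg j)" for j
  define g where "g j = snd (fg j)" for j
  have fgF: "(f j, g j) \<in> F" for j using fg(1)[of j] by (simp add: f_def g_def)
  have fm: "f j \<in> borel_measurable (Rn n)" and gm: "g j \<in> borel_measurable (Rn n)" for j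
    using F_meas fgF[of j] by auto
  have f0: "0 \<le> f j z" and g0: "0 \<le> g j z" if "z \<in> space (Pn n)" for j z
    using F_nonneg fgF[of j] that by (auto simp: Rn_def)
  have "\<forall>j. \<exists>\<phi>. \<phi> \<in> borel_measurable seqs \<and> (AE z in Pn n. ennreal \<bar>f j z\<bar> = \<phi> z) \<and>
    (\<forall>q. mixed_norm n q (f j) = mixed q \<phi> n U)"
    unfolding U_def by (intro allI mixed_norm_borel_representative fm)
  from choice[OF this] obtain \<phi> where \<phi>m [measurable]: "\<And>j. \<phi> j \<in> borel_measurable seqs"
    and \<phi>ae: "\<And>j. AE z in Pn n. ennreal \<bar>f j z\<bar> = \<phi> j z"
    and \<phi>n: "\<And>j q. mixed_norm n q (f j) = mixed q (\<phi> j) n U" by auto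
  have "\<forall>j. \<exists>\<phi>. \<phi> \<in> borel_measurable seqs \<and> (AE z in Pn n. ennreal \<bar>g j z\<bar> = \<phi> z) \<and>
    (\<forall>q. mixed_norm n q (g j) = mixed q \<phi> n U)"
    unfolding U_def by (intro allI mixed_norm_borel_representative gm)
  from choice[OF this] obtain \<gamma> where \<gamma>m [measurable]: "\<And>j. \<gamma> j \<in> borel_measurable seqs"
    and \<gamma>ae: "\<And>j. AE z in Pn n. ennreal \<bar>g j z\<bar> = \<gamma> j z"
    and \<gamma>n: "\<And>j q. mixed_norm n q (g j) = mixed q (\<gamma> j) n U" by auto

  define P where "P j x = epowr (\<phi> j x) p0" for j x
  have Pm [measurable]: "P j \<in> borel_measurable seqs" for j unfolding P_def by measurable
  have rpos: "0 < r i" and spos: "0 < s i" and r'pos: "0 < r' i" if "i < n" for i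
    using r1[OF that] s1[OF that] r'1[OF that] by auto
  have P_norm: "mixed r (P j) n U = epowr (mixed p (\<phi> j) n U) p0" for j
  proof -
    have "(\<lambda>i. p0 * r i) = p" using p0 by (simp add: r_def)
    then show ?thesis unfolding P_def using mixed_epowr[of p0 n r "\<phi> j" U] p0 rpos by simp
  qed
  have Pfin: "mixed r (P j) n U < top" for j
    using fg(2)[of j] by (simp add: P_norm f_def[symmetric] \<phi>n)
  define H where "H x = (SUP j. ennreal (\<beta> j) * dual_fun r (P j) n x)" for x
  have Hm: "H \<in> borel_measurable seqs" unfolding H_def by measurable
  have "mixed r' H n U \<le> (SUP j. 2 ^ (n * (j + 1)) * mixed r' (\<lambda>x. ennreal (\<beta> j) * dual_fun r (P j) n x) n U)"
    unfolding H_def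
  proof (rule mixed_SUP_le)
    show "1 \<le> r' i" if "i < n" for i using r'1[OF that] by simp
  qed measurable
  also have "\<dots> \<le> 1"
  proof (rule SUP_least)
    fix j
    have e: "(2 ^ (n * (j + 1)) :: ennreal) * ennreal (\<beta> j) = 1"
    proof -
      have "(2 ^ (n * (j + 1)) :: ennreal) = ennreal (2 ^ (n * (j + 1)))"
        using ennreal_power[of 2 "n * (j + 1)"] by simp
      then show ?thesis by (simp add: \<beta>_def flip: ennreal_mult)
    qed
    have d1: "mixed r' (dual_fun r (P j) n) n U \<le> 1"
      unfolding r'_def by (intro mixed_dual_fun_le_1 r1) auto
    have "2 ^ (n * (j + 1)) * mixed r' (\<lambda>x. ennreal (\<beta> j) * dual_fun r (P j) n x) n U
        \<le> 2 ^ (n * (j + 1)) * (ennreal (\<beta> j) * mixed r' (dual_fun r (P j) n) n U)"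
      by (intro mult_left_mono mixed_cmult_le r'pos) auto
    also have "\<dots> = mixed r' (dual_fun r (P j) n) n U"
      by (simp only: mult.assoc[symmetric] e mult_1)
    finally show "2 ^ (n * (j + 1)) * mixed r' (\<lambda>x. ennreal (\<beta> j) * dual_fun r (P j) n x) n U \<le> 1"
      using d1 by (rule order_trans)
  qed
  also have "(1::ennreal) < top" by simp
  finally have Hfin: "mixed r' H n U < top" .

  obtain D :: real where D: "0 < D" "\<And>h x. h \<in> borel_measurable seqs \<Longrightarrow> mixed r' h n x < top \<Longrightarrow>
      \<exists>W\<in>borel_measurable seqs. (\<forall>y. h y \<le> W y) \<and>
        (\<forall>j<n. \<forall>y. coord_max j W y \<le> ennreal D * W y) \<and> mixed r' W n x < top"
    by (rule mixed_majorant[where q=r' and n=n, OF r'1]) (assumption, rule that)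
  from D(2)[OF Hm Hfin] obtain W where Wm [measurable]: "W \<in> borel_measurable seqs"
    and HW: "\<And>y. H y \<le> W y" and WA: "\<And>j y. j < n \<Longrightarrow> coord_max j W y \<le> ennreal D * W y"
    and Wfin: "mixed r' W n U < top" by auto
  have Wae: "AE z in Pn n. W z < top"
  proof -
    have "(\<integral>\<^sup>+ z. indicator {y. W y = top} z \<partial>Pn n) = mixed (\<lambda>_. 1) (indicator {y. W y = top}) n U"
      by (rule nn_integral_Pn[OF _ U]) measurable
    also have "\<dots> = 0" by (rule mixed_finite_AE[OF Wm r'pos Wfin])
    finally have "AE z in Pn n. indicator {y. W y = top} z = (0::ennreal)"
    proof (subst (asm) nn_integral_0_iff_AE)
      show "indicator {y. W y = top} \<in> borel_measurable (Pn n)"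
        by (rule borel_measurable_Pn) measurable
    qed
    then show ?thesis by eventually_elim (auto simp: indicator_def less_top split: if_splits)
  qed
  define w where "w z = enn2real (W z)" for z
  have w: "A1_weight n w"
    unfolding w_def by (rule A1_weight_of_strong[OF assms(1) Wm WA D(1) Wae])
  define \<Lambda> where "\<Lambda> = mixed r' W n U"
  \<comment> \<open>Independent of the pair, since \<open>w\<close> is. It is finite whatever value
    \<Phi> takes at the constant of \<open>w\<close>; a negative value becomes 0.\<close>
  define L where "L = ennreal (\<Phi> (A1_const n w)) * (epowr (2 ^ n) (1 / q0) * epowr \<Lambda> (1 / p0))"
  have two: "(2 ^ n :: ennreal) < top"
    using ennreal_power[of 2 n] ennreal_less_top[of "2 ^ n"] by simp
  have Lfin: "L < top"
    using Wfin two by (simp add: L_def \<Lambda>_def ennreal_mult_less_top)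

  have left: "(\<integral>\<^sup>+ x. ennreal (f j x powr p0 * w x) \<partial>Rn n) = mixed (\<lambda>_. 1) (\<lambda>x. P j x * W x) n U" for j
  proof -
    have "(\<integral>\<^sup>+ x. ennreal (f j x powr p0 * w x) \<partial>Rn n) = (\<integral>\<^sup>+ x. P j x * W x \<partial>Pn n)"
      unfolding Rn_def nn_integral_completion
    proof (rule nn_integral_cong_AE)
      show "AE x in Pn n. ennreal (f j x powr p0 * w x) = P j x * W x"
        using \<phi>ae[of j] Wae AE_space
      proof eventually_elim
        case (elim z)
        have "W z = ennreal (w z)" using elim(2) by (simp add: w_def)
        moreover have "\<phi> j z = ennreal (f j z)" using elim(1) f0[OF elim(3)] by simp
        ultimately show ?case using f0[OF elim(3), of j]
          by (simp add: P_def epowr_ennreal ennreal_mult w_def)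
      qed
    qed
    also have "\<dots> = mixed (\<lambda>_. 1) (\<lambda>x. P j x * W x) n U"
      by (rule nn_integral_Pn[OF _ U]) measurable
    finally show ?thesis .
  qed
  have right: "(\<integral>\<^sup>+ x. ennreal (g j x powr q0 * w x powr (q0 / p0)) \<partial>Rn n)
      = mixed (\<lambda>_. 1) (\<lambda>x. epowr (\<gamma> j x) q0 * epowr (W x) (q0 / p0)) n U" for j
  proof -
    have "(\<integral>\<^sup>+ x. ennreal (g j x powr q0 * w x powr (q0 / p0)) \<partial>Rn n)
       = (\<integral>\<^sup>+ x. epowr (\<gamma> j x) q0 * epowr (W x) (q0 / p0) \<partial>Pn n)"
      unfolding Rn_def nn_integral_completion
    proof (rule nn_integral_cong_AE)
      show "AE x in Pn n. ennreal (g j x powr q0 * w x powr (q0 / p0)) = epowr (\<gamma> j x) q0 * epowr (W x) (q0 / p0)"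
        using \<gamma>ae[of j] Wae AE_space
      proof eventually_elim
        case (elim z)
        have "W z = ennreal (w z)" using elim(2) by (simp add: w_def)
        then have "epowr (W z) (q0 / p0) = ennreal (w z powr (q0 / p0))"
          by (simp only:) (rule epowr_ennreal, simp add: w_def)
        moreover have "\<gamma> j z = ennreal (g j z)" using elim(1) g0[OF elim(3)] by simp
        ultimately show ?case using g0[OF elim(3), of j]
          by (simp add: epowr_ennreal ennreal_mult)
      qed
    qed
    also have "\<dots> = mixed (\<lambda>_. 1) (\<lambda>x. epowr (\<gamma> j x) q0 * epowr (W x) (q0 / p0)) n U"
      by (rule nn_integral_Pn[OF _ U]) measurable
    finally show ?thesis .
  qed

  \<comment> \<open>The hypothesis only speaks of pairs with finite left side; Hoelder's inequality
    and the finite norm of \<open>f j\<close> supply this.\<close>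
  have upper: "mixed (\<lambda>_. 1) (\<lambda>x. P j x * W x) n U < top" for j
  proof -
    have "mixed (\<lambda>_. 1) (\<lambda>x. P j x * W x) n U \<le> 2 ^ n * (mixed r (P j) n U * \<Lambda>)"
      unfolding \<Lambda>_def r'_def by (intro mixed_holder r1) auto
    also have "\<dots> < top" using two Pfin[of j] Wfin by (simp add: \<Lambda>_def ennreal_mult_less_top)
    finally show ?thesis .
  qed
  have lower: "ennreal (\<beta> j) * mixed r (P j) n U \<le> mixed (\<lambda>_. 1) (\<lambda>x. P j x * W x) n U" for j
  proof -
    have "ennreal (\<beta> j) * mixed r (P j) n U \<le> ennreal (\<beta> j) * mixed (\<lambda>_. 1) (\<lambda>y. P j y * dual_fun r (P j) n y) n U"
      by (intro mult_left_mono mixed_le_dual_fun r1 Pfin) auto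
    also have "\<dots> = mixed (\<lambda>_. 1) (\<lambda>y. ennreal (\<beta> j) * (P j y * dual_fun r (P j) n y)) n U"
      by (rule mixed_mult_above[symmetric]) auto
    also have "\<dots> \<le> mixed (\<lambda>_. 1) (\<lambda>x. P j x * W x) n U"
    proof (rule mixed_mono)
      fix y
      have "ennreal (\<beta> j) * dual_fun r (P j) n y \<le> H y" unfolding H_def by (rule SUP_upper) simp
      then have "ennreal (\<beta> j) * dual_fun r (P j) n y \<le> W y" using HW by (rule order_trans)
      then have "P j y * (ennreal (\<beta> j) * dual_fun r (P j) n y) \<le> P j y * W y" by (rule mult_left_mono) simp
      then show "ennreal (\<beta> j) * (P j y * dual_fun r (P j) n y) \<le> P j y * W y"
        by (simp only: mult.left_commute)
    qed simp
    finally show ?thesis .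
  qed
  have gbound: "epowr (mixed (\<lambda>_. 1) (\<lambda>x. epowr (\<gamma> j x) q0 * epowr (W x) (q0 / p0)) n U) (1 / q0)
      \<le> epowr (2 ^ n) (1 / q0) * (mixed q (\<gamma> j) n U * epowr \<Lambda> (1 / p0))" for j
  proof -
    let ?s' = "\<lambda>i. s i / (s i - 1)"
    have "mixed (\<lambda>_. 1) (\<lambda>x. epowr (\<gamma> j x) q0 * epowr (W x) (q0 / p0)) n U
      \<le> 2 ^ n * (mixed s (\<lambda>x. epowr (\<gamma> j x) q0) n U * mixed ?s' (\<lambda>x. epowr (W x) (q0 / p0)) n U)"
      by (intro mixed_holder s1) measurable
    also have "mixed s (\<lambda>x. epowr (\<gamma> j x) q0) n U = epowr (mixed q (\<gamma> j) n U) q0"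
    proof -
      have "(\<lambda>i. q0 * s i) = q" using q0 by (simp add: s_def)
      then show ?thesis using mixed_epowr[of q0 n s "\<gamma> j" U] q0 spos by simp
    qed
    \<comment> \<open>The exponent relation at work: the norm of W^(q0/p0) dual to \<open>s\<close>
      is again a power of \<Lambda>.\<close>
    also have "mixed ?s' (\<lambda>x. epowr (W x) (q0 / p0)) n U = epowr \<Lambda> (q0 / p0)"
    proof -
      have "mixed ?s' (\<lambda>x. epowr (W x) (q0 / p0)) n U = epowr (mixed (\<lambda>i. q0 / p0 * ?s' i) W n U) (q0 / p0)"
        using p0 q0 s1 by (intro mixed_epowr) (auto intro!: divide_pos_pos intro: less_trans[OF zero_less_one])
      also have "mixed (\<lambda>i. q0 / p0 * ?s' i) W n U = \<Lambda>"
        unfolding \<Lambda>_def by (intro mixed_cong_exponents conj)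
      finally show ?thesis .
    qed
    finally have "epowr (mixed (\<lambda>_. 1) (\<lambda>x. epowr (\<gamma> j x) q0 * epowr (W x) (q0 / p0)) n U) (1 / q0)
       \<le> epowr (2 ^ n * (epowr (mixed q (\<gamma> j) n U) q0 * epowr \<Lambda> (q0 / p0))) (1 / q0)"
      using q0 by (intro epowr_mono) auto
    also have "\<dots> = epowr (2 ^ n) (1 / q0) * (mixed q (\<gamma> j) n U * epowr \<Lambda> (1 / p0))"
      using q0 by (simp add: epowr_mult epowr_epowr)
    finally show ?thesis .
  qed

  have main: "epowr (ennreal (\<beta> j)) (1 / p0) * mixed p (\<phi> j) n U \<le> L * mixed q (\<gamma> j) n U" for j
  proof -
    have "epowr (ennreal (\<beta> j)) (1 / p0) * mixed p (\<phi> j) n U = epowr (ennreal (\<beta> j) * mixed r (P j) n U) (1 / p0)"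
      using p0 by (simp add: epowr_mult P_norm epowr_inv)
    also have "\<dots> \<le> epowr (mixed (\<lambda>_. 1) (\<lambda>x. P j x * W x) n U) (1 / p0)"
      using p0 by (intro epowr_mono lower) auto
    also have "\<dots> \<le> ennreal (\<Phi> (A1_const n w)) *
       epowr (mixed (\<lambda>_. 1) (\<lambda>x. epowr (\<gamma> j x) q0 * epowr (W x) (q0 / p0)) n U) (1 / q0)"
    proof -
      have "epowr (mixed (\<lambda>_. 1) (\<lambda>x. P j x * W x) n U) (1 / p0) < \<infinity>" using upper[of j] by simp
      then show ?thesis using \<Phi>[rule_format, OF w fgF[of j]] by (simp only: left right prod.case)
    qed
    also have "\<dots> \<le> ennreal (\<Phi> (A1_const n w)) * (epowr (2 ^ n) (1 / q0) * (mixed q (\<gamma> j) n U * epowr \<Lambda> (1 / p0)))"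
      by (intro mult_left_mono gbound) simp
    also have "\<dots> = L * mixed q (\<gamma> j) n U" unfolding L_def by (simp only: mult_ac)
    finally show ?thesis .
  qed
  obtain l where l: "L = ennreal l" "0 \<le> l" using Lfin by (cases L) auto
  \<comment> \<open>For this \<open>j\<close> the bound by \<open>L\<close> already implies the
    estimate that the j-th pair violates.\<close>
  obtain j :: nat where j: "l \<le> real j" using real_arch_simple[of l] by auto
  have "mixed p (\<phi> j) n U = ennreal ((1 / \<beta> j) powr (1 / p0)) * (epowr (ennreal (\<beta> j)) (1 / p0) * mixed p (\<phi> j) n U)"
  proof -
    have "ennreal ((1 / \<beta> j) powr (1 / p0)) * epowr (ennreal (\<beta> j)) (1 / p0) = 1"
      using \<beta>[of j] by (simp add: epowr_ennreal powr_divide flip: ennreal_mult)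
    then show ?thesis by (simp only: mult.assoc[symmetric] mult_1)
  qed
  also have "\<dots> \<le> ennreal ((1 / \<beta> j) powr (1 / p0)) * (L * mixed q (\<gamma> j) n U)"
    by (intro mult_left_mono main) simp
  also have "\<dots> \<le> ennreal ((1 / \<beta> j) powr (1 / p0)) * (ennreal j * mixed q (\<gamma> j) n U)"
    unfolding l(1) by (intro mult_left_mono mult_right_mono ennreal_leI j) auto
  also have "\<dots> = ennreal (j * (1 / \<beta> j) powr (1 / p0)) * mixed q (\<gamma> j) n U"
    by (simp add: ennreal_mult mult_ac)
  finally have "mixed_norm n p (f j) \<le> ennreal (j * (1 / \<beta> j) powr (1 / p0)) * mixed_norm n q (g j)"
    unfolding \<phi>n \<gamma>n .
  with fg(3)[of j] show False unfolding f_def g_def by simp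
qed

end
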